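(* Let $s=a+ib$ with $a\ge1$, $b\in\mathbb{R}$, and let $k\in[0,1)$ satisfy $|b/s|\le k$. Let $g$ be analytic in $\mathbb{D}^*$ with expansion $g(\zeta)=\zeta+\frac{d}{\zeta}+\cdots$ near $\infty$, and suppose that for all $\zeta\in\mathbb{D}^*$ (with $\zeta\neq\infty$; the expression being defined and finite there) $$\left|ib+(1-|\zeta|^2)a\left\{(1-s)\left(1-\frac{\zeta g'(\zeta)}{g(\zeta)}\right)-s\frac{\zeta g''(\zeta)}{g'(\zeta)}\right\}\right|\le ak|s|-|b|(a-1).$$ Then $g$ extends to an $l$-quasiconformal automorphism of $\widehat{\mathbb{C}}$, where $$l=\frac{2ka+(1-k^2)|b|}{(1+k^2)a+(1-k^2)|s|}.$$
   Context: $\widehat{\mathbb{C}}=\mathbb{C}\cup\{\infty\}$ is the Riemann sphere and $\mathbb{D}^*=\{\zeta\in\widehat{\mathbb{C}}:|\zeta|>1\}$ (including $\infty$). A sense-preserving homeomorphism $F$ of a domain $G$ is $k$-quasiconformal ($0\le k<1$) if $F$ is absolutely continuous on almost all lines parallel to the coordinate axes and $|F_{\bar z}|\le k|F_z|$ almost everywhere in $G$ (in local coordinates near $\infty$). An $l$-quasiconformal automorphism of $\widehat{\mathbb{C}}$ extending $g$ is such a homeomorphism of $\widehat{\mathbb{C}}$ onto itself whose restriction to $\mathbb{D}^*$ is $g$. *)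

theory Defs
  imports "HOL-Analysis.Analysis"
begin

definition abs_cont_on_interval :: "(real \<Rightarrow> complex) \<Rightarrow> real \<Rightarrow> real \<Rightarrow> bool" where
  "abs_cont_on_interval f c d \<longleftrightarrow>
     (\<forall>\<epsilon>>0. \<exists>\<delta>>0. \<forall>(n::nat) (p::nat \<Rightarrow> real) (q::nat \<Rightarrow> real).
        (\<forall>i<n. c \<le> p i \<and> p i \<le> q i \<and> q i \<le> d) \<longrightarrow>
        (\<forall>i<n. \<forall>j<n. i \<noteq> j \<longrightarrow> q i \<le> p j \<or> q j \<le> p i) \<longrightarrow>
        (\<Sum>i<n. q i - p i) < \<delta> \<longrightarrow>
        (\<Sum>i<n. cmod (f (q i) - f (p i))) < \<epsilon>)"

definition ACL_on :: "(complex \<Rightarrow> complex) \<Rightarrow> complex set \<Rightarrow> bool" where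
  "ACL_on F G \<longleftrightarrow>
     (AE y in lborel. \<forall>c d. c \<le> d \<and> (\<forall>t\<in>{c..d}. Complex t y \<in> G) \<longrightarrow>
        abs_cont_on_interval (\<lambda>t. F (Complex t y)) c d) \<and>
     (AE x in lborel. \<forall>c d. c \<le> d \<and> (\<forall>t\<in>{c..d}. Complex x t \<in> G) \<longrightarrow>
        abs_cont_on_interval (\<lambda>t. F (Complex x t)) c d)"

text \<open>Dilatation condition: a.e. in G the partials F_x, F_y exist and
  |F_zbar| \<le> k |F_z|, where F_z = (F_x - i F_y)/2, F_zbar = (F_x + i F_y)/2.\<close>
definition beltrami_bound_on :: "real \<Rightarrow> (complex \<Rightarrow> complex) \<Rightarrow> complex set \<Rightarrow> bool" where
  "beltrami_bound_on k F G \<longleftrightarrow>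
     (AE z in lborel. z \<in> G \<longrightarrow>
        (\<exists>px py. ((\<lambda>t. F (z + of_real t)) has_vector_derivative px) (at 0) \<and>
                 ((\<lambda>t. F (z + \<i> * of_real t)) has_vector_derivative py) (at 0) \<and>
                 cmod ((px + \<i> * py) / 2) \<le> k * cmod ((px - \<i> * py) / 2)))"

definition qc_on :: "real \<Rightarrow> (complex \<Rightarrow> complex) \<Rightarrow> complex set \<Rightarrow> bool" where
  "qc_on k F G \<longleftrightarrow> open G \<and> (\<exists>h. homeomorphism G (F ` G) F h) \<and> ACL_on F G \<and> beltrami_bound_on k F G"

text \<open>An l-quasiconformal automorphism of the Riemann sphere extending g (given on |z|>1,
  with g(\<infinity>) = \<infinity>): since the extension must fix \<infinity>, it is represented by its restriction
  F to C, which must be a homeomorphism of C onto C, l-qc on C, agree with g on |z|>1,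
  and be l-qc in the local coordinate w = 1/z near \<infinity> (chart map w \<mapsto> 1/F(1/w), 0 \<mapsto> 0).\<close>
definition qc_automorphism_extending :: "real \<Rightarrow> (complex \<Rightarrow> complex) \<Rightarrow> (complex \<Rightarrow> complex) \<Rightarrow> bool" where
  "qc_automorphism_extending l g F \<longleftrightarrow>
     (\<exists>h. homeomorphism UNIV UNIV F h) \<and>
     qc_on l F UNIV \<and>
     (\<forall>z. 1 < cmod z \<longrightarrow> F z = g z) \<and>
     qc_on l (\<lambda>w. if w = 0 then 0 else inverse (F (inverse w))) (ball 0 1)"

end

(* Write s log for the complex power and w = e^v, so that G(v) = g(e^v) lives on Re v > 0; put
   P = G'/G and Q = P + s P'/P.  The hypothesis says |ib + a(1 - e^(2x))(1 - Q)| <= ak|s| - |b|(a - 1)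
   with x = Re v, and it forces |E| <= k|s| for E = ib + a(1 - 1/c)(1 - Q), e^(-2x/a) <= c <= 1.
   The Loewner chain is Psi(c, v) = G(v) (1 - (1 - c) P(v))^s; along the boundary c = e^(-2x/a)
   it gives the extension
     F(1/cnj w) = g(w) (1 + (|w|^(-2/a) - 1) w g'(w)/g(w))^s,
   whose complex dilatation has modulus |E/s| <= k, and k is at most the bound l of the theorem.

   Global injectivity comes from replacing the reflection x -> |x| by a C^1 convex regularisation
   mu_T: the resulting maps F_T have positive Jacobian, hence are proper local homeomorphisms of
   the punctured plane which are injective near infinity, so they are homeomorphisms of C.
   F_T = F outside the annulus e^(-T) < |z| < e^T.  Comparing with F_T bounds |g| from above and
   below near the circle, Bloch's theorem then yields x|P| -> 0, and this makes the logarithmic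
   derivative of P small enough to get |g'| = O((|w| - 1)^(-beta)) with beta < 1.  So F_T
   converges uniformly to F, absolute continuity on lines follows from the integrable
   singularity, and the fibres of F, being limits of homeomorphisms, are connected: a
   nontrivial one would be an arc of the circle on which g is constant. *)

theory Submission
  imports Defs "HOL-Complex_Analysis.Complex_Analysis"
begin

section \<open>Homeomorphisms of the plane\<close>

text \<open>One elementary fact drives the proof: |E| < |s| is equivalent to Re (s/(s - E)) > 1/2.
  In the logarithmic coordinate x + iy the differential of F_T is, up to a nonzero factor, (m + (1 -
  m) s/(s - E)) dx + i dy with m = mu_T'(x), and the threshold 1/2 is just what a positive Jacobian
  needs for slopes m down to -1, the slope of the reflection. The same threshold controls the zeros
  of 1 - (1 - c) P and so makes the power s meaningful. The inequality mu_T >= |x| says exactly that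
  c = exp((x - mu_T)/a) and Re v = mu_T stay in the region where |E| <= k|s| is available. The
  obstacle is the circle: neither boundary values of g nor its injectivity are given, so F has no
  formula there at first. F_T avoids this because its v never leaves Re v > 0; even the injectivity
  of g is read off from F_T. The exponent 2/a comes from the origin: |c^s| = c^a = exp(-2x), so
  there the modulus of Psi is of order exp(x - 2x) = exp(-x), the modulus of the reflected
  point.\<close>

lemma bounded_preimage_at_infinity:
  fixes f :: "complex \<Rightarrow> complex"
  assumes "filterlim f at_infinity at_infinity"
  shows "bounded {z. cmod (f z) \<le> M}"
proof -
  have "eventually (\<lambda>z. cmod (f z) \<ge> M + 1) at_infinity"
    using assms unfolding filterlim_at_infinity[OF order_refl]
    by (metis eventually_mono filterlim_at_infinity_imp_norm_at_top assms filterlim_at_top)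
  then obtain b where b: "\<And>z. cmod z \<ge> b \<Longrightarrow> cmod (f z) \<ge> M + 1"
    unfolding eventually_at_infinity by blast
  have "{z. cmod (f z) \<le> M} \<subseteq> ball 0 b"
  proof
    fix z assume "z \<in> {z. cmod (f z) \<le> M}"
    thus "z \<in> ball 0 b" using b[of z] by (cases "cmod z < b") auto
  qed
  thus ?thesis using bounded_ball bounded_subset by blast
qed

text \<open>Invariance of domain makes the range open and properness makes it closed, so
  connectedness of the plane gives surjectivity.\<close>

lemma inj_proper_imp_homeomorphism:
  fixes f :: "complex \<Rightarrow> complex"
  assumes cont: "continuous_on UNIV f" and inj: "inj f"
    and inf: "filterlim f at_infinity at_infinity"
  obtains h where "homeomorphism UNIV UNIV f h"
proof -
  have "open (range f)"
    using invariance_of_domain[OF cont _ inj] by simp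
  moreover have "closed (range f)"
    unfolding closed_sequential_limits
  proof (intro allI impI, elim conjE)
    fix p l assume p: "\<forall>n. p n \<in> range f" and l: "p \<longlonglongrightarrow> l"
    have "\<forall>n. \<exists>z. p n = f z" using p by blast
    then obtain z where z: "\<And>n. p n = f (z n)" by metis
    have "bounded (range p)" using l convergent_imp_bounded by blast
    then obtain M where M: "\<And>n. cmod (p n) \<le> M" by (auto simp: bounded_iff)
    have "range z \<subseteq> {z. cmod (f z) \<le> M}" using M z by auto
    hence "bounded (range z)" using bounded_preimage_at_infinity[OF inf] bounded_subset by blast
    then obtain y r where r: "strict_mono r" "(z \<circ> r) \<longlonglongrightarrow> y"
      using bounded_imp_convergent_subsequence by blast
    have "(\<lambda>n. f ((z \<circ> r) n)) \<longlonglongrightarrow> f y"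
      using continuous_on_tendsto_compose[OF cont r(2)] by simp
    hence "(p \<circ> r) \<longlonglongrightarrow> f y" by (simp add: z o_def)
    moreover have "(p \<circ> r) \<longlonglongrightarrow> l" using l r(1) LIMSEQ_subseq_LIMSEQ by blast
    ultimately show "l \<in> range f" using LIMSEQ_unique by blast
  qed
  ultimately have "range f = {} \<or> range f = UNIV" using clopen[of "range f"] by simp
  hence eq: "range f = UNIV" by simp
  obtain h where "homeomorphism UNIV (range f) f h"
    by (rule invariance_of_domain_homeomorphism[OF open_UNIV cont order.refl inj])
  thus ?thesis using eq that by simp
qed

text \<open>Within the punctured plane the set \<open>A\<close> of values taken at least twice is
  open and relatively closed, hence empty or everything; large values are attained only where
  \<open>f\<close> is injective, so it is empty. The origin is treated apart because the regularised
  maps are not known to be locally injective there.\<close>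

lemma locally_injective_imp_inj:
  fixes f :: "complex \<Rightarrow> complex"
  assumes cont: "continuous_on UNIV f" and f0: "f 0 = 0" and nz: "\<And>z. z \<noteq> 0 \<Longrightarrow> f z \<noteq> 0"
    and loc: "\<And>z. z \<noteq> 0 \<Longrightarrow> \<exists>r>0. inj_on f (ball z r)"
    and inf: "filterlim f at_infinity at_infinity"
    and injR: "inj_on f {z. R < cmod z}"
  shows "inj f"
proof -
  define A where "A = {p. p \<noteq> 0 \<and> (\<exists>z1 z2. z1 \<noteq> z2 \<and> f z1 = p \<and> f z2 = p)}"
  have opn: "\<exists>r>0. r \<le> e \<and> open (f ` ball z r) \<and> inj_on f (ball z r)" if z0: "z \<noteq> 0" "e > 0" for z e
  proof -
    obtain r where r: "r > 0" "inj_on f (ball z r)" using loc[OF z0(1)] by blast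
    have i: "inj_on f (ball z (min r e))"
      by (rule inj_on_subset[OF r(2)]) auto
    have "open (f ` ball z (min r e))"
      by (rule invariance_of_domain) (use i cont continuous_on_subset in auto)
    thus ?thesis using i z0 r by (intro exI[of _ "min r e"]) auto
  qed
  have opA: "open A"
    unfolding open_subopen[of A]
  proof
    fix p assume "p \<in> A"
    then obtain z1 z2 where z: "p \<noteq> 0" "z1 \<noteq> z2" "f z1 = p" "f z2 = p" unfolding A_def by blast
    have nz12: "z1 \<noteq> 0" "z2 \<noteq> 0" using z f0 by auto
    define e where "e = dist z1 z2 / 2"
    have e: "e > 0" using z by (simp add: e_def)
    obtain r1 where r1: "r1 > 0" "r1 \<le> e" "open (f ` ball z1 r1)" using opn[OF nz12(1) e] by blast
    obtain r2 where r2: "r2 > 0" "r2 \<le> e" "open (f ` ball z2 r2)" using opn[OF nz12(2) e] by blast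
    have disj: "x \<noteq> y" if "x \<in> ball z1 r1" "y \<in> ball z2 r2" for x y
    proof
      assume "x = y"
      hence "dist z1 z2 < r1 + r2" using that dist_triangle[of z1 z2 x] by (simp add: dist_commute)
      thus False using r1 r2 by (simp add: e_def)
    qed
    let ?V = "f ` ball z1 r1 \<inter> f ` ball z2 r2 \<inter> - {0}"
    have "open ?V" using r1 r2 by (intro open_Int) auto
    moreover have "p \<in> ?V"
    proof -
      have "f z1 \<in> f ` ball z1 r1" "f z2 \<in> f ` ball z2 r2" using r1 r2 by simp_all
      thus ?thesis using z by simp
    qed
    moreover have "?V \<subseteq> A"
    proof
      fix q assume q: "q \<in> ?V"
      then obtain x y where "x \<in> ball z1 r1" "y \<in> ball z2 r2" "q = f x" "q = f y" by blast
      thus "q \<in> A" using disj[of x y] q unfolding A_def by auto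
    qed
    ultimately show "\<exists>T. open T \<and> p \<in> T \<and> T \<subseteq> A" by blast
  qed
  have lim: "p \<in> A" if pn: "\<And>n. q n \<in> A" and l: "q \<longlonglongrightarrow> p" and p0: "p \<noteq> 0" for q p
  proof -
    have "\<forall>n. \<exists>z. fst z \<noteq> snd z \<and> f (fst z) = q n \<and> f (snd z) = q n"
      using pn unfolding A_def by auto
    then obtain z where z: "\<And>n. fst (z n) \<noteq> snd (z n)" "\<And>n. f (fst (z n)) = q n" "\<And>n. f (snd (z n)) = q n"
      by metis
    have "bounded (range q)" using l convergent_imp_bounded by blast
    then obtain M where M: "\<And>n. cmod (q n) \<le> M" by (auto simp: bounded_iff)
    have "range z \<subseteq> {z. cmod (f z) \<le> M} \<times> {z. cmod (f z) \<le> M}" 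
      using M z by (auto simp: image_subset_iff mem_Times_iff)
    hence "bounded (range z)" using bounded_preimage_at_infinity[OF inf] bounded_subset bounded_Times by blast
    then obtain y r where r: "strict_mono r" "(z \<circ> r) \<longlonglongrightarrow> y"
      using bounded_imp_convergent_subsequence by blast
    have y1: "(\<lambda>n. fst (z (r n))) \<longlonglongrightarrow> fst y" and y2: "(\<lambda>n. snd (z (r n))) \<longlonglongrightarrow> snd y"
      using tendsto_fst[OF r(2)] tendsto_snd[OF r(2)] by (auto simp: o_def)
    have qr: "(\<lambda>n. q (r n)) \<longlonglongrightarrow> p" using l r(1) LIMSEQ_subseq_LIMSEQ[of q p r] by (simp add: o_def)
    have "(\<lambda>n. q (r n)) \<longlonglongrightarrow> f (fst y)"
      using continuous_on_tendsto_compose[OF cont y1] by (simp add: z)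
    hence f1: "f (fst y) = p" using qr LIMSEQ_unique by blast
    have "(\<lambda>n. q (r n)) \<longlonglongrightarrow> f (snd y)"
      using continuous_on_tendsto_compose[OF cont y2] by (simp add: z)
    hence f2: "f (snd y) = p" using qr LIMSEQ_unique by blast
    \<comment> \<open>Two preimages that merged in the limit would eventually lie in one ball on
      which \<open>f\<close> is injective.\<close>
    have "fst y \<noteq> snd y"
    proof
      assume eq: "fst y = snd y"
      have "fst y \<noteq> 0" using f1 p0 f0 by auto
      then obtain e where e: "e > 0" "inj_on f (ball (fst y) e)" using loc by blast
      have "\<forall>\<^sub>F n in sequentially. fst (z (r n)) \<in> ball (fst y) e"
        using tendstoD[OF y1 e(1)] by (simp add: dist_commute)
      moreover have "\<forall>\<^sub>F n in sequentially. snd (z (r n)) \<in> ball (fst y) e"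
        using tendstoD[OF y2 e(1)] eq by (simp add: dist_commute)
      ultimately have "\<forall>\<^sub>F n in sequentially. False"
      proof eventually_elim
        case (elim n)
        thus ?case using e(2) z(1)[of "r n"] z(2)[of "r n"] z(3)[of "r n"] by (metis inj_onD)
      qed
      thus False by simp
    qed
    thus ?thesis using f1 f2 p0 unfolding A_def by blast
  qed
  have "closedin (top_of_set (-{0})) A"
    unfolding closedin_limpt
  proof (intro conjI allI impI)
    show "A \<subseteq> - {0}" by (auto simp: A_def)
    fix x assume x: "x islimpt A \<and> x \<in> - {0}"
    then obtain q where "\<And>n. q n \<in> A" "q \<longlonglongrightarrow> x" by (auto simp: islimpt_sequential)
    thus "x \<in> A" using lim x by blast
  qed
  moreover have "openin (top_of_set (-{0})) A"
    using opA by (subst openin_open_eq) (auto simp: A_def)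
  moreover have "connected (- {0::complex})"
    by (rule connected_punctured_universe) simp
  ultimately have "A = {} \<or> A = - {0}" unfolding connected_clopen by blast
  moreover have "A \<noteq> - {0}"
  proof
    assume eq: "A = -{0}"
    have "compact (f ` cball 0 R)"
      by (rule compact_continuous_image) (use cont continuous_on_subset in auto)
    then obtain M where M: "\<And>z. cmod z \<le> R \<Longrightarrow> cmod (f z) \<le> M"
      using compact_imp_bounded[of "f ` cball 0 R"] unfolding bounded_iff by force
    have "of_real (\<bar>M\<bar> + 1) \<in> A" unfolding eq Compl_iff singleton_iff of_real_eq_0_iff by linarith
    then obtain z1 z2 where z: "z1 \<noteq> z2" "f z1 = of_real (\<bar>M\<bar> + 1)" "f z2 = of_real (\<bar>M\<bar> + 1)"
      unfolding A_def by auto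
    have *: "R < cmod z" if "f z = of_real (\<bar>M\<bar> + 1)" for z
    proof (rule ccontr)
      assume "\<not> R < cmod z"
      hence "cmod (of_real (\<bar>M\<bar> + 1)) \<le> M" using M[of z] that by simp
      thus False by (simp add: abs_if split: if_splits)
    qed
    show False using inj_onD[OF injR, of z1 z2] z *[of z1] *[of z2] by simp
  qed
  ultimately have A0: "A = {}" by blast
  show "inj f"
  proof (rule injI, rule ccontr)
    fix x y assume xy: "f x = f y" "x \<noteq> y"
    have "f x \<noteq> 0" using xy nz by metis
    hence "f x \<in> A" using xy unfolding A_def by auto
    thus False using A0 by blast
  qed
qed

text \<open>If the fibre split into closed pieces \<open>K1\<close> and \<open>K2\<close>, the
  points equidistant from them would form a wall on which \<open>F\<close> keeps a distance
  \<open>m\<close> from \<open>p\<close>. For \<open>f n\<close> uniformly close to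
  \<open>F\<close>, the preimage under \<open>f n\<close> of a small disc about \<open>p\<close> is
  connected and contains the whole fibre, so it meets the wall; but \<open>F\<close> is close to
  \<open>p\<close> on that preimage.\<close>

lemma connected_fibre_of_homeomorphism_limit:
  fixes f :: "nat \<Rightarrow> complex \<Rightarrow> complex"
  assumes hom: "\<And>n. \<exists>h. homeomorphism UNIV UNIV (f n) h"
    and ul: "uniform_limit UNIV f F sequentially"
    and cont: "continuous_on UNIV F"
    and inf: "filterlim F at_infinity at_infinity"
  shows "connected (F -` {p})"
proof (rule ccontr)
  assume "\<not> connected (F -` {p})"
  moreover have cl: "closed (F -` {p})"
    using cont by (simp add: continuous_closed_vimage continuous_on_eq_continuous_at)
  ultimately obtain K1 K2 where K: "closed K1" "closed K2" "K1 \<noteq> {}" "K2 \<noteq> {}" "K1 \<union> K2 = F -` {p}" "K1 \<inter> K2 = {}"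
    unfolding connected_closed_set[OF cl] by blast
  define D where "D z = infdist z K1 - infdist z K2" for z
  have contD: "continuous_on S D" for S unfolding D_def by (intro continuous_intros)
  have D1: "D z < 0" if "z \<in> K1" for z
  proof -
    have "infdist z K1 = 0" using that by simp
    moreover have "infdist z K2 > 0"
      using that K in_closed_iff_infdist_zero[OF K(2,4), of z] infdist_nonneg[of z K2] by fastforce
    ultimately show ?thesis by (simp add: D_def)
  qed
  have D2: "D z > 0" if "z \<in> K2" for z
  proof -
    have "infdist z K2 = 0" using that by simp
    moreover have "infdist z K1 > 0"
      using that K in_closed_iff_infdist_zero[OF K(1,3), of z] infdist_nonneg[of z K1] by fastforce
    ultimately show ?thesis by (simp add: D_def)
  qed
  \<comment> \<open>The bound on |F| makes this part of the wall compact; on the rest |F - p| is at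
    least 1 anyway.\<close>
  define C where "C = {z. D z = 0} \<inter> {z. cmod (F z) \<le> cmod p + 1}"
  have "closed C" unfolding C_def
    by (intro closed_Int closed_Collect_eq closed_Collect_le continuous_intros contD cont)
  moreover have "bounded C"
    unfolding C_def using bounded_preimage_at_infinity[OF inf] bounded_subset by blast
  ultimately have comp: "compact C" by (simp add: compact_eq_bounded_closed)
  have "\<exists>m>0. m \<le> 1 \<and> (\<forall>z. D z = 0 \<longrightarrow> cmod (F z - p) \<ge> m)"
  proof -
    have Fp: "F z \<noteq> p" if "D z = 0" for z
      using D1[of z] D2[of z] that K(5) by auto
    have far: "cmod (F z - p) \<ge> 1" if "D z = 0" "z \<notin> C" for z
      using that norm_triangle_ineq2[of "F z" p] unfolding C_def by auto
    show ?thesis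
    proof (cases "C = {}")
      case True thus ?thesis using far by (intro exI[of _ 1]) auto
    next
      case False
      have "continuous_on C (\<lambda>z. cmod (F z - p))"
        by (intro continuous_intros continuous_on_subset[OF cont]) auto
      then obtain x where x: "x \<in> C" "\<And>y. y \<in> C \<Longrightarrow> cmod (F x - p) \<le> cmod (F y - p)"
        using continuous_attains_inf[OF comp False] by blast
      have "F x \<noteq> p" using x Fp C_def by auto
      thus ?thesis using far x by (intro exI[of _ "min 1 (cmod (F x - p))"]) (auto simp: min_le_iff_disj)
    qed
  qed
  then obtain m where m: "m > 0" "\<And>z. D z = 0 \<Longrightarrow> cmod (F z - p) \<ge> m" by blast
  have "\<forall>\<^sub>F n in sequentially. \<forall>x\<in>UNIV. dist (f n x) (F x) < m/3"
    using uniform_limitD[OF ul, of "m/3"] m by simp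
  then obtain n where n: "\<And>x. dist (f n x) (F x) < m/3"
    unfolding eventually_sequentially by blast
  obtain h where h: "homeomorphism UNIV UNIV (f n) h" using hom by blast
  have hf: "h (f n x) = x" and fh: "f n (h x) = x" for x
    using h by (auto simp: homeomorphism_def)
  define B where "B = h ` ball p (m/2)"
  have "connected B" unfolding B_def
    by (intro connected_continuous_image connected_ball continuous_on_subset[OF homeomorphism_cont2[OF h]]) auto
  hence cD: "connected (D ` B)" by (intro connected_continuous_image contD)
  have memB: "z \<in> B" if "F z = p" for z
  proof -
    have "f n z \<in> ball p (m/2)" using n[of z] that m by (simp add: dist_commute)
    hence "h (f n z) \<in> B" unfolding B_def by (rule imageI)
    thus ?thesis using hf by simp
  qed
  obtain z1 z2 where z: "z1 \<in> K1" "z2 \<in> K2" using K by blast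
  have "F z1 = p" "F z2 = p" using z K(5) by auto
  hence "D z1 \<in> D ` B" "D z2 \<in> D ` B" using memB by auto
  hence "0 \<in> D ` B" using connectedD_interval[OF cD, of "D z1" "D z2" 0] D1[OF z(1)] D2[OF z(2)] by auto
  then obtain z where zB: "z \<in> B" "D z = 0" by force
  then obtain q where q: "q \<in> ball p (m/2)" "z = h q" unfolding B_def by blast
  have "dist (f n z) p < m/2" using q fh by (simp add: dist_commute)
  hence "dist (F z) p < m/2 + m/3" using n[of z] dist_triangle[of "F z" p "f n z"] by (simp add: dist_commute)
  moreover have "dist (F z) p \<ge> m" using m(2)[OF zB(2)] by (simp add: dist_norm)
  ultimately show False using m(1) by simp
qed

section \<open>Absolute continuity on intervals\<close>

lemma has_vector_derivative_Complex_left: "((\<lambda>x. Complex x y) has_vector_derivative 1) (at x)"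
  unfolding has_vector_derivative_complex_iff by (auto intro!: derivative_eq_intros)

lemma sum_disjoint_increments_le:
  fixes V :: "real \<Rightarrow> real"
  assumes "finite I" "mono_on {c..d} V" "c \<le> d"
    and "\<And>i. i \<in> I \<Longrightarrow> c \<le> p i \<and> p i \<le> q i \<and> q i \<le> d"
    and "\<And>i j. i \<in> I \<Longrightarrow> j \<in> I \<Longrightarrow> i \<noteq> j \<Longrightarrow> q i \<le> p j \<or> q j \<le> p i"
  shows "(\<Sum>i\<in>I. V (q i) - V (p i)) \<le> V d - V c"
  using assms
proof (induction "card I" arbitrary: I d rule: less_induct)
  case less
  note I = less.prems
  have Vle: "V x \<le> V y" if "c \<le> x" "x \<le> y" "y \<le> d" for x y
    using mono_onD[OF I(2), of x y] that by auto
  show ?case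
  proof (cases "I = {}")
    case True thus ?thesis using Vle[of c d] I(3) by simp
  next
    case False
    show ?thesis
    \<comment> \<open>A degenerate interval sitting at the right end of another one need not lie
      below it, so such intervals are removed before the rightmost one is singled out.\<close>
    proof (cases "\<exists>i\<in>I. p i = q i")
      case True
      then obtain i where i: "i \<in> I" "p i = q i" by blast
      have "(\<Sum>j\<in>I - {i}. V (q j) - V (p j)) \<le> V d - V c"
      proof (rule less.hyps)
        show "card (I - {i}) < card I" using i I(1) by (intro card_Diff1_less) auto
      qed (use I in auto)
      thus ?thesis using i I(1) by (subst sum.remove[of I i]) auto
    next
      case nondeg: False
      have "Max (q ` I) \<in> q ` I" using I(1) False by (intro Max_in) auto
      then obtain i where i: "i \<in> I" "q i = Max (q ` I)" by force
      have mx: "q j \<le> q i" if "j \<in> I" for j using i(2) that I(1) by simp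
      have below: "q j \<le> p i" if "j \<in> I" "j \<noteq> i" for j
      proof (rule ccontr)
        assume "\<not> q j \<le> p i"
        hence "q i \<le> p j" using I(5)[OF i(1) that(1)] that(2) by auto
        hence "p j = q j" using mx[OF that(1)] I(4)[OF that(1)] by linarith
        thus False using nondeg that(1) by blast
      qed
      have *: "(\<Sum>j\<in>I - {i}. V (q j) - V (p j)) \<le> V (p i) - V c"
      proof (rule less.hyps)
        show "card (I - {i}) < card I" using i I(1) by (intro card_Diff1_less) auto
        show "mono_on {c..p i} V"
          by (rule mono_on_subset[OF I(2)]) (use I(4)[OF i(1)] in auto)
        show "c \<le> p i" using I(4)[OF i(1)] by simp
      qed (use I below in auto)
      have "(\<Sum>j\<in>I. V (q j) - V (p j)) = V (q i) - V (p i) + (\<Sum>j\<in>I - {i}. V (q j) - V (p j))"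
        using i I(1) by (intro sum.remove) auto
      also have "\<dots> \<le> V (q i) - V c" using * by simp
      also have "\<dots> \<le> V d - V c" using Vle[of "q i" d] I(4)[OF i(1)] by simp
      finally show ?thesis .
    qed
  qed
qed

definition small_family :: "real \<Rightarrow> real \<Rightarrow> real \<Rightarrow> nat \<Rightarrow> (nat \<Rightarrow> real) \<Rightarrow> (nat \<Rightarrow> real) \<Rightarrow> bool" where
  "small_family c d \<delta> n p q \<longleftrightarrow> (\<forall>i<n. c \<le> p i \<and> p i \<le> q i \<and> q i \<le> d) \<and>
     (\<forall>i<n. \<forall>j<n. i \<noteq> j \<longrightarrow> q i \<le> p j \<or> q j \<le> p i) \<and> (\<Sum>i<n. q i - p i) < \<delta>"

lemma abs_cont_on_interval_iff:
  "abs_cont_on_interval f c d \<longleftrightarrow> (\<forall>\<epsilon>>0. \<exists>\<delta>>0. \<forall>n p q. small_family c d \<delta> n p q \<longrightarrow>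
     (\<Sum>i<n. cmod (f (q i) - f (p i))) < \<epsilon>)"
  unfolding abs_cont_on_interval_def small_family_def by (simp only: imp_conjL)

text \<open>This form suits unbounded derivatives: \<open>f\<close> is Lipschitz up to a monotone
  error \<open>V\<close> of arbitrarily small total growth. The Lipschitz part is controlled by the
  total length of a disjoint family, the error by \<open>V d - V c\<close> whatever the
  lengths.\<close>

lemma abs_cont_on_intervalI:
  fixes f :: "real \<Rightarrow> complex"
  assumes cd: "c \<le> d" and "\<And>e. e > 0 \<Longrightarrow> \<exists>K V. 0 \<le> K \<and> mono_on {c..d} V \<and> V d - V c \<le> e \<and>
     (\<forall>p q. c \<le> p \<longrightarrow> p \<le> q \<longrightarrow> q \<le> d \<longrightarrow> cmod (f q - f p) \<le> K * (q - p) + (V q - V p))"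
  shows "abs_cont_on_interval f c d"
  unfolding abs_cont_on_interval_iff
proof (intro allI impI)
  fix \<epsilon> :: real assume "\<epsilon> > 0"
  then obtain K V where KV: "0 \<le> K" "mono_on {c..d} V" "V d - V c \<le> \<epsilon>/2"
     "\<And>p q. c \<le> p \<Longrightarrow> p \<le> q \<Longrightarrow> q \<le> d \<Longrightarrow> cmod (f q - f p) \<le> K * (q - p) + (V q - V p)"
    using assms(2)[of "\<epsilon>/2"] by (metis half_gt_zero)
  show "\<exists>\<delta>>0. \<forall>n p q. small_family c d \<delta> n p q \<longrightarrow> (\<Sum>i<n. cmod (f (q i) - f (p i))) < \<epsilon>"
  proof (intro exI[of _ "\<epsilon> / (2 * (K + 1))"] conjI allI impI)
    show "\<epsilon> / (2 * (K + 1)) > 0" using \<open>\<epsilon> > 0\<close> KV by simp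
    fix n p q assume fam: "small_family c d (\<epsilon> / (2 * (K + 1))) n p q"
    have "(\<Sum>i<n. cmod (f (q i) - f (p i))) \<le> (\<Sum>i<n. K * (q i - p i) + (V (q i) - V (p i)))"
      by (intro sum_mono KV(4)) (use fam in \<open>auto simp: small_family_def\<close>)
    also have "\<dots> = K * (\<Sum>i<n. q i - p i) + (\<Sum>i<n. V (q i) - V (p i))"
      by (simp only: sum.distrib sum_distrib_left)
    also have "(\<Sum>i<n. V (q i) - V (p i)) \<le> V d - V c"
      by (rule sum_disjoint_increments_le) (use KV(2) cd fam in \<open>auto simp: small_family_def\<close>)
    also have "V d - V c \<le> \<epsilon>/2" by fact
    also have "K * (\<Sum>i<n. q i - p i) < \<epsilon>/2"
    proof -
      have "K * (\<Sum>i<n. q i - p i) \<le> K * (\<epsilon> / (2 * (K + 1)))"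
        using fam KV(1) by (intro mult_left_mono) (auto simp: small_family_def)
      also have "\<dots> < \<epsilon>/2" using \<open>\<epsilon> > 0\<close> KV(1) by (simp add: field_simps)
      finally show ?thesis .
    qed
    finally show "(\<Sum>i<n. cmod (f (q i) - f (p i))) < \<epsilon>" by simp
  qed
qed

lemma small_family_mono_image:
  assumes fam: "small_family c d \<delta> n p q" and "mono h" and "\<And>x y. x \<le> y \<Longrightarrow> h y - h x \<le> y - x"
    and "\<And>x. c \<le> x \<Longrightarrow> x \<le> d \<Longrightarrow> c' \<le> h x \<and> h x \<le> d'"
  shows "small_family c' d' \<delta> n (h \<circ> p) (h \<circ> q)"
proof -
  have "(\<Sum>i<n. h (q i) - h (p i)) \<le> (\<Sum>i<n. q i - p i)"
    by (intro sum_mono assms(3)) (use fam in \<open>auto simp: small_family_def\<close>)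
  thus ?thesis using assms unfolding small_family_def o_def
    by (meson order.strict_trans1 order_trans monoD)
qed

lemma abs_cont_on_interval_concat:
  assumes 1: "abs_cont_on_interval f c e" and 2: "abs_cont_on_interval f e d" and "c \<le> e" "e \<le> d"
  shows "abs_cont_on_interval f c d"
  unfolding abs_cont_on_interval_iff
proof (intro allI impI)
  fix \<epsilon> :: real assume "\<epsilon> > 0"
  hence e2: "\<epsilon>/2 > 0" by simp
  obtain \<delta>1 where \<delta>1: "\<delta>1 > 0" "\<And>n p q. small_family c e \<delta>1 n p q \<Longrightarrow> (\<Sum>i<n. cmod (f (q i) - f (p i))) < \<epsilon>/2"
    using 1 e2 unfolding abs_cont_on_interval_iff by blast
  obtain \<delta>2 where \<delta>2: "\<delta>2 > 0" "\<And>n p q. small_family e d \<delta>2 n p q \<Longrightarrow> (\<Sum>i<n. cmod (f (q i) - f (p i))) < \<epsilon>/2"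
    using 2 e2 unfolding abs_cont_on_interval_iff by blast
  show "\<exists>\<delta>>0. \<forall>n p q. small_family c d \<delta> n p q \<longrightarrow> (\<Sum>i<n. cmod (f (q i) - f (p i))) < \<epsilon>"
  proof (intro exI[of _ "min \<delta>1 \<delta>2"] conjI allI impI)
    show "min \<delta>1 \<delta>2 > 0" using \<delta>1 \<delta>2 by simp
    fix n p q assume fam: "small_family c d (min \<delta>1 \<delta>2) n p q"
    hence fam': "small_family c d \<delta>1 n p q" "small_family c d \<delta>2 n p q" by (simp_all add: small_family_def)
    \<comment> \<open>Clamping at \<open>e\<close> from either side turns a family straddling
      \<open>e\<close> into one on each side, and the increment of \<open>f\<close> over an interval
      is the sum of its two clamped increments.\<close>
    define lo hi where "lo = (\<lambda>x. min x e)" and "hi = (\<lambda>x. max x e)"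
    have "small_family c e \<delta>1 n (lo \<circ> p) (lo \<circ> q)"
      by (rule small_family_mono_image[OF fam'(1)]) (use assms(3,4) in \<open>auto simp: lo_def mono_def min_def\<close>)
    from \<delta>1(2)[OF this] have s1: "(\<Sum>i<n. cmod (f (lo (q i)) - f (lo (p i)))) < \<epsilon>/2" by simp
    have "small_family e d \<delta>2 n (hi \<circ> p) (hi \<circ> q)"
      by (rule small_family_mono_image[OF fam'(2)]) (use assms(3,4) in \<open>auto simp: hi_def mono_def max_def\<close>)
    from \<delta>2(2)[OF this] have s2: "(\<Sum>i<n. cmod (f (hi (q i)) - f (hi (p i)))) < \<epsilon>/2" by simp
    have "f y - f x = (f (lo y) - f (lo x)) + (f (hi y) - f (hi x))" if "x \<le> y" for x y
      using that by (auto simp: lo_def hi_def min_def max_def)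
    hence "cmod (f y - f x) \<le> cmod (f (lo y) - f (lo x)) + cmod (f (hi y) - f (hi x))" if "x \<le> y" for x y
      using that by (metis norm_triangle_ineq)
    hence "(\<Sum>i<n. cmod (f (q i) - f (p i))) \<le>
        (\<Sum>i<n. cmod (f (lo (q i)) - f (lo (p i))) + cmod (f (hi (q i)) - f (hi (p i))))"
      using fam by (intro sum_mono) (auto simp: small_family_def)
    also have "\<dots> < \<epsilon>" using s1 s2 by (simp add: sum.distrib)
    finally show "(\<Sum>i<n. cmod (f (q i) - f (p i))) < \<epsilon>" .
  qed
qed

text \<open>Beyond \<eta> the power has slope at most
  \<open>\<alpha> * \<eta> powr (\<alpha> - 1)\<close>; the growth below \<eta> is charged to the
  truncated power, whose total growth is at most \<open>\<eta> powr \<alpha>\<close>.\<close>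

lemma powr_increment_bound:
  fixes \<alpha> \<eta> :: real
  assumes \<alpha>: "0 < \<alpha>" "\<alpha> \<le> 1" and \<eta>: "0 < \<eta>" and xy: "0 \<le> x" "x \<le> y"
  shows "y powr \<alpha> - x powr \<alpha> \<le> \<alpha> * \<eta> powr (\<alpha> - 1) * (y - x) + (min y \<eta> powr \<alpha> - min x \<eta> powr \<alpha>)"
proof -
  have far: "v powr \<alpha> - u powr \<alpha> \<le> \<alpha> * \<eta> powr (\<alpha> - 1) * (v - u)" if uv: "\<eta> \<le> u" "u < v" for u v
  proof -
    have "\<exists>z. z > u \<and> z < v \<and> v powr \<alpha> - u powr \<alpha> = (v - u) * (\<alpha> * z powr (\<alpha> - 1))"
      by (rule MVT2[OF uv(2)]) (use \<eta> uv in \<open>auto intro!: derivative_eq_intros simp: powr_diff field_simps\<close>)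
    then obtain z where z: "z > u" "z < v" "v powr \<alpha> - u powr \<alpha> = (v - u) * (\<alpha> * z powr (\<alpha> - 1))" by blast
    have "z powr (\<alpha> - 1) \<le> \<eta> powr (\<alpha> - 1)"
      using \<alpha> \<eta> uv z by (intro powr_mono2') auto
    hence "(v - u) * (\<alpha> * z powr (\<alpha> - 1)) \<le> (v - u) * (\<alpha> * \<eta> powr (\<alpha> - 1))"
      using uv \<alpha> by (intro mult_left_mono) auto
    thus ?thesis using z(3) by (simp add: mult_ac)
  qed
  consider "y \<le> \<eta>" | "x < \<eta>" "\<eta> < y" | "\<eta> \<le> x" "x < y" | "x = y" using xy by linarith
  thus ?thesis
  proof cases
    case 1 thus ?thesis using xy \<alpha> by (simp add: min_def)
  next
    case 2
    have "y powr \<alpha> - \<eta> powr \<alpha> \<le> \<alpha> * \<eta> powr (\<alpha> - 1) * (y - \<eta>)" using far[of \<eta> y] 2 by simp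
    also have "\<dots> \<le> \<alpha> * \<eta> powr (\<alpha> - 1) * (y - x)" using 2 \<alpha> by (intro mult_left_mono) auto
    finally show ?thesis using 2 by (simp add: min_def)
  next
    case 3 thus ?thesis using far[of x y] by (cases "x = \<eta>") (auto simp: min_def)
  next
    case 4 thus ?thesis by simp
  qed
qed

lemma abs_cont_on_interval_derivative_bound:
  fixes f :: "real \<Rightarrow> complex"
  assumes cd: "c < d" and cont: "continuous_on {c..d} f"
    and f': "\<And>t. c < t \<Longrightarrow> t < d \<Longrightarrow> (f has_vector_derivative f' t) (at t)"
    and bnd: "\<And>t. c < t \<Longrightarrow> t < d \<Longrightarrow> norm (f' t) \<le> C * ((t - c) powr -\<beta> + (d - t) powr -\<beta>)"
    and C: "0 \<le> C" and \<beta>: "0 \<le> \<beta>" "\<beta> < 1"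
  shows "abs_cont_on_interval f c d"
proof (rule abs_cont_on_intervalI)
  define \<alpha> where "\<alpha> = 1 - \<beta>"
  have \<alpha>: "0 < \<alpha>" "\<alpha> \<le> 1" using \<beta> by (auto simp: \<alpha>_def)
  \<comment> \<open>An antiderivative of the bound on \<open>f'\<close>, so its increments dominate
    those of \<open>f\<close>.\<close>
  define \<phi> where "\<phi> t = C / \<alpha> * ((t - c) powr \<alpha> - (d - t) powr \<alpha>)" for t
  have inc: "cmod (f q - f p) \<le> \<phi> q - \<phi> p" if pq: "c \<le> p" "p \<le> q" "q \<le> d" for p q
  proof (cases "p = q")
    case False
    hence "p < q" using pq by simp
    thus ?thesis
    proof (rule differentiable_bound_general[where f' = f' and \<phi>' = "\<lambda>t. C * ((t - c) powr -\<beta> + (d - t) powr -\<beta>)"])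
      show "continuous_on {p..q} f" using cont pq by (auto intro: continuous_on_subset)
      show "continuous_on {p..q} \<phi>" unfolding \<phi>_def
        by (intro continuous_intros continuous_on_powr') (use pq \<alpha> in auto)
      fix t assume t: "p < t" "t < q"
      show "(f has_vector_derivative f' t) (at t)" using f' t pq by simp
      show "norm (f' t) \<le> C * ((t - c) powr -\<beta> + (d - t) powr -\<beta>)" using bnd t pq by simp
      have 1: "((\<lambda>t. (t - c) powr \<alpha>) has_real_derivative \<alpha> * (t - c) powr (\<alpha> - of_nat 1) * 1) (at t)"
        by (rule DERIV_fun_powr) (use t pq in \<open>auto intro!: derivative_eq_intros\<close>)
      have 2: "((\<lambda>t. (d - t) powr \<alpha>) has_real_derivative \<alpha> * (d - t) powr (\<alpha> - of_nat 1) * (-1)) (at t)"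
        by (rule DERIV_fun_powr) (use t pq in \<open>auto intro!: derivative_eq_intros\<close>)
      have "(\<phi> has_real_derivative C / \<alpha> * (\<alpha> * (t - c) powr (\<alpha> - of_nat 1) * 1 - \<alpha> * (d - t) powr (\<alpha> - of_nat 1) * (-1))) (at t)"
        unfolding \<phi>_def by (intro DERIV_cmult DERIV_diff 1 2)
      moreover have "C / \<alpha> * (\<alpha> * (t - c) powr (\<alpha> - of_nat 1) * 1 - \<alpha> * (d - t) powr (\<alpha> - of_nat 1) * (-1))
          = C * ((t - c) powr -\<beta> + (d - t) powr -\<beta>)"
      proof -
        have "\<alpha> - of_nat 1 = -\<beta>" by (simp add: \<alpha>_def)
        hence "(t - c) powr (\<alpha> - of_nat 1) = (t - c) powr -\<beta>" "(d - t) powr (\<alpha> - of_nat 1) = (d - t) powr -\<beta>"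
          by simp_all
        thus ?thesis using \<alpha> by (simp add: distrib_left)
      qed
      ultimately show "(\<phi> has_vector_derivative C * ((t - c) powr -\<beta> + (d - t) powr -\<beta>)) (at t)"
        by (simp add: has_real_derivative_iff_has_vector_derivative)
    qed
  qed simp
  show "c \<le> d" using cd by simp
  fix e :: real assume e: "e > 0"
  \<comment> \<open>Chosen so that the contributions of the two endpoints, together
    \<open>2 * C / \<alpha> * \<eta> powr \<alpha>\<close>, stay below \<open>e\<close>; the
    denominator \<open>C + 1\<close> also covers \<open>C = 0\<close>.\<close>
  define \<eta> where "\<eta> = (e * \<alpha> / (2 * (C + 1))) powr (1/\<alpha>)"
  have \<eta>: "\<eta> > 0" using e \<alpha> C by (simp add: \<eta>_def)
  have \<eta>\<alpha>: "\<eta> powr \<alpha> = e * \<alpha> / (2 * (C + 1))" using e \<alpha> C by (simp add: \<eta>_def powr_powr)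
  define V where "V t = C / \<alpha> * (min (t - c) \<eta> powr \<alpha> - min (d - t) \<eta> powr \<alpha>)" for t
  define K where "K = 2 * (C / \<alpha>) * (\<alpha> * \<eta> powr (\<alpha> - 1))"
  have "0 \<le> K" using C \<alpha> by (simp add: K_def)
  moreover have "mono_on {c..d} V"
  proof (rule mono_onI)
    fix r s assume rs: "r \<in> {c..d}" "s \<in> {c..d}" "r \<le> s"
    have "min (r - c) \<eta> powr \<alpha> \<le> min (s - c) \<eta> powr \<alpha>"
      by (rule powr_mono2) (use \<alpha> \<eta> rs in auto)
    moreover have "min (d - s) \<eta> powr \<alpha> \<le> min (d - r) \<eta> powr \<alpha>"
      by (rule powr_mono2) (use \<alpha> \<eta> rs in auto)
    ultimately show "V r \<le> V s" unfolding V_def using C \<alpha> by (intro mult_left_mono) auto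
  qed
  moreover have "V d - V c \<le> e"
  proof -
    have m: "min (d - c) \<eta> powr \<alpha> \<le> \<eta> powr \<alpha>"
      by (rule powr_mono2) (use \<alpha> \<eta> cd in auto)
    have "V d - V c = C / \<alpha> * (2 * min (d - c) \<eta> powr \<alpha>)"
      using \<eta> \<alpha> by (simp add: V_def min_def algebra_simps)
    also have "\<dots> \<le> C / \<alpha> * (2 * \<eta> powr \<alpha>)"
      using m C \<alpha> by (intro mult_left_mono) auto
    also have "\<dots> \<le> e" unfolding \<eta>\<alpha> using C \<alpha> e by (simp add: field_simps)
    finally show ?thesis .
  qed
  moreover have "cmod (f q - f p) \<le> K * (q - p) + (V q - V p)" if pq: "c \<le> p" "p \<le> q" "q \<le> d" for p q
  proof -
    have "\<phi> q - \<phi> p = C / \<alpha> * (((q - c) powr \<alpha> - (p - c) powr \<alpha>) + ((d - p) powr \<alpha> - (d - q) powr \<alpha>))"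
      by (simp add: \<phi>_def algebra_simps)
    also have "\<dots> \<le> C / \<alpha> * ((\<alpha> * \<eta> powr (\<alpha> - 1) * ((q - c) - (p - c)) + (min (q - c) \<eta> powr \<alpha> - min (p - c) \<eta> powr \<alpha>))
       + (\<alpha> * \<eta> powr (\<alpha> - 1) * ((d - p) - (d - q)) + (min (d - p) \<eta> powr \<alpha> - min (d - q) \<eta> powr \<alpha>)))"
      using C \<alpha> pq by (intro mult_left_mono add_mono powr_increment_bound \<eta>) auto
    also have "\<dots> = K * (q - p) + (V q - V p)"
      by (simp add: K_def V_def algebra_simps)
    finally show ?thesis using inc[OF pq] by linarith
  qed
  ultimately show "\<exists>K V. 0 \<le> K \<and> mono_on {c..d} V \<and> V d - V c \<le> e \<and>
     (\<forall>p q. c \<le> p \<longrightarrow> p \<le> q \<longrightarrow> q \<le> d \<longrightarrow> cmod (f q - f p) \<le> K * (q - p) + (V q - V p))"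
    by blast
qed

lemma abs_cont_on_interval_refl: "abs_cont_on_interval f t t"
proof (rule abs_cont_on_intervalI)
  fix e :: real assume "e > 0"
  have "cmod (f q - f p) \<le> 0 * (q - p) + (0 - 0)" if "t \<le> p" "p \<le> q" "q \<le> t" for p q
  proof -
    have "p = q" using that by linarith
    thus ?thesis by simp
  qed
  thus "\<exists>K V. 0 \<le> K \<and> mono_on {t..t} V \<and> V t - V t \<le> e \<and>
     (\<forall>p q. t \<le> p \<longrightarrow> p \<le> q \<longrightarrow> q \<le> t \<longrightarrow> cmod (f q - f p) \<le> K * (q - p) + (V q - V p))"
    using \<open>e > 0\<close> by (intro exI[of _ 0] exI[of _ "\<lambda>_. 0"] conjI allI impI) (simp_all only: mono_on_def, simp_all)
qed simp

lemma abs_cont_on_interval_endpoint_singularity: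
  fixes f :: "real \<Rightarrow> complex"
  assumes ab: "a \<le> b" and e: "e = a \<or> e = b" and cont: "continuous_on {a..b} f"
    and f': "\<And>t. a < t \<Longrightarrow> t < b \<Longrightarrow> \<exists>D. (f has_vector_derivative D) (at t) \<and> norm D \<le> C * \<bar>t - e\<bar> powr -\<beta>"
    and C: "0 \<le> C" and \<beta>: "0 \<le> \<beta>" "\<beta> < 1"
  shows "abs_cont_on_interval f a b"
proof (cases "a = b")
  case False
  hence ab': "a < b" using ab by simp
  obtain f' where f': "\<And>t. a < t \<Longrightarrow> t < b \<Longrightarrow> (f has_vector_derivative f' t) (at t) \<and> norm (f' t) \<le> C * \<bar>t - e\<bar> powr -\<beta>"
    using f' by metis
  show ?thesis
  proof (rule abs_cont_on_interval_derivative_bound[OF ab' cont _ _ C \<beta>])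
    fix t assume t: "a < t" "t < b"
    show "(f has_vector_derivative f' t) (at t)" using f'[OF t] by blast
    have "\<bar>t - e\<bar> powr -\<beta> \<le> (t - a) powr -\<beta> + (b - t) powr -\<beta>" using e t by auto
    hence "C * \<bar>t - e\<bar> powr -\<beta> \<le> C * ((t - a) powr -\<beta> + (b - t) powr -\<beta>)" using C by (rule mult_left_mono)
    thus "norm (f' t) \<le> C * ((t - a) powr -\<beta> + (b - t) powr -\<beta>)" using f'[OF t] by linarith
  qed
qed (simp add: abs_cont_on_interval_refl)

lemma abs_cont_on_interval_bounded_derivative:
  assumes cd: "c \<le> d" and cont: "continuous_on {c..d} f"
    and f': "\<And>t. c < t \<Longrightarrow> t < d \<Longrightarrow> \<exists>D. (f has_vector_derivative D) (at t) \<and> norm D \<le> M"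
  shows "abs_cont_on_interval f c d"
proof (rule abs_cont_on_interval_endpoint_singularity[OF cd _ cont, of c "max 0 M" 0])
  fix t assume t: "c < t" "t < d"
  show "\<exists>D. (f has_vector_derivative D) (at t) \<and> norm D \<le> max 0 M * \<bar>t - c\<bar> powr - 0"
    using f'[OF t] t by fastforce
qed auto

lemma abs_cont_on_interval_local:
  assumes "c \<le> d"
    and "\<And>t. c \<le> t \<Longrightarrow> t \<le> d \<Longrightarrow> \<exists>\<delta>>0. \<forall>a b. a \<le> t \<and> t \<le> b \<and> b - a < \<delta> \<longrightarrow> abs_cont_on_interval f a b"
  shows "abs_cont_on_interval f c d"
  using assms(1)
proof (induction rule: Bolzano)
  case (trans a b c)
  thus ?case using abs_cont_on_interval_concat by blast
qed (use assms(2) in blast)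

text \<open>A conformal map has F_zbar = 0, so any bound \<open>l \<ge> 0\<close> will do. This
  handles the chart at infinity, where the extension is conformal.\<close>

lemma holomorphic_imp_qc_on:
  assumes holf: "f holomorphic_on S" and S: "open S" and inj: "inj_on f S" and l: "0 \<le> l"
  shows "qc_on l f S"
proof -
  have df: "(f has_field_derivative deriv f z) (at z)" if "z \<in> S" for z
    using holf S that by (auto intro!: holomorphic_derivI)
  have contf: "continuous_on S f" by (rule holomorphic_on_imp_continuous_on[OF holf])
  have contdf: "continuous_on S (deriv f)"
    by (rule holomorphic_on_imp_continuous_on[OF holomorphic_deriv[OF holf S]])
  have line: "abs_cont_on_interval (\<lambda>t. f (\<gamma> t)) c d"
    if cd: "c \<le> d" and mem: "\<forall>t\<in>{c..d}. \<gamma> t \<in> S" and \<gamma>: "\<And>t. (\<gamma> has_vector_derivative \<gamma>') (at t)" and n: "norm \<gamma>' = 1" for c d \<gamma> \<gamma>'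
  proof -
    have cont\<gamma>: "continuous_on A \<gamma>" for A
      by (intro continuous_at_imp_continuous_on ballI has_vector_derivative_continuous[OF \<gamma>])
    have "compact ((\<lambda>t. deriv f (\<gamma> t)) ` {c..d})"
      by (intro compact_continuous_image continuous_on_compose2[OF contdf cont\<gamma>]) (use mem in auto)
    then obtain M where M: "\<And>t. t \<in> {c..d} \<Longrightarrow> cmod (deriv f (\<gamma> t)) \<le> M"
      using compact_imp_bounded bounded_iff by (metis imageI)
    show ?thesis
    proof (rule abs_cont_on_interval_bounded_derivative[OF cd])
      show "continuous_on {c..d} (\<lambda>t. f (\<gamma> t))"
        by (intro continuous_on_compose2[OF contf cont\<gamma>]) (use mem in auto)
      fix t assume t: "c < t" "t < d"
      have "(f \<circ> \<gamma> has_vector_derivative \<gamma>' * deriv f (\<gamma> t)) (at t)"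
        by (rule field_vector_diff_chain_at[OF \<gamma> df]) (use mem t in auto)
      thus "\<exists>D. ((\<lambda>t. f (\<gamma> t)) has_vector_derivative D) (at t) \<and> norm D \<le> M"
        using M[of t] t n by (intro exI[of _ "\<gamma>' * deriv f (\<gamma> t)"]) (simp add: o_def norm_mult)
    qed
  qed
  have ver: "((\<lambda>t. Complex y t) has_vector_derivative \<i>) (at t)" for y t
    unfolding has_vector_derivative_complex_iff by (auto intro!: derivative_eq_intros)
  have "ACL_on f S" unfolding ACL_on_def
    by (intro conjI AE_I2 allI impI) (auto intro!: line[OF _ _ has_vector_derivative_Complex_left] line[OF _ _ ver])
  moreover have "beltrami_bound_on l f S" unfolding beltrami_bound_on_def
  proof (intro AE_I2 impI)
    fix z assume z: "z \<in> S"
    have 1: "((\<lambda>t. z + complex_of_real t) has_vector_derivative 1) (at 0)"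
      unfolding has_vector_derivative_complex_iff by (auto intro!: derivative_eq_intros)
    have 2: "((\<lambda>t. z + \<i> * complex_of_real t) has_vector_derivative \<i>) (at 0)"
      unfolding has_vector_derivative_complex_iff by (auto intro!: derivative_eq_intros)
    have "((\<lambda>t. f (z + complex_of_real t)) has_vector_derivative 1 * deriv f z) (at 0)"
      using field_vector_diff_chain_at[OF 1, of f "deriv f z"] df[OF z] by (simp add: o_def)
    moreover have "((\<lambda>t. f (z + \<i> * complex_of_real t)) has_vector_derivative \<i> * deriv f z) (at 0)"
      using field_vector_diff_chain_at[OF 2, of f "deriv f z"] df[OF z] by (simp add: o_def)
    moreover have "cmod ((1 * deriv f z + \<i> * (\<i> * deriv f z)) / 2) \<le> l * cmod ((1 * deriv f z - \<i> * (\<i> * deriv f z)) / 2)"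
      using l by simp
    ultimately show "\<exists>px py. ((\<lambda>t. f (z + complex_of_real t)) has_vector_derivative px) (at 0) \<and>
       ((\<lambda>t. f (z + \<i> * complex_of_real t)) has_vector_derivative py) (at 0) \<and>
       cmod ((px + \<i> * py) / 2) \<le> l * cmod ((px - \<i> * py) / 2)" by blast
  qed
  moreover have "\<exists>h. homeomorphism S (f ` S) f h"
    using invariance_of_domain_homeomorphism[OF S contf order.refl inj] by metis
  ultimately show ?thesis using S by (simp add: qc_on_def)
qed

section \<open>The criterion in logarithmic coordinates\<close>

text \<open>Convexity of exp between 0 and \<open>a * y\<close>. With y = 2x/a it compares 1/c - 1
  on the boundary c = e^(-2x/a) with the factor e^(2x) - 1 of the hypothesis.\<close>

lemma exp_minus_one_scaled_le:
  fixes a y :: real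
  assumes "a \<ge> 1"
  shows "a * (exp y - 1) \<le> exp (a * y) - 1"
proof -
  have "exp ((1 - 1/a) *\<^sub>R 0 + (1/a) *\<^sub>R (a * y)) \<le> (1 - 1/a) * exp 0 + (1/a) * exp (a * y)"
    using assms by (intro convex_onD[OF exp_convex]) auto
  hence "exp y \<le> 1 - 1/a + exp (a * y) / a" using assms by simp
  hence "a * exp y \<le> a * (1 - 1/a + exp (a * y) / a)" using assms by (intro mult_left_mono) auto
  also have "\<dots> = a - 1 + exp (a * y)" using assms by (simp add: field_simps)
  finally show ?thesis by (simp add: algebra_simps)
qed

text \<open>With t = E/s this is the fact that 1/(1 - t) maps the unit disc into the half-plane Re >
  1/2.\<close>

lemma Re_divide_diff_gt_half:
  fixes s E :: complex
  assumes "cmod E < cmod s"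
  shows "Re (s / (s - E)) > 1/2"
proof -
  have ne: "s - E \<noteq> 0" using assms by auto
  have "(cmod E)\<^sup>2 < (cmod s)\<^sup>2" using assms by (intro power_strict_mono) auto
  hence "(Re E)\<^sup>2 + (Im E)\<^sup>2 < (Re s)\<^sup>2 + (Im s)\<^sup>2" by (simp add: cmod_power2)
  hence "2 * (Re s * (Re s - Re E) + Im s * (Im s - Im E)) > (Re s - Re E)\<^sup>2 + (Im s - Im E)\<^sup>2"
    by (simp add: power2_eq_square algebra_simps)
  moreover have "(Re s - Re E)\<^sup>2 + (Im s - Im E)\<^sup>2 > 0"
    using ne by (metis cmod_power2 minus_complex.simps zero_less_norm_iff zero_less_power)
  ultimately show ?thesis by (simp add: Re_divide field_simps)
qed

lemma bounded_along_exp: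
  assumes "f holomorphic_on ball 0 1"
  obtains K :: real where "K > 0" "\<And>v. Re v \<ge> 1 \<Longrightarrow> cmod (f (exp (-v))) \<le> K"
proof -
  have e1: "exp (-1) < (1::real)" by simp
  have "continuous_on (cball 0 (exp (-1))) f"
    by (rule continuous_on_subset[OF holomorphic_on_imp_continuous_on[OF assms]])
      (use le_less_trans[OF _ e1] in auto)
  hence "compact (f ` cball 0 (exp (-1)))" by (rule compact_continuous_image) auto
  then obtain K where K: "K > 0" "\<And>q. q \<in> cball 0 (exp (-1)) \<Longrightarrow> cmod (f q) \<le> K"
    using compact_imp_bounded bounded_pos by (metis imageI)
  show ?thesis by (rule that[OF K(1)]) (simp add: K(2))
qed

lemma field_derivative_compose_has_derivative:
  "(f has_field_derivative D) (at (g x)) \<Longrightarrow> (g has_derivative g') (at x) \<Longrightarrow>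
    ((\<lambda>x. f (g x)) has_derivative (\<lambda>h. g' h * D)) (at x)"
  using has_derivative_compose[of g g' x UNIV f "(*) D"]
  by (simp add: has_field_derivative_def mult.commute)

section \<open>A differentiable substitute for the absolute value\<close>

lemma pos_part_square_deriv: "((\<lambda>y::real. (max 0 y)^2) has_real_derivative 2 * max 0 y) (at y)"
proof -
  consider "y > 0" | "y < 0" | "y = 0" by linarith
  thus ?thesis
  proof cases
    case 1
    have "((\<lambda>y. y^2) has_real_derivative 2 * y) (at y)" by (auto intro!: derivative_eq_intros)
    thus ?thesis using 1
      by (simp, elim has_field_derivative_transform_within_open[of _ _ _ "{0<..}"]) auto
  next
    case 2
    have "((\<lambda>y. 0) has_real_derivative 0) (at y)" by simp
    thus ?thesis using 2
      by (simp, elim has_field_derivative_transform_within_open[of _ _ _ "{..<0}"]) auto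
  next
    case 3
    have "(\<lambda>h::real. (max 0 h)^2 / h) \<midarrow>0\<rightarrow> 0"
    proof (rule Lim_null_comparison)
      show "\<forall>\<^sub>F h in at 0. norm ((max 0 h)^2 / h) \<le> \<bar>h\<bar>" for h :: real
        by (rule always_eventually) (auto simp: max_def power2_eq_square)
      show "((\<lambda>h::real. \<bar>h\<bar>) \<longlongrightarrow> 0) (at 0)" by (auto intro!: tendsto_eq_intros)
    qed
    thus ?thesis using 3 by (simp add: DERIV_def)
  qed
qed

text \<open>A \<open>C\<^sup>1\<close> regularisation of \<open>\<bar>x\<bar>\<close>, equal to it for \<open>\<bar>x\<bar> \<ge> T\<close>.\<close>
definition mu :: "real \<Rightarrow> real \<Rightarrow> real" where
  "mu T x = T / 2 + (x^2 - (max 0 (x - T))^2 - (max 0 (- x - T))^2) / (2 * T)"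

definition dmu :: "real \<Rightarrow> real \<Rightarrow> real" where
  "dmu T x = (x - max 0 (x - T) + max 0 (- x - T)) / T"

lemma mu_deriv: "(mu T has_real_derivative dmu T x) (at x)" if "T > 0"
proof -
  have 1: "((\<lambda>x. (max 0 (x - T))^2) has_real_derivative 2 * max 0 (x - T) * 1) (at x)"
    by (rule DERIV_chain2[OF pos_part_square_deriv]) (auto intro!: derivative_eq_intros)
  have 2: "((\<lambda>x. (max 0 (- x - T))^2) has_real_derivative 2 * max 0 (- x - T) * (-1)) (at x)"
    by (rule DERIV_chain2[OF pos_part_square_deriv]) (auto intro!: derivative_eq_intros)
  have "((\<lambda>x. T / 2 + (x^2 - (max 0 (x - T))^2 - (max 0 (- x - T))^2) / (2 * T)) has_real_derivative dmu T x) (at x)"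
    by (rule derivative_eq_intros 1 2 refl | use that in \<open>simp add: dmu_def field_simps\<close>)+
  thus ?thesis unfolding mu_def[abs_def] .
qed

lemma mu_outside: "T > 0 \<Longrightarrow> T \<le> \<bar>x\<bar> \<Longrightarrow> mu T x = \<bar>x\<bar>"
  by (cases "x \<ge> 0") (auto simp: mu_def max_def field_simps power2_eq_square)

lemma mu_inside: "T > 0 \<Longrightarrow> \<bar>x\<bar> \<le> T \<Longrightarrow> mu T x = (x^2 + T^2) / (2 * T)"
  by (auto simp: mu_def max_def field_simps power2_eq_square)

lemma mu_ge: "T > 0 \<Longrightarrow> \<bar>x\<bar> \<le> mu T x"
proof (cases "T \<le> \<bar>x\<bar>")
  case False
  assume T: "T > 0"
  have "0 \<le> (T - \<bar>x\<bar>)^2" by simp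
  hence "2 * T * \<bar>x\<bar> \<le> x^2 + T^2" by (simp add: power2_eq_square algebra_simps)
  thus ?thesis using False T by (simp add: mu_inside field_simps)
qed (simp add: mu_outside)

lemma mu_pos: "T > 0 \<Longrightarrow> mu T x > 0"
  using mu_ge[of T x] by (cases "x = 0") (auto simp: mu_inside)

lemma mu_le: "T > 0 \<Longrightarrow> \<bar>x\<bar> \<le> T \<Longrightarrow> mu T x \<le> T"
proof -
  assume T: "T > 0" "\<bar>x\<bar> \<le> T"
  have "x^2 \<le> T^2" using T by (simp add: abs_le_square_iff[symmetric])
  thus ?thesis using T by (simp add: mu_inside field_simps power2_eq_square)
qed

lemma dmu_le: "T > 0 \<Longrightarrow> \<bar>dmu T x\<bar> \<le> 1"
  by (auto simp: dmu_def max_def abs_le_iff field_simps)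

lemma dmu_right: "T > 0 \<Longrightarrow> T \<le> x \<Longrightarrow> dmu T x = 1"
  by (auto simp: dmu_def max_def)

lemma dmu_left: "T > 0 \<Longrightarrow> x \<le> -T \<Longrightarrow> dmu T x = -1"
  by (auto simp: dmu_def max_def)

lemma dmu_cont: "T > 0 \<Longrightarrow> isCont (dmu T) x"
  unfolding dmu_def by (intro continuous_intros) auto

lemma ln_ge_dist_one:
  fixes r :: real
  assumes "0 < r" "r \<le> exp 1"
  shows "\<bar>r - 1\<bar> \<le> exp 1 * \<bar>ln r\<bar>"
proof (cases "r \<ge> 1")
  case True
  have "1 - 1 / r \<le> ln r" using ln_le_minus_one[of "1 / r"] assms by (simp add: ln_div)
  hence "r * (1 - 1 / r) \<le> r * ln r" using assms by (intro mult_left_mono) auto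
  also have "\<dots> \<le> exp 1 * ln r" using assms True by (intro mult_right_mono) auto
  finally show ?thesis using assms True by (simp add: algebra_simps)
next
  case False
  have "1 - r \<le> - ln r" using ln_le_minus_one[of r] assms by simp
  also have "1 * (- ln r) \<le> exp 1 * (- ln r)" using False assms by (intro mult_right_mono) auto
  finally show ?thesis using False assms by simp
qed

text \<open>\<open>\<phi>\<close> is g(z) - z in the coordinate 1/z. Its zero at 0 records the
  missing constant term of the expansion, and this makes P - 1 of second order in exp(-v).\<close>

locale criterion =
  fixes a b k :: real and g \<phi> :: "complex \<Rightarrow> complex"
  assumes a_ge: "a \<ge> 1" and k_ge: "0 \<le> k" and k_lt: "k < 1"
    and b_le: "\<bar>b\<bar> \<le> k * cmod (Complex a b)"
    and g_hol: "g holomorphic_on {z. 1 < cmod z}"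
    and phi_hol: "\<phi> holomorphic_on ball 0 1" and phi_0: "\<phi> 0 = 0"
    and g_phi: "\<And>w. 0 < cmod w \<Longrightarrow> cmod w < 1 \<Longrightarrow> g (inverse w) = inverse w + \<phi> w"
    and g_nz: "\<And>z. 1 < cmod z \<Longrightarrow> g z \<noteq> 0" and dg_nz: "\<And>z. 1 < cmod z \<Longrightarrow> deriv g z \<noteq> 0"
    and ineq: "\<And>z. 1 < cmod z \<Longrightarrow>
       cmod (\<i> * of_real b + of_real ((1 - (cmod z)\<^sup>2) * a) *
         ((1 - Complex a b) * (1 - z * deriv g z / g z) - Complex a b * (z * deriv (deriv g) z / deriv g z)))
         \<le> a * k * cmod (Complex a b) - \<bar>b\<bar> * (a - 1)"
begin

definition s :: complex where "s = Complex a b"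

definition H :: "complex set" where "H = {v. Re v > 0}"

definition G :: "complex \<Rightarrow> complex" where "G v = g (exp v)"

definition P :: "complex \<Rightarrow> complex" where "P v = exp v * deriv g (exp v) / g (exp v)"

definition Q :: "complex \<Rightarrow> complex" where "Q v = P v + s * deriv P v / P v"

definition E :: "real \<Rightarrow> complex \<Rightarrow> complex"
  where "E c v = \<i> * of_real b + of_real (a * (1 - 1 / c)) * (1 - Q v)"

definition B :: "real \<Rightarrow> complex \<Rightarrow> complex" where "B c v = 1 - of_real (1 - c) * P v"

lemma s_simps [simp]: "Re s = a" "Im s = b" "s \<noteq> 0" "cmod s > 0"
  using a_ge by (auto simp: s_def complex_eq_iff)

lemma a_pos [simp]: "a > 0" "a \<ge> 0" "a \<noteq> 0" using a_ge by auto

lemma b_le': "\<bar>b\<bar> \<le> k * cmod s" using b_le by (simp add: s_def)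

lemma open_H [simp]: "open H" by (simp add: H_def open_halfspace_Re_gt)

lemma exp_H: "v \<in> H \<Longrightarrow> 1 < cmod (exp v)" by (simp add: H_def)

lemma open_ext: "open {z::complex. 1 < cmod z}"
  by (intro open_Collect_less continuous_intros)

lemma dg_hol: "deriv g holomorphic_on {z. 1 < cmod z}"
  by (rule holomorphic_deriv[OF g_hol open_ext])

lemma G_deriv: "v \<in> H \<Longrightarrow> (G has_field_derivative P v * G v) (at v)"
proof -
  assume v: "v \<in> H"
  have "(g has_field_derivative deriv g (exp v)) (at (exp v))"
    using g_hol open_ext exp_H[OF v] by (auto intro!: holomorphic_derivI)
  hence "((\<lambda>v. g (exp v)) has_field_derivative deriv g (exp v) * exp v) (at v)"
    by (rule DERIV_chain2) (rule DERIV_exp)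
  thus ?thesis using g_nz[OF exp_H[OF v]] by (simp add: G_def[abs_def] P_def mult_ac)
qed

lemma G_nz: "v \<in> H \<Longrightarrow> G v \<noteq> 0" using g_nz exp_H by (simp add: G_def)

lemma P_nz: "v \<in> H \<Longrightarrow> P v \<noteq> 0" using g_nz dg_nz exp_H by (simp add: P_def)

lemma G_hol: "G holomorphic_on H"
  using G_deriv holomorphic_on_open open_H by blast

lemma P_has_deriv: "v \<in> H \<Longrightarrow> (P has_field_derivative
   P v * (1 + exp v * deriv (deriv g) (exp v) / deriv g (exp v) - P v)) (at v)"
proof -
  assume v: "v \<in> H"
  note nz = g_nz[OF exp_H[OF v]] dg_nz[OF exp_H[OF v]]
  have 1: "(g has_field_derivative deriv g (exp v)) (at (exp v))"
    using g_hol open_ext exp_H[OF v] by (auto intro!: holomorphic_derivI)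
  have 2: "(deriv g has_field_derivative deriv (deriv g) (exp v)) (at (exp v))"
    using dg_hol open_ext exp_H[OF v] by (auto intro!: holomorphic_derivI)
  have "((\<lambda>v. g (exp v)) has_field_derivative deriv g (exp v) * exp v) (at v)"
       "((\<lambda>v. deriv g (exp v)) has_field_derivative deriv (deriv g) (exp v) * exp v) (at v)"
    by (rule DERIV_chain2[OF 1 DERIV_exp] DERIV_chain2[OF 2 DERIV_exp])+
  note [derivative_intros] = this
  show ?thesis unfolding P_def[abs_def]
    by (rule derivative_eq_intros refl | use nz in \<open>simp add: field_simps\<close>)+
qed

lemma P_hol: "P holomorphic_on H"
  using P_has_deriv holomorphic_on_open open_H by blast

lemma deriv_P: "v \<in> H \<Longrightarrow> deriv P v = P v * (Q v - P v) / s"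
  using P_nz by (simp add: Q_def field_simps)

lemma P_deriv: "v \<in> H \<Longrightarrow> (P has_field_derivative P v * (Q v - P v) / s) (at v)"
  using P_hol open_H deriv_P by (metis holomorphic_derivI)

text \<open>The right-hand side is the bracket of the hypothesis at exp v, so the hypothesis becomes
  a bound involving only \<open>Q\<close>.\<close>

lemma one_minus_Q: "v \<in> H \<Longrightarrow> 1 - Q v = (1 - s) * (1 - exp v * deriv g (exp v) / g (exp v))
     - s * (exp v * deriv (deriv g) (exp v) / deriv g (exp v))"
proof -
  assume v: "v \<in> H"
  have "deriv P v = P v * (1 + exp v * deriv (deriv g) (exp v) / deriv g (exp v) - P v)"
    by (rule DERIV_imp_deriv[OF P_has_deriv[OF v]])
  hence "Q v = P v + s * (1 + exp v * deriv (deriv g) (exp v) / deriv g (exp v) - P v)"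
    using P_nz[OF v] by (simp add: Q_def)
  thus ?thesis unfolding P_def[symmetric] by (simp only:) (simp add: algebra_simps)
qed

lemma hyp: "v \<in> H \<Longrightarrow> cmod (\<i> * of_real b + of_real (a * (1 - exp (2 * Re v))) * (1 - Q v))
   \<le> a * k * cmod s - \<bar>b\<bar> * (a - 1)"
  using ineq[OF exp_H[of v]] one_minus_Q[of v]
  by (simp add: s_def[symmetric] exp_double[symmetric] mult.commute mult.left_commute power2_eq_square[symmetric])

text \<open>By convexity the hypothesis on \<open>|ib + a(1 - exp(2x))(1 - Q)|\<close> yields the bound for every
  smaller real coefficient in front of \<open>1 - Q\<close>.\<close>
lemma E_le:
  assumes v: "v \<in> H" and c: "0 < c" "c \<le> 1" "exp (- 2 * Re v / a) \<le> c"
  shows "cmod (E c v) \<le> k * cmod s"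
proof -
  define N where "N = exp (2 * Re v) - 1"
  have N: "N > 0" using v by (simp add: N_def H_def)
  \<comment> \<open>The weight that makes \<open>E c v\<close> a convex combination of ib and the
    expression \<open>?X\<close> of the hypothesis. Convexity of exp gives more than
    \<open>l \<le> 1\<close>, namely \<open>l * a \<le> 1\<close>.\<close>
  define l where "l = (1 / c - 1) / N"
  have l0: "l \<ge> 0" using c N by (simp add: l_def)
  have "1 / c \<le> exp (2 * Re v / a)"
    using c by (simp add: exp_minus field_simps)
  hence "a * (1 / c - 1) \<le> a * (exp (2 * Re v / a) - 1)" by (intro mult_left_mono) auto
  also have "\<dots> \<le> N" unfolding N_def using exp_minus_one_scaled_le[OF a_ge, of "2 * Re v / a"] by simp
  finally have la: "l * a \<le> 1" using N by (simp add: l_def field_simps)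
  have l1: "l \<le> 1"
  proof -
    have "l * 1 \<le> l * a" using l0 a_ge by (intro mult_left_mono) auto
    thus ?thesis using la by simp
  qed
  have lN: "1 / c - 1 = l * N" using N by (simp add: l_def)
  let ?X = "\<i> * of_real b + of_real (a * (1 - exp (2 * Re v))) * (1 - Q v)"
  have "a * (1 - 1 / c) = l * (a * (1 - exp (2 * Re v)))"
  proof -
    have "a * (1 - 1 / c) = - (a * (1 / c - 1))" by (simp add: algebra_simps)
    also have "\<dots> = l * (a * (1 - exp (2 * Re v)))" unfolding lN by (simp add: N_def algebra_simps)
    finally show ?thesis .
  qed
  hence "E c v = of_real (1 - l) * (\<i> * of_real b) + of_real l * ?X"
    unfolding E_def by (simp only: of_real_mult) (simp add: algebra_simps)
  hence "cmod (E c v) \<le> cmod (of_real (1 - l) * (\<i> * of_real b)) + cmod (of_real l * ?X)"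
    by (metis norm_triangle_ineq)
  also have "\<dots> = (1 - l) * \<bar>b\<bar> + l * cmod ?X"
    using l0 l1 by (simp add: norm_mult del: of_real_diff of_real_mult)
  also have "\<dots> \<le> (1 - l) * \<bar>b\<bar> + l * (a * k * cmod s - \<bar>b\<bar> * (a - 1))"
    using hyp[OF v] l0 by (intro add_left_mono mult_left_mono) auto
  \<comment> \<open>The term -|b|(a - 1) of the hypothesis is calibrated for this: what remains
    interpolates between |b| and k|s| with weight \<open>l * a\<close>.\<close>
  also have "\<dots> = \<bar>b\<bar> + (l * a) * (k * cmod s - \<bar>b\<bar>)" by (simp add: algebra_simps)
  also have "\<dots> \<le> \<bar>b\<bar> + 1 * (k * cmod s - \<bar>b\<bar>)"
    using la b_le' by (intro add_left_mono mult_right_mono) auto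
  finally show ?thesis by simp
qed

lemma E_lt:
  assumes "v \<in> H" and "0 < c" "c \<le> 1" "exp (- 2 * Re v / a) \<le> c"
  shows "cmod (E c v) < cmod s"
proof -
  have "k * cmod s < 1 * cmod s" using k_lt by (intro mult_strict_right_mono) auto
  thus ?thesis using E_le[OF assms] by linarith
qed

text \<open>The summand ib of \<open>E\<close> cancels against s = a + ib, leaving a real multiple
  of s - E. Both the motion of the zeros of \<open>B\<close> and the differential of
  \<open>Phi\<close> are computed from this.\<close>

lemma one_minus_Q_eq: "0 < c \<Longrightarrow> 1 - of_real (1 - c) * Q v = of_real (c / a) * (s - E c v)"
proof -
  assume c: "0 < c"
  have s: "s = of_real a + \<i> * of_real b" by (simp add: complex_eq_iff)
  have "s - E c v = of_real a - of_real (a * (1 - 1 / c)) * (1 - Q v)"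
    by (simp add: E_def s algebra_simps)
  hence "of_real (c / a) * (s - E c v) = of_real (c / a * a) - of_real (c / a * (a * (1 - 1 / c))) * (1 - Q v)"
    by (simp only: right_diff_distrib mult.assoc[symmetric] of_real_mult[symmetric])
  also have "c / a * a = c" by simp
  also have "c / a * (a * (1 - 1 / c)) = c - 1" using c by (simp add: field_simps)
  finally show ?thesis by (simp add: algebra_simps)
qed

text \<open>The bound on \<open>r 0\<close> comes from comparing the hypothesis along \<open>q = exp (-v) \<rightarrow> 0\<close> in the
  directions \<open>1\<close> and \<open>\<i>\<close>.\<close>
lemma P_expansion:
  obtains r where "r holomorphic_on ball 0 1" "cmod (r 0) < 1"
    "\<And>v. v \<in> H \<Longrightarrow> P v = 1 + exp (-v)^2 * r (exp (-v))"
proof -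
  \<comment> \<open>Dividing out the zero of \<phi> gives g(1/q) = D(q)/q with D(q) = 1 + q^2
    \<psi>(q), and D is zero-free because g is.\<close>
  define \<psi> where "\<psi> = (\<lambda>z. if z = 0 then deriv \<phi> 0 else (\<phi> z - \<phi> 0) / (z - 0))"
  have \<psi>_hol: "\<psi> holomorphic_on ball 0 1"
    unfolding \<psi>_def by (rule pole_lemma_open[OF phi_hol open_ball])
  have \<phi>_eq: "\<phi> q = q * \<psi> q" for q by (simp add: \<psi>_def phi_0)
  have d\<psi>_hol: "deriv \<psi> holomorphic_on ball 0 1"
    by (rule holomorphic_deriv[OF \<psi>_hol open_ball])
  define D where "D q = 1 + q^2 * \<psi> q" for q
  have D_nz: "D q \<noteq> 0" if "q \<in> ball 0 1" for q
  proof (cases "q = 0")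
    case False
    have "g (inverse q) = D q / q" using False that g_phi[of q]
      by (simp add: D_def \<phi>_eq field_simps power2_eq_square)
    moreover have "1 < cmod (inverse q)" using False that
      by (simp add: norm_inverse one_less_inverse)
    ultimately show ?thesis using g_nz by force
  qed (simp add: D_def)
  define r where "r q = - (2 * \<psi> q + q * deriv \<psi> q) / D q" for q
  have r_hol: "r holomorphic_on ball 0 1"
    unfolding r_def D_def
    by (intro holomorphic_intros \<psi>_hol d\<psi>_hol) (use D_nz in \<open>auto simp: D_def\<close>)
  have q_mem: "exp (-v) \<in> ball 0 1" if "v \<in> H" for v using that by (simp add: H_def)
  have P_eq: "P v = 1 + exp (-v)^2 * r (exp (-v))" if v: "v \<in> H" for v
  proof -
    define w where "w = exp v"
    define q where "q = exp (-v)"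
    have wq: "q = inverse w" "w \<noteq> 0" "q \<noteq> 0" "w * q = 1" by (auto simp: w_def q_def exp_minus)
    have w1: "1 < cmod w" unfolding w_def by (rule exp_H[OF v])
    have q1: "q \<in> ball 0 1" unfolding q_def by (rule q_mem[OF v])
    have geq: "g z = z + inverse z * \<psi> (inverse z)" if "z \<in> {z. 1 < cmod z}" for z
    proof -
      have "z \<noteq> 0" using that by auto
      thus ?thesis using g_phi[of "inverse z"] that \<phi>_eq by (auto simp: norm_inverse inverse_less_1_iff)
    qed
    have d\<psi>: "(\<psi> has_field_derivative deriv \<psi> (inverse w)) (at (inverse w))"
      using \<psi>_hol q1 wq by (auto intro!: holomorphic_derivI[OF _ open_ball])
    have "((\<lambda>z. z + inverse z * \<psi> (inverse z)) has_field_derivative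
        1 - q^2 * \<psi> q - q^3 * deriv \<psi> q) (at w)"
      by (rule derivative_eq_intros refl DERIV_chain2[where f = \<psi> and g = inverse, OF d\<psi>] | use wq in \<open>simp add: power2_eq_square power3_eq_cube algebra_simps\<close>)+
    hence "(g has_field_derivative 1 - q^2 * \<psi> q - q^3 * deriv \<psi> q) (at w)"
      by (rule has_field_derivative_transform_within_open[OF _ open_ext]) (use w1 geq in auto)
    hence dg: "deriv g w = 1 - q^2 * \<psi> q - q^3 * deriv \<psi> q" by (rule DERIV_imp_deriv)
    have "w * D q = w + (w * q) * (q * \<psi> q)" by (simp add: D_def power2_eq_square algebra_simps)
    hence gw: "g w = w * D q" using geq[of w] w1 wq by simp
    have "P v = deriv g w / D q" unfolding P_def w_def[symmetric] gw using wq by simp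
    also have "\<dots> = 1 + q^2 * r q"
      using D_nz[OF q1] by (simp add: dg r_def field_simps) (simp add: D_def power2_eq_square power3_eq_cube algebra_simps)
    finally show ?thesis by (simp add: q_def)
  qed
  have dr_hol: "deriv r holomorphic_on ball 0 1"
    by (rule holomorphic_deriv[OF r_hol open_ball])
  define \<kappa> where "\<kappa> q = r q - s * (2 * r q + q * deriv r q) / (1 + q^2 * r q)" for q
  have Q_eq: "Q v - 1 = exp (-v)^2 * \<kappa> (exp (-v))" if v: "v \<in> H" for v
  proof -
    define q where "q = exp (-v)"
    have dr: "(r has_field_derivative deriv r (exp (-v))) (at (exp (-v)))"
      using r_hol q_mem[OF v] by (auto intro!: holomorphic_derivI[OF _ open_ball])
    have "((\<lambda>v. exp (-v)) has_field_derivative - exp (-v)) (at v)"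
      by (auto intro!: derivative_eq_intros)
    from DERIV_chain2[OF dr this]
    have dr': "((\<lambda>v. r (exp (-v))) has_field_derivative - deriv r q * q) (at v)" by (simp add: q_def)
    have "((\<lambda>v. 1 + exp (-v)^2 * r (exp (-v))) has_field_derivative - 2 * q^2 * r q - q^3 * deriv r q) (at v)"
      by (rule derivative_eq_intros refl dr' | simp add: q_def power2_eq_square power3_eq_cube algebra_simps)+
    hence "(P has_field_derivative - 2 * q^2 * r q - q^3 * deriv r q) (at v)"
      by (rule has_field_derivative_transform_within_open[OF _ open_H v]) (simp add: P_eq)
    hence dP: "deriv P v = - 2 * q^2 * r q - q^3 * deriv r q" by (rule DERIV_imp_deriv)
    show ?thesis using P_nz[OF v] unfolding Q_def dP P_eq[OF v] \<kappa>_def q_def[symmetric]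
      by (simp add: field_simps power2_eq_square power3_eq_cube)
  qed
  define M where "M = a * k * cmod s - \<bar>b\<bar> * (a - 1)"
  \<comment> \<open>For q = d and q = id the square q^2 has opposite signs. As d tends to 0, both
    |ib + a \<kappa>(0)| and |ib - a \<kappa>(0)| are bounded by \<open>M\<close>, and the triangle
    inequality eliminates b.\<close>
  have bnd: "cmod (\<i> * of_real b + of_real (a * (1 - d^2)) * \<kappa> (of_real d)) \<le> M"
            "cmod (\<i> * of_real b - of_real (a * (1 - d^2)) * \<kappa> (\<i> * of_real d)) \<le> M"
    if d: "0 < d" "d < 1" for d :: real
  proof -
    have ex: "exp (2 * (- ln d)) = 1 / d^2"
      using d by (simp add: exp_minus exp_double divide_inverse)
    have aux: "a * (1 - 1 / d^2) * d^2 = - (a * (1 - d^2))" using d by (simp add: field_simps)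
    have "cmod (\<i> * of_real b + of_real (a * (1 - exp (2 * Re v))) * (1 - Q v)) \<le> M" if "v \<in> H" for v
      unfolding M_def by (rule hyp[OF that])
    note * = this
    define v1 where "v1 = complex_of_real (- ln d)"
    have v1: "v1 \<in> H" using d by (simp add: v1_def H_def)
    have q1: "exp (- v1) = of_real d" using d by (simp add: v1_def exp_of_real)
    have "of_real (a * (1 - exp (2 * Re v1))) * (1 - Q v1) = of_real (a * (1 - d^2)) * \<kappa> (of_real d)"
    proof -
      have "1 - Q v1 = - (of_real (d^2) * \<kappa> (of_real d))"
        using Q_eq[OF v1] unfolding q1 by (simp add: algebra_simps)
      moreover have "Re v1 = - ln d" by (simp add: v1_def)
      ultimately have "of_real (a * (1 - exp (2 * Re v1))) * (1 - Q v1)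
          = - (of_real (a * (1 - 1 / d^2) * d^2) * \<kappa> (of_real d))"
        using ex by (simp only: of_real_mult) (simp add: mult_ac)
      thus ?thesis unfolding aux by simp
    qed
    from *[OF v1, unfolded this]
    show "cmod (\<i> * of_real b + of_real (a * (1 - d^2)) * \<kappa> (of_real d)) \<le> M" .
    define v2 where "v2 = complex_of_real (- ln d) - \<i> * of_real (pi/2)"
    have v2: "v2 \<in> H" using d by (simp add: v2_def H_def)
    have q2: "exp (- v2) = \<i> * of_real d"
    proof -
      have "- v2 = \<i> * of_real (pi/2) + of_real (ln d)" by (simp add: v2_def)
      hence "exp (- v2) = exp (\<i> * of_real (pi/2)) * exp (of_real (ln d))" by (simp only: exp_add)
      also have "exp (\<i> * of_real (pi/2)) = \<i>" by (simp only: cis_conv_exp[symmetric] cis_pi_half)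
      finally show ?thesis using d by (simp add: exp_of_real)
    qed
    have "of_real (a * (1 - exp (2 * Re v2))) * (1 - Q v2) = - of_real (a * (1 - d^2)) * \<kappa> (\<i> * of_real d)"
    proof -
      have "1 - Q v2 = of_real (d^2) * \<kappa> (\<i> * of_real d)"
        using Q_eq[OF v2] unfolding q2 by (simp add: algebra_simps power_mult_distrib)
      moreover have "Re v2 = - ln d" by (simp add: v2_def)
      ultimately have "of_real (a * (1 - exp (2 * Re v2))) * (1 - Q v2)
          = of_real (a * (1 - 1 / d^2) * d^2) * \<kappa> (\<i> * of_real d)"
        using ex by (simp only: of_real_mult) (simp add: mult_ac)
      thus ?thesis unfolding aux by simp
    qed
    from *[OF v2, unfolded this]
    show "cmod (\<i> * of_real b - of_real (a * (1 - d^2)) * \<kappa> (\<i> * of_real d)) \<le> M"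
      by (simp only: mult_minus_left add_uminus_conv_diff)
  qed
  have \<kappa>_cont: "isCont \<kappa> 0"
  proof -
    have "isCont r 0" "isCont (deriv r) 0"
      using r_hol dr_hol by (auto dest!: holomorphic_on_imp_continuous_on simp: continuous_on_eq_continuous_at)
    thus ?thesis unfolding \<kappa>_def by (intro continuous_intros) auto
  qed
  have ev: "\<forall>\<^sub>F d in at_right (0::real). 0 < d \<and> d < 1"
    by (auto simp: eventually_at_right[of 0 1] intro!: exI[of _ 1])
  have l1: "((\<lambda>d::real. \<kappa> (of_real d)) \<longlongrightarrow> \<kappa> 0) (at_right 0)"
    by (rule isCont_tendsto_compose[OF \<kappa>_cont]) (auto intro!: tendsto_eq_intros)
  have l2: "((\<lambda>d::real. \<kappa> (\<i> * of_real d)) \<longlongrightarrow> \<kappa> 0) (at_right 0)"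
    by (rule isCont_tendsto_compose[OF \<kappa>_cont]) (auto intro!: tendsto_eq_intros)
  have "cmod (\<i> * of_real b + of_real (a * (1 - 0^2)) * \<kappa> 0) \<le> M"
    by (rule tendsto_upperbound[where F = "at_right (0::real)" and f = "\<lambda>d. cmod (\<i> * of_real b + of_real (a * (1 - d^2)) * \<kappa> (of_real d))"])
       (intro tendsto_intros l1, use ev bnd in \<open>auto elim!: eventually_mono\<close>)
  moreover have "cmod (\<i> * of_real b - of_real (a * (1 - 0^2)) * \<kappa> 0) \<le> M"
    by (rule tendsto_upperbound[where F = "at_right (0::real)" and f = "\<lambda>d. cmod (\<i> * of_real b - of_real (a * (1 - d^2)) * \<kappa> (\<i> * of_real d))"])
       (intro tendsto_intros l2, use ev bnd in \<open>auto elim!: eventually_mono\<close>)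
  moreover have "cmod ((\<i> * of_real b + of_real a * \<kappa> 0) - (\<i> * of_real b - of_real a * \<kappa> 0))
      \<le> cmod (\<i> * of_real b + of_real a * \<kappa> 0) + cmod (\<i> * of_real b - of_real a * \<kappa> 0)"
    by (rule norm_triangle_ineq4)
  ultimately have "a * cmod (\<kappa> 0) \<le> M" by (simp add: norm_mult)
  also have "M \<le> a * (k * cmod s)" unfolding M_def using a_ge by simp
  finally have k0: "cmod (\<kappa> 0) \<le> k * cmod s" by simp
  have "\<kappa> 0 = (1 - 2 * s) * r 0" by (simp add: \<kappa>_def algebra_simps)
  hence k1: "cmod (2 * s - 1) * cmod (r 0) \<le> k * cmod s"
    using k0 by (metis norm_minus_commute norm_mult)
  have "cmod s \<le> cmod (2 * s - 1)"
  proof -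
    have "(cmod (2 * s - 1))^2 - (cmod s)^2 = (3 * a - 1) * (a - 1) + 3 * b^2"
      unfolding cmod_power2 by (simp add: power2_eq_square algebra_simps)
    also have "\<dots> \<ge> 0" using a_ge by simp
    finally have "(cmod s)^2 \<le> (cmod (2 * s - 1))^2" by linarith
    thus ?thesis by (rule power2_le_imp_le[OF _ norm_ge_zero])
  qed
  hence "cmod (r 0) * cmod s \<le> cmod (r 0) * cmod (2 * s - 1)" by (intro mult_left_mono) auto
  also have "\<dots> \<le> k * cmod s" using k1 by (simp only: mult.commute)
  finally have "cmod (r 0) \<le> k" by simp
  hence "cmod (r 0) < 1" using k_lt by simp
  thus ?thesis using r_hol P_eq that by blast
qed

text \<open>The strict bound |r(0)| < 1 yields the factor 1 in front of the exponential. A zero of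
  \<open>B c v\<close> means 1/P - 1 = -c, while admissibility gives c >= e^(-2x/a) >= e^(-2x), so
  there are no admissible zeros far out.\<close>

lemma P_near_infinity:
  obtains X where "X > 0" "\<And>v. Re v \<ge> X \<Longrightarrow> cmod (1 / P v - 1) < exp (- 2 * Re v)"
proof -
  obtain r where r: "r holomorphic_on ball 0 1" "cmod (r 0) < 1"
    "\<And>v. v \<in> H \<Longrightarrow> P v = 1 + exp (-v)^2 * r (exp (-v))" using P_expansion by blast
  define \<rho> where "\<rho> q = r q / (1 + q^2 * r q)" for q
  have "isCont r 0" using r(1) by (auto dest!: holomorphic_on_imp_continuous_on simp: continuous_on_eq_continuous_at)
  hence "isCont \<rho> 0" unfolding \<rho>_def by (intro continuous_intros) auto
  moreover have "cmod (\<rho> 0) < 1" using r(2) by (simp add: \<rho>_def)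
  ultimately have "\<forall>\<^sub>F q in nhds 0. cmod (\<rho> q) < 1"
    by (intro order_tendstoD(2)[of "\<lambda>q. cmod (\<rho> q)" "cmod (\<rho> 0)"])
       (auto intro!: tendsto_norm simp: isCont_def tendsto_at_iff_tendsto_nhds)
  then obtain d where d: "d > 0" "\<And>q. dist q 0 < d \<Longrightarrow> cmod (\<rho> q) < 1"
    unfolding eventually_nhds_metric by blast
  define X where "X = \<bar>ln d\<bar> + 1"
  show ?thesis
  proof (rule that)
    show "X > 0" by (simp add: X_def)
    fix v assume v: "Re v \<ge> X"
    have vH: "v \<in> H" using v by (simp add: H_def X_def)
    have "exp (- Re v) < exp (ln d)" using v by (subst exp_less_cancel_iff) (simp add: X_def)
    hence "cmod (exp (-v)) < d" using d by simp
    hence 1: "cmod (\<rho> (exp (-v))) < 1" using d(2) by simp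
    have "1 / P v - 1 = - (exp (-v)^2 * \<rho> (exp (-v)))"
      using P_nz[OF vH] unfolding r(3)[OF vH] \<rho>_def by (simp add: field_simps)
    hence "cmod (1 / P v - 1) = exp (- Re v)^2 * cmod (\<rho> (exp (-v)))"
      by (simp add: norm_mult norm_power)
    also have "\<dots> < exp (- Re v)^2 * 1" using 1 by (intro mult_strict_left_mono) auto
    also have "exp (- Re v)^2 = exp (- 2 * Re v)" by (simp flip: exp_double)
    finally show "cmod (1 / P v - 1) < exp (- 2 * Re v)" by simp
  qed
qed

lemma P_bound_infinity:
  obtains K where "K > 0" "\<And>v. Re v \<ge> 1 \<Longrightarrow> cmod (P v - 1) \<le> K * exp (- 2 * Re v)"
proof -
  obtain r where r: "r holomorphic_on ball 0 1" "cmod (r 0) < 1"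
    "\<And>v. v \<in> H \<Longrightarrow> P v = 1 + exp (-v)^2 * r (exp (-v))" using P_expansion by blast
  obtain K where K: "K > 0" "\<And>v. Re v \<ge> 1 \<Longrightarrow> cmod (r (exp (-v))) \<le> K"
    using bounded_along_exp[OF r(1)] by blast
  show ?thesis
  proof (rule that[OF K(1)])
    fix v assume v: "Re v \<ge> 1"
    have "exp (- Re v)^2 * cmod (r (exp (-v))) \<le> exp (- Re v)^2 * K"
      by (intro mult_left_mono K(2) v) auto
    moreover have "exp (- Re v)^2 = exp (- 2 * Re v)" by (simp flip: exp_double)
    ultimately show "cmod (P v - 1) \<le> K * exp (- 2 * Re v)"
      using r(3)[of v] v by (simp add: H_def norm_mult norm_power mult.commute)
  qed
qed

section \<open>Zero-freeness of the Loewner chain\<close>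

lemma P_periodic: "P (v + 2 * of_real pi * of_int n * \<i>) = P v"
proof -
  have "exp (v + 2 * of_real pi * of_int n * \<i>) = exp v"
    by (subst exp_eq) auto
  thus ?thesis by (simp only: P_def)
qed

text \<open>A zero of \<open>B c\<close> at parameter \<open>c\<close> can be followed to smaller \<open>c\<close>, staying in the
  admissible region: this is where \<open>Re (s / (s - E)) > 1/2\<close> enters.\<close>
lemma zero_moves_outward:
  assumes c: "0 < c" "c \<le> 1" and v: "v \<in> H" "exp (- 2 * Re v / a) \<le> c" and zero: "B c v = 0"
  shows "\<exists>c' v'. 0 < c' \<and> c' < c \<and> v' \<in> H \<and> exp (- 2 * Re v' / a) \<le> c' \<and> B c' v' = 0"
proof -
  \<comment> \<open>\<open>B c v = 0\<close> is equivalent to \<open>\<kappa> v = c\<close>, so a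
    local inverse of \<kappa> follows the zero as c varies.\<close>
  define \<kappa> where "\<kappa> v = 1 - 1 / P v" for v
  have Pv: "of_real (1 - c) * P v = 1" using zero by (simp add: B_def)
  hence c1: "1 - c \<noteq> 0" by (metis mult_zero_left of_real_0 zero_neq_one)
  have P: "P v = 1 / of_real (1 - c)" using Pv c1 by (metis nonzero_mult_div_cancel_left of_real_eq_0_iff)
  have \<kappa>v: "\<kappa> v = of_real c" unfolding \<kappa>_def P by simp
  define W where "W = s - E c v"
  have Wnz: "W \<noteq> 0" using E_lt[OF v(1) c v(2)] by (auto simp: W_def)
  have QP: "P v * (Q v - P v) = - of_real (c / (a * (1 - c)^2)) * W"
  proof -
    have "of_real (1 - c) * (Q v - P v) = of_real (1 - c) * Q v - 1"
      using Pv by (simp only: right_diff_distrib)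
    also have "\<dots> = - (of_real (c / a) * W)"
      unfolding W_def by (simp only: one_minus_Q_eq[OF c(1), of v, symmetric] minus_diff_eq)
    finally have eq: "Q v - P v = - (of_real (c / a) * W) / of_real (1 - c)"
      using c1 by (metis nonzero_mult_div_cancel_left of_real_eq_0_iff)
    show ?thesis unfolding eq unfolding P by (simp add: power2_eq_square mult_ac)
  qed
  define D\<kappa> where "D\<kappa> = - of_real (c / a) * W / s"
  have D\<kappa>nz: "D\<kappa> \<noteq> 0" using Wnz c by (simp add: D\<kappa>_def)
  have \<kappa>_hol: "\<kappa> holomorphic_on H"
    unfolding \<kappa>_def by (intro holomorphic_intros P_hol) (use P_nz in auto)
  have "(\<kappa> has_field_derivative (P v * (Q v - P v) / s) / (P v)^2) (at v)"
    unfolding \<kappa>_def by (rule derivative_eq_intros P_deriv[OF v(1)] refl | use P_nz[OF v(1)] in \<open>simp add: power2_eq_square\<close>)+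
  moreover have "(P v * (Q v - P v) / s) / (P v)^2 = D\<kappa>"
  proof -
    define o1 where "o1 = complex_of_real (1 - c)"
    have "o1 \<noteq> 0" using c1 unfolding o1_def of_real_eq_0_iff .
    have e: "complex_of_real (c / (a * (1 - c)^2)) = of_real (c / a) / o1^2"
      unfolding o1_def by simp
    show ?thesis using \<open>o1 \<noteq> 0\<close>
      unfolding QP unfolding P D\<kappa>_def e o1_def[symmetric] by (simp add: field_simps)
  qed
  ultimately have d\<kappa>: "deriv \<kappa> v = D\<kappa>" by (simp add: DERIV_imp_deriv)
  obtain r where r: "r > 0" "ball v r \<subseteq> H" "inj_on \<kappa> (ball v r)"
    using has_complex_derivative_locally_injective[OF \<kappa>_hol v(1) open_H] d\<kappa> D\<kappa>nz by metis
  have \<kappa>_hol_r: "\<kappa> holomorphic_on ball v r" using \<kappa>_hol r(2) holomorphic_on_subset by blast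
  obtain \<psi> where \<psi>: "\<psi> holomorphic_on (\<kappa> ` ball v r)"
      "\<And>z. z \<in> ball v r \<Longrightarrow> deriv \<kappa> z * deriv \<psi> (\<kappa> z) = 1" "\<And>z. z \<in> ball v r \<Longrightarrow> \<psi> (\<kappa> z) = z"
    using holomorphic_has_inverse[OF \<kappa>_hol_r open_ball r(3)] by blast
  have opn: "open (\<kappa> ` ball v r)"
    by (rule open_mapping_thm3[OF \<kappa>_hol_r open_ball r(3)])
  have vb: "v \<in> ball v r" using r by simp
  have cmem: "of_real c \<in> \<kappa> ` ball v r" using imageI[OF vb, of \<kappa>] \<kappa>v by simp
  have \<psi>c: "\<psi> (of_real c) = v" using \<psi>(3)[OF vb] \<kappa>v by simp
  have "deriv \<psi> (of_real c) = 1 / D\<kappa>"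
    using \<psi>(2)[OF vb] D\<kappa>nz unfolding \<kappa>v d\<kappa> by (simp add: field_simps)
  hence "(\<psi> has_field_derivative 1 / D\<kappa>) (at (of_real c))"
    using \<psi>(1) opn cmem by (metis holomorphic_derivI)
  hence "((\<lambda>x. \<psi> (of_real x)) has_vector_derivative 1 / D\<kappa>) (at c)"
    using has_vector_derivative_real_field by blast
  hence "((\<lambda>x. Re (\<psi> (of_real x))) has_real_derivative Re (1 / D\<kappa>)) (at c)"
    by (simp add: has_vector_derivative_complex_iff)
  \<comment> \<open>Admissibility reads \<open>0 \<le> Re v + a / 2 * ln c\<close>. Along the moving
    zero this quantity has derivative (a/c)(1/2 - Re (s/W)) < 0, so it increases as c
    decreases.\<close>
  hence dD: "((\<lambda>x. Re (\<psi> (of_real x)) + a / 2 * ln x) has_real_derivative Re (1 / D\<kappa>) + a / 2 * (1 / c)) (at c)"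
    by (rule DERIV_add) (rule DERIV_cmult, rule DERIV_ln_divide, rule c(1))
  have "Re (1 / D\<kappa>) = - (a / c) * Re (s / W)"
  proof -
    have "1 / D\<kappa> = of_real (- (a / c)) * (s / W)" using c Wnz by (simp add: D\<kappa>_def field_simps)
    thus ?thesis by (simp only: times_complex.simps Re_complex_of_real Im_complex_of_real mult_zero_left diff_zero)
  qed
  moreover have "Re (s / W) > 1/2"
    unfolding W_def by (rule Re_divide_diff_gt_half[OF E_lt[OF v(1) c v(2)]])
  hence "a / c * (1 / 2) < a / c * Re (s / W)" using c by (intro mult_strict_left_mono) auto
  ultimately have "Re (1 / D\<kappa>) + a / 2 * (1 / c) < 0" by simp
  from DERIV_neg_dec_left[OF dD this] obtain d where d: "d > 0"
    "\<And>h. h > 0 \<Longrightarrow> h < d \<Longrightarrow> Re (\<psi> (of_real c)) + a / 2 * ln c < Re (\<psi> (of_real (c - h))) + a / 2 * ln (c - h)"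
    by blast
  obtain e where e: "e > 0" "\<And>z. dist z (of_real c) < e \<Longrightarrow> z \<in> \<kappa> ` ball v r"
    using opn cmem unfolding open_dist by blast
  define h where "h = min (min d e) c / 2"
  have h: "h > 0" "h < d" "h < e" "h < c" using d e c by (auto simp: h_def)
  define c' where "c' = c - h"
  have "dist (complex_of_real c') (of_real c) < e" using h by (simp add: c'_def dist_norm)
  then obtain z where z: "z \<in> ball v r" "of_real c' = \<kappa> z" using e(2) by blast
  have zH: "z \<in> H" using z r by blast
  have \<psi>z: "\<psi> (of_real c') = z" using \<psi>(3)[OF z(1)] z(2) by simp
  have c': "0 < c'" "c' < c" using h by (auto simp: c'_def)
  have "0 \<le> Re v + a / 2 * ln c"
  proof -
    have "- 2 * Re v / a \<le> ln c" using v(2) c by (metis ln_exp ln_mono exp_gt_zero)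
    thus ?thesis by (simp add: field_simps)
  qed
  also have "\<dots> < Re z + a / 2 * ln c'" using d(2)[OF h(1,2)] by (simp add: \<psi>c flip: c'_def \<psi>z)
  finally have "- 2 * Re z / a \<le> ln c'" by (simp add: field_simps)
  hence "exp (- 2 * Re z / a) \<le> c'" using c' by (metis exp_le_cancel_iff exp_ln)
  moreover have "B c' z = 0"
    using z(2) P_nz[OF zH] by (simp add: B_def \<kappa>_def)
  ultimately show ?thesis using zH c' by blast
qed

text \<open>Modulo the period 2 pi i the admissible zeros with parameter at most \<open>c\<close>
  form a compact set: \<open>P_near_infinity\<close> bounds Re v from above, and c < 1 keeps it away
  from 0. A zero with least parameter would contradict \<open>zero_moves_outward\<close>.\<close>

lemma B_nz:
  assumes c: "0 < c" "c \<le> 1" and v: "v \<in> H" "exp (- 2 * Re v / a) \<le> c"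
  shows "B c v \<noteq> 0"
proof
  assume zero: "B c v = 0"
  obtain X where X: "X > 0" "\<And>v. Re v \<ge> X \<Longrightarrow> cmod (1 / P v - 1) < exp (- 2 * Re v)"
    using P_near_infinity by blast
  define Z where "Z = {(c', v'). 0 < c' \<and> c' \<le> c \<and> v' \<in> H \<and> exp (- 2 * Re v' / a) \<le> c' \<and> B c' v' = 0}"
  have c1: "c < 1"
    using zero c(2) by (cases "c = 1") (auto simp: B_def)
  define L where "L = - (a / 2) * ln c"
  have L: "L > 0" using c c1 by (simp add: L_def mult_neg_neg mult_pos_neg ln_less_zero)
  have Zx: "L \<le> Re v' \<and> Re v' \<le> X" if "(c', v') \<in> Z" for c' v'
  proof
    have z: "0 < c'" "c' \<le> c" "v' \<in> H" "exp (- 2 * Re v' / a) \<le> c'" "B c' v' = 0"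
      using that by (auto simp: Z_def)
    have "exp (- 2 * Re v' / a) \<le> c" using z by simp
    hence "- 2 * Re v' / a \<le> ln c" using c by (metis ln_exp ln_mono exp_gt_zero)
    thus "L \<le> Re v'" by (simp add: L_def field_simps)
    show "Re v' \<le> X"
    proof (rule ccontr)
      assume "\<not> Re v' \<le> X"
      hence "cmod (1 / P v' - 1) < exp (- 2 * Re v')" using X by simp
      moreover have "1 / P v' - 1 = - of_real c'"
        using z(5) P_nz[OF z(3)] by (simp add: B_def field_simps)
      ultimately have "c' < exp (- 2 * Re v')" using z(1) by simp
      also have "\<dots> \<le> exp (- 2 * Re v' / a)"
      proof -
        have "Re v' * 1 \<le> Re v' * a" using a_ge z(3) by (intro mult_left_mono) (auto simp: H_def)
        thus ?thesis by (simp add: field_simps)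
      qed
      finally show False using z(4) by simp
    qed
  qed
  define S where "S = Z \<inter> {(c', v'). 0 \<le> Im v' \<and> Im v' \<le> 2 * pi}"
  have shift: "\<exists>v''. (c', v'') \<in> S" if "(c', v') \<in> Z" for c' v'
  proof -
    define n where "n = \<lfloor>Im v' / (2 * pi)\<rfloor>"
    define v'' where "v'' = v' + 2 * of_real pi * of_int (- n) * \<i>"
    have "P v'' = P v'" unfolding v''_def by (rule P_periodic)
    moreover have "Re v'' = Re v'" by (simp add: v''_def)
    ultimately have "(c', v'') \<in> Z" using that by (simp add: Z_def B_def H_def)
    moreover have "Im v'' = Im v' - 2 * pi * of_int n" by (simp add: v''_def)
    moreover have "of_int n \<le> Im v' / (2 * pi)" "Im v' / (2 * pi) < of_int n + 1"
      unfolding n_def by linarith+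
    hence "2 * pi * of_int n \<le> Im v'" "Im v' \<le> 2 * pi * of_int n + 2 * pi"
      by (auto simp: field_simps)
    ultimately show ?thesis by (intro exI[of _ v'']) (simp add: S_def)
  qed
  have "(c, v) \<in> Z" using c v zero by (simp add: Z_def)
  hence Sne: "S \<noteq> {}" using shift by blast
  define BOX where "BOX = {exp (- 2 * X / a)..c} \<times> cbox (Complex L 0) (Complex X (2 * pi))"
  have BOXH: "BOX \<subseteq> UNIV \<times> H" using L by (auto simp: BOX_def in_cbox_complex_iff H_def)
  have S_eq: "S = BOX \<inter> {p. exp (- 2 * Re (snd p) / a) \<le> fst p} \<inter> {p \<in> BOX. B (fst p) (snd p) = 0}"
  proof (intro equalityI subsetI)
    fix p assume "p \<in> S"
    then obtain c' v' where p: "p = (c', v')" "(c', v') \<in> Z" "0 \<le> Im v'" "Im v' \<le> 2 * pi" by (auto simp: S_def)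
    have z: "0 < c'" "c' \<le> c" "v' \<in> H" "exp (- 2 * Re v' / a) \<le> c'" "B c' v' = 0"
      using p(2) by (auto simp: Z_def)
    have "exp (- 2 * X / a) \<le> exp (- 2 * Re v' / a)" using Zx[OF p(2)] by (simp add: field_simps)
    hence "exp (- 2 * X / a) \<le> c'" using z(4) by linarith
    thus "p \<in> BOX \<inter> {p. exp (- 2 * Re (snd p) / a) \<le> fst p} \<inter> {p \<in> BOX. B (fst p) (snd p) = 0}"
      using p z Zx[OF p(2)] by (auto simp: BOX_def in_cbox_complex_iff)
  next
    fix p assume p: "p \<in> BOX \<inter> {p. exp (- 2 * Re (snd p) / a) \<le> fst p} \<inter> {p \<in> BOX. B (fst p) (snd p) = 0}"
    have "exp (- 2 * X / a) \<le> fst p" using p by (auto simp: BOX_def)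
    hence "0 < fst p" by (rule less_le_trans[OF exp_gt_zero])
    moreover have "snd p \<in> H" using p BOXH by auto
    ultimately show "p \<in> S" using p by (auto simp: S_def Z_def BOX_def in_cbox_complex_iff case_prod_unfold)
  qed
  have contB: "continuous_on BOX (\<lambda>p. B (fst p) (snd p))"
    unfolding B_def by (intro continuous_intros continuous_on_compose2[OF holomorphic_on_imp_continuous_on[OF P_hol]]) (use BOXH in auto)
  have cB: "compact BOX" unfolding BOX_def by (intro compact_Times compact_Icc compact_cbox)
  have "compact S" unfolding S_eq
  proof (intro compact_Int_closed[OF compact_Int_closed[OF cB]])
    show "closed {p::real \<times> complex. exp (- 2 * Re (snd p) / a) \<le> fst p}"
      by (intro closed_Collect_le continuous_intros) auto
    have "closedin (top_of_set BOX) (BOX \<inter> (\<lambda>p. B (fst p) (snd p)) -` {0})"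
      by (intro continuous_closedin_preimage contB) auto
    hence "closed (BOX \<inter> (\<lambda>p. B (fst p) (snd p)) -` {0})"
      using cB compact_imp_closed closedin_closed_trans by blast
    moreover have "BOX \<inter> (\<lambda>p. B (fst p) (snd p)) -` {0} = {p \<in> BOX. B (fst p) (snd p) = 0}" by auto
    ultimately show "closed {p \<in> BOX. B (fst p) (snd p) = 0}" by simp
  qed
  then obtain p where p: "p \<in> S" "\<And>q. q \<in> S \<Longrightarrow> fst p \<le> fst q"
    using continuous_attains_inf[of S fst] Sne continuous_on_fst[OF continuous_on_id] by blast
  have "0 < fst p" "fst p \<le> c" "snd p \<in> H" "exp (- 2 * Re (snd p) / a) \<le> fst p" "B (fst p) (snd p) = 0"
    using p(1) by (auto simp: S_def Z_def)
  moreover from this obtain c' v' where "0 < c'" "c' < fst p" "v' \<in> H" "exp (- 2 * Re v' / a) \<le> c'" "B c' v' = 0"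
    using zero_moves_outward[of "fst p" "snd p"] c by auto
  ultimately have "(c', v') \<in> Z" "c' < fst p" by (auto simp: Z_def)
  then obtain v'' where "(c', v'') \<in> S" using shift by blast
  thus False using p(2) \<open>c' < fst p\<close> by force
qed

text \<open>For fixed \<open>v\<close> the values \<open>B c v\<close> run along a segment starting at \<open>B 1 v = 1\<close>, so zero-freeness
  already keeps them off the negative axis.\<close>
lemma B_slit:
  assumes c: "0 < c" "c \<le> 1" and v: "v \<in> H" "exp (- 2 * Re v / a) \<le> c"
  shows "B c v \<notin> \<real>\<^sub>\<le>\<^sub>0"
proof
  assume "B c v \<in> \<real>\<^sub>\<le>\<^sub>0"
  then obtain x where x: "x \<le> 0" "B c v = of_real x" by (auto elim!: nonpos_Reals_cases)
  define c' where "c' = 1 - (1 - c) / (1 - x)"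
  have "0 \<le> (1 - c) / (1 - x)" "(1 - c) / (1 - x) \<le> 1 - c"
    using x(1) c mult_left_mono[of 1 "1 - x" "1 - c"] by (auto simp: field_simps)
  hence c': "c \<le> c'" "c' \<le> 1" by (auto simp: c'_def)
  have "of_real (1 - c) * P v = of_real (1 - x)" using x(2) by (simp add: B_def algebra_simps)
  hence "of_real ((1 - c) / (1 - x)) * P v = 1" using x(1) by (simp add: field_simps)
  hence "B c' v = 0" by (simp add: B_def c'_def)
  thus False using B_nz[of c' v] c c' v by auto
qed

section \<open>The regularised extensions\<close>

text \<open>The power with the principal logarithm; \<open>B_slit\<close> keeps its base off the cut
  at admissible points.\<close>

definition Psi :: "real \<Rightarrow> complex \<Rightarrow> complex" where "Psi c v = G v * exp (s * Ln (B c v))"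

definition vT :: "real \<Rightarrow> complex \<Rightarrow> complex" where "vT T u = Complex (mu T (Re u)) (Im u)"

text \<open>For Re u >= T this gives c = 1 and v = u, hence \<open>Phi T u = G u\<close>; for Re u
  <= -T it gives the boundary value c = e^(-2 Re v/a) with v the reflection of u.\<close>

definition cT :: "real \<Rightarrow> complex \<Rightarrow> real" where "cT T u = exp ((Re u - mu T (Re u)) / a)"

definition Phi :: "real \<Rightarrow> complex \<Rightarrow> complex" where "Phi T u = Psi (cT T u) (vT T u)"

text \<open>With x = Re u, the inequality x <= mu gives c <= 1, and x >= -mu gives the lower bound
  on c.\<close>

lemma cT_admissible:
  assumes "T > 0"
  shows "0 < cT T u" "cT T u \<le> 1" "vT T u \<in> H" "exp (- 2 * Re (vT T u) / a) \<le> cT T u"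
proof -
  note m = mu_ge[OF assms, of "Re u"]
  show "0 < cT T u" by (simp add: cT_def)
  show "cT T u \<le> 1" using m by (simp add: cT_def divide_nonpos_pos)
  show "vT T u \<in> H" using mu_pos[OF assms, of "Re u"] by (simp add: vT_def H_def)
  have "- 2 * mu T (Re u) / a \<le> (Re u - mu T (Re u)) / a"
    using m by (intro divide_right_mono) auto
  thus "exp (- 2 * Re (vT T u) / a) \<le> cT T u" by (simp add: vT_def cT_def)
qed

text \<open>The common factor of the partial derivatives \<open>pdx\<close> and \<open>pdy\<close>
  of \<open>Phi\<close>. For slope 1 of mu the differential is the complex linear map h -> Lam (s -
  E) h; for slope -1 it is h -> Lam (s h + E cnj h), of dilatation |E/s|.\<close>

definition Lam :: "real \<Rightarrow> complex \<Rightarrow> complex" where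
  "Lam T u = Phi T u * P (vT T u) * of_real (cT T u / a) / B (cT T u) (vT T u)"

definition pdx :: "real \<Rightarrow> complex \<Rightarrow> complex" where
  "pdx T u = Lam T u * ((s - E (cT T u) (vT T u)) * of_real (dmu T (Re u)) + s * of_real (1 - dmu T (Re u)))"

definition pdy :: "real \<Rightarrow> complex \<Rightarrow> complex" where
  "pdy T u = Lam T u * \<i> * (s - E (cT T u) (vT T u))"

definition dPhi :: "real \<Rightarrow> complex \<Rightarrow> complex \<Rightarrow> complex" where
  "dPhi T u h = pdx T u * of_real (Re h) + pdy T u * of_real (Im h)"

lemma Phi_deriv:
  assumes T: "T > 0"
  shows "(Phi T has_derivative dPhi T u) (at u)"
proof -
  note adm = cT_admissible[OF T, of u]
  define m where "m = dmu T (Re u)"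
  define c where "c = cT T u"
  define v where "v = vT T u"
  define dv where "dv h = of_real (m * Re h) + \<i> * of_real (Im h)" for h :: complex
  have dm: "((\<lambda>u. mu T (Re u)) has_derivative (\<lambda>h. Re h * m)) (at u)"
    unfolding m_def by (rule field_derivative_compose_has_derivative[OF mu_deriv[OF T]]) (auto intro!: derivative_eq_intros)
  have "((\<lambda>u. complex_of_real (mu T (Re u)) + \<i> * of_real (Im u)) has_derivative
      (\<lambda>h. of_real (Re h * m) + \<i> * of_real (Im h))) (at u)"
    by (rule derivative_eq_intros dm refl)+ simp
  hence dvT: "(vT T has_derivative dv) (at u)"
    by (simp add: vT_def[abs_def] dv_def[abs_def] Complex_eq mult.commute)
  have dc: "(cT T has_derivative (\<lambda>h. c * (1 - m) / a * Re h)) (at u)"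
  proof -
    have "((\<lambda>u. (Re u - mu T (Re u)) / a) has_derivative (\<lambda>h. (Re h - Re h * m) / a)) (at u)"
      by (intro bounded_linear.has_derivative[OF bounded_linear_divide] has_derivative_diff dm bounded_linear_imp_has_derivative bounded_linear_Re)
    from field_derivative_compose_has_derivative[OF DERIV_exp this]
    have "(cT T has_derivative (\<lambda>h. (Re h - Re h * m) / a * c)) (at u)"
      unfolding cT_def[abs_def] c_def .
    moreover have "(Re h - Re h * m) / a * c = c * (1 - m) / a * Re h" for h
      by (simp add: field_simps)
    ultimately show ?thesis by (simp only:)
  qed
  have dG: "((\<lambda>u. G (vT T u)) has_derivative (\<lambda>h. dv h * (P v * G v))) (at u)"
    unfolding v_def by (rule field_derivative_compose_has_derivative[OF G_deriv dvT]) (rule adm)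
  have dP: "((\<lambda>u. P (vT T u)) has_derivative (\<lambda>h. dv h * (P v * (Q v - P v) / s))) (at u)"
    unfolding v_def by (rule field_derivative_compose_has_derivative[OF P_deriv dvT]) (rule adm)
  define dB where "dB h = of_real (c * (1 - m) / a * Re h) * P v - of_real (1 - c) * (dv h * (P v * (Q v - P v) / s))" for h
  have dB: "((\<lambda>u. B (cT T u) (vT T u)) has_derivative dB) (at u)"
    unfolding B_def dB_def
    by (rule derivative_eq_intros dP dc refl)+ (auto simp: fun_eq_iff c_def v_def algebra_simps)
  have Bs: "B c v \<notin> \<real>\<^sub>\<le>\<^sub>0" unfolding c_def v_def by (rule B_slit[OF adm])
  hence Bnz: "B c v \<noteq> 0" by auto
  have "((\<lambda>u. Ln (B (cT T u) (vT T u))) has_derivative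
      (\<lambda>h. dB h * inverse (B c v))) (at u)"
    unfolding c_def v_def
    by (rule field_derivative_compose_has_derivative[OF has_field_derivative_Ln dB]) (use Bs c_def v_def in auto)
  hence "((\<lambda>u. s * Ln (B (cT T u) (vT T u))) has_derivative
      (\<lambda>h. s * (dB h * inverse (B c v)))) (at u)"
    by (rule has_derivative_mult_right)
  from field_derivative_compose_has_derivative[OF DERIV_exp this]
  have dexp: "((\<lambda>u. exp (s * Ln (B (cT T u) (vT T u)))) has_derivative
      (\<lambda>h. s * (dB h * inverse (B c v))
        * exp (s * Ln (B c v)))) (at u)"
    by (simp only: c_def v_def)
  have "(Phi T has_derivative (\<lambda>h. G v * (s * (dB h * inverse (B c v))
        * exp (s * Ln (B c v))) + dv h * (P v * G v) * exp (s * Ln (B c v)))) (at u)"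
    unfolding Phi_def[abs_def] Psi_def using has_derivative_mult[OF dG dexp] by (simp only: c_def v_def)
  moreover have "G v * (s * (dB h * inverse (B c v))
        * exp (s * Ln (B c v))) + dv h * (P v * G v) * exp (s * Ln (B c v))
      = dPhi T u h" for h
  proof -
    define o1 where "o1 = complex_of_real (1 - c)"
    define X where "X = complex_of_real (c * (1 - m) / a * Re h)"
    define S where "S = s - E c v"
    have Q: "1 - o1 * Q v = of_real (c / a) * S"
      unfolding o1_def S_def by (rule one_minus_Q_eq) (use adm c_def in auto)
    have B1: "B c v = 1 - o1 * P v" by (simp add: B_def o1_def)
    have "G v * (s * ((X * P v - o1 * (dv h * (P v * (Q v - P v) / s))) * inverse (B c v))
        * exp (s * Ln (B c v))) + dv h * (P v * G v) * exp (s * Ln (B c v))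
      = Psi c v * P v / B c v * (s * X + dv h * (B c v - o1 * (Q v - P v)))"
      using Bnz unfolding Psi_def by (simp add: field_simps)
    \<comment> \<open>Here \<open>P\<close> drops out: B - (1 - c)(Q - P) = 1 - (1 - c) Q. This
      cancellation is the reason for the definition of \<open>Q\<close>.\<close>
    also have "B c v - o1 * (Q v - P v) = of_real (c / a) * S"
      using Q unfolding B1 by (simp add: algebra_simps)
    also have "s * X + dv h * (of_real (c / a) * S) =
       of_real (c / a) * ((S * of_real m + s * of_real (1 - m)) * of_real (Re h) + \<i> * S * of_real (Im h))"
      unfolding X_def dv_def by (simp add: field_simps)
    also have "Psi c v * P v / B c v * \<dots> = dPhi T u h"
      unfolding dPhi_def pdx_def pdy_def Lam_def Phi_def c_def[symmetric] v_def[symmetric] m_def[symmetric] S_def[symmetric]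
      by (simp add: algebra_simps add_divide_distrib diff_divide_distrib)
    finally show ?thesis unfolding dB_def X_def o1_def .
  qed
  ultimately show ?thesis by (simp only:)
qed

lemma vT_cont: "T > 0 \<Longrightarrow> isCont (vT T) u"
  unfolding vT_def[abs_def] Complex_eq
  by (intro continuous_intros isCont_o2[where f = Re and g = "mu T"])
     (auto intro: DERIV_isCont[OF mu_deriv])

lemma cT_cont: "T > 0 \<Longrightarrow> isCont (cT T) u"
  unfolding cT_def[abs_def]
  by (intro continuous_intros isCont_o2[where f = Re and g = "mu T"])
     (auto intro: DERIV_isCont[OF mu_deriv])

lemma Phi_cont: "T > 0 \<Longrightarrow> isCont (Phi T) u"
  using Phi_deriv has_derivative_continuous by blast

lemma isCont_H: "f holomorphic_on H \<Longrightarrow> v \<in> H \<Longrightarrow> isCont f v"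
  by (metis holomorphic_on_imp_continuous_on continuous_on_eq_continuous_at open_H)

lemma Q_hol: "Q holomorphic_on H"
  unfolding Q_def by (intro holomorphic_intros P_hol holomorphic_deriv) (use P_nz in auto)

lemma pd_cont:
  assumes T: "T > 0"
  shows "isCont (pdx T) u" "isCont (pdy T) u" "isCont (\<lambda>u. E (cT T u) (vT T u)) u"
    "isCont (\<lambda>u. B (cT T u) (vT T u)) u" "isCont (\<lambda>u. P (vT T u)) u"
proof -
  note adm = cT_admissible[OF T, of u]
  show P: "isCont (\<lambda>u. P (vT T u)) u" 
    using isCont_o2[OF vT_cont[OF T] isCont_H[OF P_hol adm(3)]] .
  have Q: "isCont (\<lambda>u. Q (vT T u)) u" 
    using isCont_o2[OF vT_cont[OF T] isCont_H[OF Q_hol adm(3)]] .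
  show B: "isCont (\<lambda>u. B (cT T u) (vT T u)) u" unfolding B_def
    by (intro continuous_intros P cT_cont[OF T])
  show E: "isCont (\<lambda>u. E (cT T u) (vT T u)) u" unfolding E_def
    by (intro continuous_intros Q cT_cont[OF T]) (use adm in auto)
  have L: "isCont (Lam T) u" unfolding Lam_def[abs_def]
    by (intro continuous_intros P B Phi_cont[OF T] cT_cont[OF T]) (use B_nz[OF adm] in auto)
  have d: "isCont (\<lambda>u. dmu T (Re u)) u"
    by (rule isCont_o2[where f = Re and g = "dmu T"]) (auto intro: dmu_cont[OF T] continuous_intros)
  show "isCont (pdx T) u" "isCont (pdy T) u"
    unfolding pdx_def[abs_def] pdy_def[abs_def] by (intro continuous_intros L E d)+
qed

lemma Phi_nz: "T > 0 \<Longrightarrow> Phi T u \<noteq> 0"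
  using cT_admissible[of T u] G_nz by (simp add: Phi_def Psi_def)

lemma Lam_nz: "T > 0 \<Longrightarrow> Lam T u \<noteq> 0"
  using cT_admissible[of T u] B_nz[of "cT T u" "vT T u"] P_nz[of "vT T u"] Phi_nz[of T u] by (simp add: Lam_def)

text \<open>After division by Lam (s - E) the differential is p dx + i dy with Re p = m + (1 - m) Re
  (s/(s - E)). For m = 1 this is 1; for -1 <= m < 1 it exceeds (1 + m)/2 >= 0.\<close>

lemma Phi_deriv_inj:
  assumes T: "T > 0" and h: "dPhi T u h = 0"
  shows "h = 0"
proof -
  note adm = cT_admissible[OF T, of u]
  define S where "S = s - E (cT T u) (vT T u)"
  define m where "m = dmu T (Re u)"
  have Snz: "S \<noteq> 0" using E_lt[OF adm(3,1,2,4)] by (auto simp: S_def)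
  define p where "p = of_real m + of_real (1 - m) * (s / S)"
  have "dPhi T u h = Lam T u * S * (p * of_real (Re h) + \<i> * of_real (Im h))"
    unfolding dPhi_def pdx_def pdy_def S_def[symmetric] m_def[symmetric] p_def using Snz by (simp add: field_simps)
  hence z: "p * of_real (Re h) + \<i> * of_real (Im h) = 0" using h Lam_nz[OF T] Snz by simp
  have m: "-1 \<le> m" "m \<le> 1" using dmu_le[OF T, of "Re u"] by (auto simp: m_def)
  have "1/2 < Re (s / S)" unfolding S_def by (rule Re_divide_diff_gt_half[OF E_lt[OF adm(3,1,2,4)]])
  have "Re p = m + (1 - m) * Re (s / S)" unfolding p_def
    by (simp only: plus_complex.simps times_complex.simps Re_complex_of_real Im_complex_of_real mult_zero_left diff_zero)
  moreover have "m + (1 - m) * Re (s / S) > 0"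
  proof (cases "m = 1")
    case False
    hence "(1 - m) * (1/2) < (1 - m) * Re (s / S)" using m \<open>1/2 < Re (s / S)\<close> by (intro mult_strict_left_mono) auto
    thus ?thesis using m by simp
  qed simp
  ultimately have "Re p > 0" by simp
  have "Re p * Re h = 0" using arg_cong[OF z, of Re] by simp
  hence "Re h = 0" using \<open>Re p > 0\<close> by simp
  moreover have "Im p * Re h + Im h = 0" using arg_cong[OF z, of Im] by simp
  ultimately show "h = 0" by (simp add: complex_eq_iff)
qed

lemma Phi_locally_injective:
  assumes T: "T > 0"
  obtains r where "r > 0" "inj_on (Phi T) (ball u r)"
proof -
  have lin: "linear (dPhi T u)"
    unfolding dPhi_def by (intro linearI) (auto simp: algebra_simps scaleR_conv_of_real)
  have inj: "inj (dPhi T u)"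
    unfolding linear_injective_0[OF lin]
  proof (intro allI impI)
    fix h assume "dPhi T u h = 0"
    thus "h = 0" by (rule Phi_deriv_inj[OF T])
  qed
  obtain g' where g': "linear g'" "g' \<circ> dPhi T u = id"
    using linear_injective_left_inverse[OF lin inj] by (elim exE conjE) (rule that)
  have on: "\<exists>d>0. \<forall>x. dist u x < d \<longrightarrow> onorm (\<lambda>v. dPhi T x v - dPhi T u v) < e" if e: "e > 0" for e
  proof -
    obtain d1 where d1: "d1 > 0" "\<And>x. dist x u < d1 \<Longrightarrow> dist (pdx T x) (pdx T u) < e/3"
      using pd_cont(1)[OF T, of u] e unfolding continuous_at_eps_delta by (metis divide_pos_pos zero_less_numeral)
    obtain d2 where d2: "d2 > 0" "\<And>x. dist x u < d2 \<Longrightarrow> dist (pdy T x) (pdy T u) < e/3"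
      using pd_cont(2)[OF T, of u] e unfolding continuous_at_eps_delta by (metis divide_pos_pos zero_less_numeral)
    show ?thesis
    proof (intro exI[of _ "min d1 d2"] conjI allI impI)
      show "min d1 d2 > 0" using d1 d2 by simp
      fix x assume x: "dist u x < min d1 d2"
      have "onorm (\<lambda>v. dPhi T x v - dPhi T u v) \<le> 2 * e / 3"
      proof (rule onorm_le)
        fix v :: complex
        have "dPhi T x v - dPhi T u v = (pdx T x - pdx T u) * of_real (Re v) + (pdy T x - pdy T u) * of_real (Im v)"
          by (simp add: dPhi_def algebra_simps)
        hence "norm (dPhi T x v - dPhi T u v) \<le> norm (pdx T x - pdx T u) * \<bar>Re v\<bar> + norm (pdy T x - pdy T u) * \<bar>Im v\<bar>"
          by (metis norm_triangle_ineq norm_mult norm_of_real)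
        also have "\<dots> \<le> e/3 * norm v + e/3 * norm v"
          using d1(2)[of x] d2(2)[of x] x e abs_Re_le_cmod[of v] abs_Im_le_cmod[of v]
          by (intro add_mono mult_mono) (auto simp: dist_norm norm_minus_commute)
        finally show "norm (dPhi T x v - dPhi T u v) \<le> 2 * e / 3 * norm v" by simp
      qed
      thus "onorm (\<lambda>v. dPhi T x v - dPhi T u v) < e" using e by simp
    qed
  qed
  obtain r where "r > 0" "inj_on (Phi T) (ball u r)"
  proof (rule has_derivative_locally_injective[of u UNIV g' "dPhi T" "Phi T"])
    show "bounded_linear g'" using g'(1) by (simp add: linear_conv_bounded_linear)
    show "\<And>x. (Phi T has_derivative dPhi T x) (at x)" by (rule Phi_deriv[OF T])
  qed (use g'(2) on in auto)
  thus ?thesis by (rule that)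
qed

section \<open>The regularised maps in the plane\<close>

definition FT :: "real \<Rightarrow> complex \<Rightarrow> complex" where
  "FT T z = (if z = 0 then 0 else Phi T (Ln z))"

text \<open>Makes \<open>FT\<close> independent of the branch of the logarithm in its definition, so
  it is smooth across the cut of \<open>Ln\<close>.\<close>

lemma Phi_periodic: "Phi T (u + 2 * of_real pi * of_int n * \<i>) = Phi T u"
proof -
  have v: "vT T (u + 2 * of_real pi * of_int n * \<i>) = vT T u + 2 * of_real pi * of_int n * \<i>"
    by (simp add: vT_def complex_eq_iff)
  have "exp (v + 2 * of_real pi * of_int n * \<i>) = exp v" for v :: complex
    by (subst exp_eq) auto
  hence "G (v + 2 * of_real pi * of_int n * \<i>) = G v" for v by (simp only: G_def)
  moreover have "cT T (u + 2 * of_real pi * of_int n * \<i>) = cT T u" by (simp add: cT_def)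
  ultimately show ?thesis by (simp only: Phi_def Psi_def v B_def P_periodic)
qed

lemma FT_exp: "FT T (exp u) = Phi T u"
proof -
  have "exp (Ln (exp u)) = exp u" by simp
  then obtain n :: int where "Ln (exp u) = u + 2 * of_real pi * of_int n * \<i>"
    unfolding exp_eq by (auto simp: mult_ac)
  thus ?thesis by (simp add: FT_def Phi_periodic)
qed

text \<open>\<open>Ln z0 + Ln (z / z0)\<close> is a branch of the logarithm near \<open>z0\<close>
  even when \<open>z0\<close> lies on the cut of \<open>Ln\<close>.\<close>

lemma local_log:
  assumes "z0 \<noteq> 0" "z \<in> ball z0 (cmod z0)"
  shows "z / z0 \<notin> \<real>\<^sub>\<le>\<^sub>0" "exp (Ln z0 + Ln (z / z0)) = z"
proof -
  have "cmod (z / z0 - 1) < 1"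
    using assms by (simp add: dist_norm norm_minus_commute norm_divide divide_simps flip: diff_divide_distrib)
  hence "Re (z / z0) > 0" using abs_Re_le_cmod[of "z / z0 - 1"] by simp
  thus "z / z0 \<notin> \<real>\<^sub>\<le>\<^sub>0" by (auto elim!: nonpos_Reals_cases)
  hence "z / z0 \<noteq> 0" by auto
  thus "exp (Ln z0 + Ln (z / z0)) = z" using assms by (simp add: exp_add)
qed

lemma FT_deriv:
  assumes T: "T > 0" and u: "exp u = z0"
  shows "(FT T has_derivative (\<lambda>h. dPhi T u (h / z0))) (at z0)"
proof -
  have z0: "z0 \<noteq> 0" using u by auto
  have "((\<lambda>z. u + Ln (z / z0)) has_field_derivative 1 / z0) (at z0)"
    by (rule derivative_eq_intros refl | use z0 in simp)+
  hence "((\<lambda>z. u + Ln (z / z0)) has_derivative (\<lambda>h. h / z0)) (at z0)"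
    by (simp add: has_field_derivative_def mult.commute[of _ "inverse z0"] divide_inverse)
  moreover have "(Phi T has_derivative dPhi T u) (at (u + Ln (z0 / z0)))"
    using Phi_deriv[OF T, of u] z0 by simp
  ultimately have "((\<lambda>z. Phi T (u + Ln (z / z0))) has_derivative
      (\<lambda>h. dPhi T u (h / z0))) (at z0)"
    by (rule has_derivative_compose)
  thus ?thesis
  proof (rule has_derivative_transform_within_open[of _ _ _ _ "ball z0 (cmod z0)"])
    fix z assume z: "z \<in> ball z0 (cmod z0)"
    have "exp (u + Ln (z / z0)) = z"
      using local_log(2)[OF z0 z] u z0 by (simp add: exp_add)
    thus "Phi T (u + Ln (z / z0)) = FT T z" using FT_exp[of T "u + Ln (z / z0)"] by simp
  qed (use z0 in auto)
qed

lemma FT_nz: "T > 0 \<Longrightarrow> z \<noteq> 0 \<Longrightarrow> FT T z \<noteq> 0"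
  by (simp add: FT_def Phi_nz)

lemma exp_nbhd:
  assumes "exp u = z" "r > 0"
  obtains e where "e > 0" "ball z e \<subseteq> exp ` ball (u::complex) r"
proof -
  have "\<not> exp constant_on (UNIV :: complex set)"
    unfolding constant_on_def by (metis UNIV_I exp_zero exp_eq_1 zero_neq_one one_complex.simps(1))
  hence "open (exp ` ball u r)"
    by (intro open_mapping_thm[of exp UNIV]) (auto intro: holomorphic_intros)
  moreover have "z \<in> exp ` ball u r" using assms by (auto intro!: image_eqI[of _ _ u])
  ultimately show ?thesis using that open_contains_ball by metis
qed

lemma FT_locally_injective:
  assumes T: "T > 0" and z0: "z0 \<noteq> 0"
  shows "\<exists>r>0. inj_on (FT T) (ball z0 r)"
proof -
  obtain r where r: "r > 0" "inj_on (Phi T) (ball (Ln z0) r)" using Phi_locally_injective[OF T] by blast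
  obtain e where e: "e > 0" "ball z0 e \<subseteq> exp ` ball (Ln z0) r" using exp_nbhd[OF exp_Ln[OF z0] r(1)] by blast
  have "inj_on (FT T) (exp ` ball (Ln z0) r)"
  proof (rule inj_onI, elim imageE)
    fix x y u v assume *: "FT T x = FT T y" "x = exp u" "u \<in> ball (Ln z0) r" "y = exp v" "v \<in> ball (Ln z0) r"
    hence "Phi T u = Phi T v" by (simp add: FT_exp)
    thus "x = y" using * inj_onD[OF r(2)] by blast
  qed
  thus ?thesis using e inj_on_subset by blast
qed

lemma FT_outside:
  assumes T: "T > 0" and z: "exp T \<le> cmod z"
  shows "FT T z = g z"
proof -
  have z0: "z \<noteq> 0" using z exp_gt_zero[of T] by auto
  have Re: "Re (Ln z) \<ge> T" using z z0 by (simp add: ln_ge_iff)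
  hence "mu T (Re (Ln z)) = Re (Ln z)" using mu_outside[OF T, of "Re (Ln z)"] T by simp
  hence "vT T (Ln z) = Ln z" "cT T (Ln z) = 1" by (simp_all add: vT_def cT_def complex_eq_iff)
  thus ?thesis using z0 by (simp add: FT_def Phi_def Psi_def B_def G_def)
qed

lemma FT_outside_ln: "0 < T \<Longrightarrow> T \<le> ln (cmod z) \<Longrightarrow> FT T z = g z"
  using FT_outside[of T z] by (cases "z = 0") (auto simp: ln_ge_iff)

lemma FT_eq:
  assumes "0 < T'" "T' \<le> T" "z \<noteq> 0" "T \<le> \<bar>ln (cmod z)\<bar>"
  shows "FT T' z = FT T z"
proof -
  have "mu T' (ln (cmod z)) = mu T (ln (cmod z))"
    using assms mu_outside[of T "ln (cmod z)"] mu_outside[of T' "ln (cmod z)"] by simp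
  thus ?thesis using assms(3) by (simp add: FT_def Phi_def vT_def cT_def)
qed

text \<open>The map g read in the chart at infinity: 1/g(1/q), continued over q = 0.\<close>

definition J :: "complex \<Rightarrow> complex" where "J q = q / (1 + q * \<phi> q)"

lemma J_nz: "q \<in> ball 0 1 \<Longrightarrow> 1 + q * \<phi> q \<noteq> 0"
proof (cases "q = 0")
  case False
  assume q: "q \<in> ball 0 1"
  have "g (inverse q) = (1 + q * \<phi> q) / q" using False q g_phi[of q] by (simp add: field_simps)
  moreover have "1 < cmod (inverse q)" using False q by (simp add: norm_inverse one_less_inverse)
  ultimately show ?thesis using g_nz by force
qed simp

lemma J_hol: "J holomorphic_on ball 0 1"
  unfolding J_def by (intro holomorphic_intros phi_hol) (use J_nz in auto)

lemma J_eq: "q \<in> ball 0 1 \<Longrightarrow> q \<noteq> 0 \<Longrightarrow> J q = inverse (g (inverse q))"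
proof -
  assume q: "q \<in> ball 0 1" "q \<noteq> 0"
  have "g (inverse q) = (1 + q * \<phi> q) / q" using q g_phi[of q] by (simp add: field_simps)
  thus ?thesis by (simp add: J_def)
qed

lemma J_deriv: "deriv J 0 = 1"
proof -
  have "(\<phi> has_field_derivative deriv \<phi> 0) (at 0)"
    using phi_hol by (auto intro!: holomorphic_derivI[OF _ open_ball])
  hence "(J has_field_derivative 1) (at 0)"
    unfolding J_def[abs_def] by (auto intro!: derivative_eq_intros)
  thus ?thesis by (rule DERIV_imp_deriv)
qed

lemma g_inj_near_infinity:
  obtains R where "R > 1" "inj_on g {z. R < cmod z}"
proof -
  obtain r where r: "r > 0" "ball 0 r \<subseteq> ball (0::complex) 1" "inj_on J (ball 0 r)"
    using has_complex_derivative_locally_injective[OF J_hol _ open_ball, of 0] J_deriv by auto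
  have inj: "x = y" if "x \<in> {z. max 2 (1/r) < cmod z}" "y \<in> {z. max 2 (1/r) < cmod z}" "g x = g y" for x y
  proof -
    have *: "inverse z \<in> ball 0 r \<and> inverse z \<noteq> 0 \<and> J (inverse z) = inverse (g z)" if "z \<in> {z. max 2 (1/r) < cmod z}" for z
    proof -
      have z: "1 / r < cmod z" "z \<noteq> 0" using that r by auto
      hence "inverse (cmod z) < r" using r(1) by (simp add: field_simps)
      hence "inverse z \<in> ball 0 r" by (simp add: norm_inverse)
      moreover from this have "inverse z \<in> ball 0 1" using r(2) by blast
      ultimately show ?thesis using J_eq[of "inverse z"] z by simp
    qed
    have "J (inverse x) = J (inverse y)" using *[OF that(1)] *[OF that(2)] that(3) by simp
    hence "inverse x = inverse y" using *[OF that(1)] *[OF that(2)] inj_onD[OF r(3), of "inverse x" "inverse y"] by blast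
    thus ?thesis by simp
  qed
  show ?thesis by (rule that[of "max 2 (1/r)"]) (use inj in \<open>auto intro!: inj_onI\<close>)
qed

lemma g_at_infinity: "filterlim g at_infinity at_infinity"
proof -
  have "isCont \<phi> 0" using phi_hol
    by (auto dest!: holomorphic_on_imp_continuous_on simp: continuous_on_eq_continuous_at)
  hence lim: "((\<lambda>z. \<phi> (inverse z)) \<longlongrightarrow> \<phi> 0) at_infinity"
    by (rule isCont_tendsto_compose) (rule tendsto_inverse_0)
  have "filterlim (\<lambda>z. \<phi> (inverse z) + z) at_infinity at_infinity"
    by (rule tendsto_add_filterlim_at_infinity[OF lim filterlim_ident])
  moreover have "\<forall>\<^sub>F z in at_infinity. \<phi> (inverse z) + z = g z"
    unfolding eventually_at_infinity
  proof (intro exI[of _ 2] allI impI)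
    fix z :: complex assume "2 \<le> cmod z"
    hence "z \<noteq> 0" "1 < cmod z" by auto
    thus "\<phi> (inverse z) + z = g z" using g_phi[of "inverse z"] by (simp add: norm_inverse inverse_less_1_iff)
  qed
  ultimately show ?thesis by (rule filterlim_mono_eventually[OF _ order_refl order_refl])
qed

lemma FT_at_infinity: "T > 0 \<Longrightarrow> filterlim (FT T) at_infinity at_infinity"
proof -
  assume T: "T > 0"
  have "\<forall>\<^sub>F z in at_infinity. g z = FT T z"
    unfolding eventually_at_infinity using FT_outside[OF T] by metis
  thus ?thesis by (rule filterlim_mono_eventually[OF g_at_infinity order_refl order_refl])
qed

lemma G_growth:
  obtains K where "K > 0" "\<And>v. Re v \<ge> 1 \<Longrightarrow> cmod (G v) \<le> K * exp (Re v)"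
proof -
  obtain K where K: "K > 0" "\<And>v. Re v \<ge> 1 \<Longrightarrow> cmod (\<phi> (exp (-v))) \<le> K"
    using bounded_along_exp[OF phi_hol] by blast
  show ?thesis
  proof (rule that[of "1 + K"])
    show "1 + K > 0" using K by simp
    fix v assume v: "Re v \<ge> 1"
    have "cmod (\<phi> (exp (-v))) \<le> K" by (rule K(2)[OF v])
    moreover have "g (inverse (exp (-v))) = inverse (exp (-v)) + \<phi> (exp (-v))"
      by (rule g_phi) (use v in auto)
    hence "G v = exp v + \<phi> (exp (-v))" by (simp add: G_def exp_minus)
    ultimately have "cmod (G v) \<le> exp (Re v) + K"
      using norm_triangle_ineq[of "exp v" "\<phi> (exp (-v))"] by simp
    also have "K \<le> K * exp (Re v)" using K v by simp
    finally show "cmod (G v) \<le> (1 + K) * exp (Re v)" by (simp add: algebra_simps)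
  qed
qed

text \<open>With m = -ln |z| one has c = e^(-2m/a). Since P - 1 = O(e^(-2m)) and e^(-2m) <= c, also
  B = O(c), so |B^s| = O(c^a) = O(e^(-2m)); the imaginary part of s costs only the factor e^(|b|
  pi). Multiplying by |G| = O(e^m) leaves O(e^(-m)) = O(|z|).\<close>

lemma FT_near_0:
  assumes T: "T > 0"
  obtains C \<rho> where "C > 0" "\<rho> > 0" "\<And>z. z \<noteq> 0 \<Longrightarrow> cmod z < \<rho> \<Longrightarrow> cmod (FT T z) \<le> C * cmod z"
proof -
  obtain K where K: "K > 0" "\<And>v. Re v \<ge> 1 \<Longrightarrow> cmod (P v - 1) \<le> K * exp (- 2 * Re v)" using P_bound_infinity by blast
  obtain L where L: "L > 0" "\<And>v. Re v \<ge> 1 \<Longrightarrow> cmod (G v) \<le> L * exp (Re v)" using G_growth by blast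
  define C where "C = L * ((1 + K) powr a * exp (\<bar>b\<bar> * pi))"
  show ?thesis
  proof (rule that[of C "exp (- max T 1)"])
    show "C > 0" using K L by (simp add: C_def)
    show "exp (- max T 1) > 0" by simp
    fix z :: complex assume z: "z \<noteq> 0" "cmod z < exp (- max T 1)"
    define m where "m = - ln (cmod z)"
    have "ln (cmod z) < - max T 1" using z by (metis ln_exp ln_less_cancel_iff zero_less_norm_iff exp_gt_zero)
    hence m: "m \<ge> T" "m \<ge> 1" by (auto simp: m_def)
    have mu: "mu T (ln (cmod z)) = m" using mu_outside[OF T, of "- m"] m z by (simp add: m_def)
    define v where "v = vT T (Ln z)"
    define c where "c = cT T (Ln z)"
    note adm = cT_admissible[OF T, of "Ln z", folded v_def c_def]
    have Rev: "Re v = m" using z by (simp add: v_def vT_def mu)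
    have lnz: "ln (cmod z) = - m" by (simp add: m_def)
    have c: "c = exp (- 2 * m / a)" using z mu unfolding lnz by (simp add: c_def cT_def lnz)
    have Bs: "B c v \<noteq> 0" by (rule B_nz[OF adm])
    have "B c v = of_real c - of_real (1 - c) * (P v - 1)" by (simp add: B_def algebra_simps)
    hence "cmod (B c v) \<le> c + (1 - c) * cmod (P v - 1)"
      using norm_triangle_ineq4[of "of_real c" "of_real (1 - c) * (P v - 1)"] adm
      by (simp add: norm_mult del: of_real_diff)
    also have "\<dots> \<le> c + 1 * (K * c)"
    proof -
      have "m * 1 \<le> m * a" using a_ge m by (intro mult_left_mono) auto
      hence "exp (- 2 * m) \<le> c" unfolding c by (simp add: field_simps)
      hence "K * exp (- 2 * m) \<le> K * c" using K by simp
      hence "cmod (P v - 1) \<le> K * c" using K(2)[of v] m Rev by simp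
      thus ?thesis using adm by (intro add_left_mono mult_mono) auto
    qed
    finally have B: "cmod (B c v) \<le> (1 + K) * c" by (simp add: algebra_simps)
    have "cmod (exp (s * Ln (B c v))) = exp (a * ln (cmod (B c v)) - b * Im (Ln (B c v)))"
      using Bs by simp
    also have "\<dots> \<le> exp (a * ln ((1 + K) * c) + \<bar>b\<bar> * pi)"
    proof -
      have "\<bar>Im (Ln (B c v))\<bar> \<le> pi" using mpi_less_Im_Ln[OF Bs] Im_Ln_le_pi[OF Bs] by simp
      hence "\<bar>b * Im (Ln (B c v))\<bar> \<le> \<bar>b\<bar> * pi" by (simp add: abs_mult mult_left_mono)
      moreover have "a * ln (cmod (B c v)) \<le> a * ln ((1 + K) * c)"
      proof (rule mult_left_mono)
        have "0 < (1 + K) * c" using K adm by simp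
        thus "ln (cmod (B c v)) \<le> ln ((1 + K) * c)" using B Bs by (subst ln_le_cancel_iff) auto
      qed simp
      ultimately show ?thesis unfolding exp_le_cancel_iff by linarith
    qed
    also have "a * ln ((1 + K) * c) = a * ln (1 + K) - 2 * m"
      using K by (subst ln_mult_pos) (auto simp: c right_diff_distrib)
    also have "exp (a * ln (1 + K) - 2 * m + \<bar>b\<bar> * pi) = (1 + K) powr a * exp (\<bar>b\<bar> * pi) * exp (- 2 * m)"
      using K by (simp add: powr_def exp_diff exp_add exp_minus field_simps)
    finally have e: "cmod (exp (s * Ln (B c v))) \<le> (1 + K) powr a * exp (\<bar>b\<bar> * pi) * exp (- 2 * m)" .
    have "cmod (FT T z) = cmod (G v) * cmod (exp (s * Ln (B c v)))"
      using z by (simp add: FT_def Phi_def Psi_def v_def c_def norm_mult)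
    also have "\<dots> \<le> (L * exp m) * ((1 + K) powr a * exp (\<bar>b\<bar> * pi) * exp (- 2 * m))"
      using L(2)[of v] L(1) Rev m e by (intro mult_mono) auto
    also have "\<dots> = C * (exp m * exp (- 2 * m))" by (simp add: C_def)
    also have "exp m * exp (- 2 * m) = exp (- m)" by (simp flip: exp_add)
    also have "exp (- m) = cmod z" using z by (simp add: m_def)
    finally show "cmod (FT T z) \<le> C * cmod z" .
  qed
qed

lemma FT_cont:
  assumes T: "T > 0"
  shows "continuous_on UNIV (FT T)"
proof -
  have "isCont (FT T) z" for z
  proof (cases "z = 0")
    case False thus ?thesis using FT_deriv[OF T exp_Ln[OF False]] has_derivative_continuous by blast
  next
    case True
    obtain C \<rho> where C: "C > 0" "\<rho> > 0" "\<And>z. z \<noteq> 0 \<Longrightarrow> cmod z < \<rho> \<Longrightarrow> cmod (FT T z) \<le> C * cmod z"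
      using FT_near_0[OF T] by blast
    have "(FT T \<longlongrightarrow> 0) (at 0)"
    proof (rule Lim_null_comparison)
      show "\<forall>\<^sub>F z in at 0. cmod (FT T z) \<le> C * cmod z"
        unfolding eventually_at using C by (intro exI[of _ \<rho>]) auto
      show "((\<lambda>z::complex. C * cmod z) \<longlongrightarrow> 0) (at 0)" by (auto intro!: tendsto_eq_intros)
    qed
    thus ?thesis using True by (simp add: isCont_def FT_def)
  qed
  thus ?thesis by (simp add: continuous_on_eq_continuous_at)
qed

lemma FT_homeomorphism:
  assumes T: "T > 0"
  shows "\<exists>h. homeomorphism UNIV UNIV (FT T) h"
proof -
  obtain R where R: "R > 1" "inj_on g {z. R < cmod z}" by (rule g_inj_near_infinity)
  have "inj_on (FT T) {z. max R (exp T) < cmod z}"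
  proof (rule inj_onI)
    fix x y assume "x \<in> {z. max R (exp T) < cmod z}" "y \<in> {z. max R (exp T) < cmod z}" "FT T x = FT T y"
    thus "x = y" using FT_outside[OF T, of x] FT_outside[OF T, of y] inj_onD[OF R(2), of x y] by simp
  qed
  hence "inj (FT T)"
    by (intro locally_injective_imp_inj[where R = "max R (exp T)"] FT_cont FT_nz FT_locally_injective FT_at_infinity T)
       (simp_all add: FT_def)
  thus ?thesis
    using inj_proper_imp_homeomorphism[OF FT_cont[OF T] _ FT_at_infinity[OF T]] by blast
qed

section \<open>Boundary behaviour\<close>

lemma FT_0 [simp]: "FT T 0 = 0" by (simp add: FT_def)

text \<open>The homeomorphism pulls \<open>S\<close> back to a connected set, on which the modulus
  takes all intermediate values. It acts as a maximum principle for these non-holomorphic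
  maps.\<close>

lemma FT_crosses_circle:
  assumes T: "T > 0" and S: "connected S" "FT T x \<in> S" "FT T y \<in> S" and \<rho>: "cmod x \<le> \<rho>" "\<rho> \<le> cmod y"
  obtains z where "cmod z = \<rho>" "FT T z \<in> S"
proof -
  obtain h where h: "homeomorphism UNIV UNIV (FT T) h" using FT_homeomorphism[OF T] by blast
  have hf: "h (FT T x) = x" and fh: "FT T (h x) = x" for x
    using h by (auto simp: homeomorphism_def)
  have "connected (cmod ` h ` S)"
    by (intro connected_continuous_image continuous_intros S continuous_on_subset[OF homeomorphism_cont2[OF h]]) auto
  moreover have "cmod x \<in> cmod ` h ` S" "cmod y \<in> cmod ` h ` S"
    using imageI[OF S(2), of "\<lambda>p. cmod (h p)"] imageI[OF S(3), of "\<lambda>p. cmod (h p)"]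
    unfolding hf image_image by blast+
  ultimately have "\<rho> \<in> cmod ` h ` S" using connectedD_interval \<rho> by blast
  then obtain p where "p \<in> S" "cmod (h p) = \<rho>" by blast
  thus ?thesis using that[of "h p"] fh by simp
qed

text \<open>For T <= 1 all F_T coincide with F_1 on the circles of radius 1/e and e. If |g(w)| were
  below the minimum of |F_1| on the inner circle, or above its maximum on the outer one, the
  preimage of a disc about 0, or of the complement of a disc, would cross that circle, which is
  impossible.\<close>

lemma G_bounds:
  obtains l U where "l > 0" "\<And>v. 0 < Re v \<Longrightarrow> Re v \<le> 1 \<Longrightarrow> l \<le> cmod (G v) \<and> cmod (G v) \<le> U"
proof -
  have cF: "continuous_on S (\<lambda>z. cmod (FT 1 z))" for S
    by (intro continuous_intros continuous_on_subset[OF FT_cont]) auto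
  have ne: "sphere (0::complex) (exp (-1)) \<noteq> {}" "sphere (0::complex) (exp 1) \<noteq> {}" by (simp_all add: sphere_eq_empty)
  obtain z0 where z0: "z0 \<in> sphere 0 (exp (-1))" "\<And>z. z \<in> sphere 0 (exp (-1)) \<Longrightarrow> cmod (FT 1 z0) \<le> cmod (FT 1 z)"
    using continuous_attains_inf[OF compact_sphere ne(1) cF] by blast
  obtain z1 where z1: "z1 \<in> sphere 0 (exp 1)" "\<And>z. z \<in> sphere 0 (exp 1) \<Longrightarrow> cmod (FT 1 z) \<le> cmod (FT 1 z1)"
    using continuous_attains_sup[OF compact_sphere ne(2) cF] by blast
  define l where "l = cmod (FT 1 z0)"
  define U where "U = cmod (FT 1 z1)"
  have "z0 \<noteq> 0" using z0(1) by auto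
  hence l: "l > 0" by (simp add: l_def FT_nz)
  have bnd: "l \<le> cmod (g w) \<and> cmod (g w) \<le> U" if w: "1 < cmod w" "cmod w \<le> exp 1" for w
  proof -
    \<comment> \<open>At this scale F_T takes the value g(w) at \<open>w\<close> and still equals
      F_1 on both comparison circles.\<close>
    define T where "T = min 1 (ln (cmod w))"
    have T: "T > 0" "T \<le> 1" using w by (auto simp: T_def intro!: ln_gt_zero)
    have FTw: "FT T w = g w" by (rule FT_outside_ln[OF T(1)]) (simp add: T_def)
    have eqs: "FT T z = FT 1 z" if "z \<in> sphere 0 (exp (-1)) \<union> sphere 0 (exp 1)" for z
      by (rule FT_eq[OF T]) (use that in auto)
    have low: "l \<le> cmod (g w)"
    proof (rule ccontr)
      assume "\<not> l \<le> cmod (g w)"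
      hence "FT T w \<in> ball 0 l" "FT T 0 \<in> ball 0 l" using FTw l by simp_all
      moreover have "exp (-1) \<le> (1::real)" by simp
      hence "exp (-1) \<le> cmod w" using w by linarith
      ultimately obtain z where "cmod z = exp (-1)" "FT T z \<in> ball 0 l"
        using FT_crosses_circle[OF T(1) connected_ball, of 0 0 l w "exp (-1)"] by auto
      thus False using z0(2)[of z] eqs[of z] by (simp add: l_def)
    qed
    have up: "cmod (g w) \<le> U"
    proof (rule ccontr)
      assume nU: "\<not> cmod (g w) \<le> U"
      have cc: "connected (- cball (0::complex) U)"
        by (rule connected_complement_bounded_convex) auto
      have "bounded {z. cmod (FT T z) \<le> U}" by (rule bounded_preimage_at_infinity[OF FT_at_infinity[OF T(1)]])
      then obtain R where R: "\<And>z. cmod (FT T z) \<le> U \<Longrightarrow> cmod z \<le> R" unfolding bounded_iff by blast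
      define z where "z = complex_of_real (max R (exp 1) + 1)"
      have "cmod z = \<bar>max R (exp 1) + 1\<bar>" unfolding z_def by (rule norm_of_real)
      hence z: "cmod z > R" "cmod z \<ge> exp 1" by linarith+
      have "FT T z \<in> - cball 0 U" "FT T w \<in> - cball 0 U" using R[of z] z FTw nU by auto
      then obtain p where "cmod p = exp 1" "FT T p \<in> - cball 0 U"
        using FT_crosses_circle[OF T(1) cc, of w z "exp 1"] w(2) z(2) by auto
      thus False using z1(2)[of p] eqs[of p] by (simp add: U_def)
    qed
    show ?thesis using low up by blast
  qed
  show ?thesis
    by (rule that[OF l, of U]) (use bnd in \<open>auto simp: G_def\<close>)
qed

lemma g_inj: "inj_on g {z. 1 < cmod z}"
proof (rule inj_onI)
  fix x y assume x: "x \<in> {z. 1 < cmod z}" and y: "y \<in> {z. 1 < cmod z}" and eq: "g x = g y"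
  define T where "T = min (ln (cmod x)) (ln (cmod y))"
  have T: "T > 0" using x y by (auto simp: T_def intro!: ln_gt_zero)
  have "FT T x = g x" "FT T y = g y" by (intro FT_outside_ln[OF T], simp add: T_def)+
  moreover obtain h where "homeomorphism UNIV UNIV (FT T) h" using FT_homeomorphism[OF T] by blast
  ultimately show "x = y" using eq by (metis UNIV_I homeomorphism_apply1)
qed

text \<open>Otherwise Bloch's theorem would put infinitely many disjoint discs of one size into the bounded
  image of the annulus \<open>1 < \<bar>w\<bar> < e\<close>.\<close>
lemma P_small:
  assumes \<delta>: "\<delta> > 0"
  obtains x0 where "x0 > 0" "x0 \<le> 1" "\<And>v. 0 < Re v \<Longrightarrow> Re v \<le> x0 \<Longrightarrow> Re v * cmod (P v) < \<delta>"
proof -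
  have "\<exists>x0>0. \<forall>v. 0 < Re v \<longrightarrow> Re v < x0 \<longrightarrow> Re v * cmod (P v) < \<delta>"
  proof (rule ccontr)
    assume "\<not> ?thesis"
    hence ex: "\<exists>v. 0 < Re v \<and> Re v < x0 \<and> \<delta> \<le> Re v * cmod (P v)" if "x0 > 0" for x0
      using that by (meson not_le)
    define A where "A v \<longleftrightarrow> 0 < Re v \<and> Re v < 1/2 \<and> \<delta> \<le> Re v * cmod (P v)" for v
    \<comment> \<open>The factor 1/4 separates the discs \<open>W n\<close>: points of
      \<open>W n\<close> have real part between x/2 and 3x/2 for x = Re (v n), and the next disc
      stays below 3x/8.\<close>
    have "\<exists>v::nat \<Rightarrow> complex. \<forall>n. A (v n) \<and> Re (v (Suc n)) < Re (v n) / 4"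
    proof (rule dependent_nat_choice)
      show "\<exists>x. A x" using ex[of "1/2"] unfolding A_def by auto
      show "\<exists>y. A y \<and> Re y < Re x / 4" if "A x" for x n
        using ex[of "min (1/2) (Re x / 4)"] that unfolding A_def by auto
    qed
    then obtain v :: "nat \<Rightarrow> complex" where v: "\<And>n. A (v n)" "\<And>n. Re (v (Suc n)) < Re (v n) / 4" by blast
    have pos: "0 < Re (v n)" "Re (v n) < 1/2" for n using v(1)[of n] by (auto simp: A_def)
    have dec: "Re (v n) < Re (v m) / 4" if "m < n" for m n
      using that
    proof (induction n)
      case (Suc n)
      show ?case
      proof (cases "m = n")
        case False
        hence "Re (v n) < Re (v m) / 4" using Suc by simp
        thus ?thesis using v(2)[of n] pos(1)[of n] by linarith
      qed (use v(2) in simp)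
    qed simp
    obtain l U where lU: "l > 0" "\<And>v. 0 < Re v \<Longrightarrow> Re v \<le> 1 \<Longrightarrow> l \<le> cmod (G v) \<and> cmod (G v) \<le> U"
      using G_bounds by blast
    define W where "W n = ball (v n) (Re (v n) / 2)" for n
    have WRe: "Re (v n) / 2 < Re z \<and> Re z < 3 / 2 * Re (v n)" if "z \<in> W n" for z n
    proof -
      have "\<bar>Re (v n) - Re z\<bar> < Re (v n) / 2"
        using that abs_Re_le_cmod[of "v n - z"] by (simp add: W_def dist_norm)
      thus ?thesis by linarith
    qed
    \<comment> \<open>Bloch's theorem on a disc of radius x/2 gives a disc of radius (x/2)|G'|/12 =
      x|P||G|/24, which is at least \<delta> l/24.\<close>
    define \<rho> where "\<rho> = \<delta> * l / 24"
    have \<rho>: "\<rho> > 0" using \<delta> lU by (simp add: \<rho>_def)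
    have "\<exists>b. ball b \<rho> \<subseteq> G ` W n" for n
    proof -
      have vH: "v n \<in> H" using pos by (simp add: H_def)
      have "W n \<subseteq> H" using WRe pos(1)[of n] by (force simp: H_def)
      hence holo: "G holomorphic_on ball (v n) (Re (v n) / 2)" using G_hol holomorphic_on_subset W_def by blast
      have "deriv G (v n) = P (v n) * G (v n)" by (rule DERIV_imp_deriv[OF G_deriv[OF vH]])
      hence "Re (v n) / 2 * cmod (deriv G (v n)) / 12 = (Re (v n) * cmod (P (v n))) * cmod (G (v n)) / 24"
        by (simp add: norm_mult)
      also have "\<dots> \<ge> \<delta> * l / 24"
        using v(1)[of n] lU(2)[of "v n"] pos[of n] \<delta> lU(1) by (intro divide_right_mono mult_mono) (auto simp: A_def)
      finally have "\<rho> \<le> Re (v n) / 2 * cmod (deriv G (v n)) / 12" by (simp add: \<rho>_def)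
      from Bloch[OF holo _ this] show ?thesis using pos(1)[of n] unfolding W_def by (metis half_gt_zero)
    qed
    then obtain b where b: "\<And>n. ball (b n) \<rho> \<subseteq> G ` W n" by metis
    have bmem: "b n \<in> G ` W n" for n using b[of n] \<rho> by auto
    have "cmod (b n) \<le> U" for n
    proof -
      obtain z where "z \<in> W n" "b n = G z" using bmem by blast
      thus ?thesis using WRe[of z n] lU(2)[of z] pos[of n] by auto
    qed
    hence "bounded (range b)" by (auto simp: bounded_iff)
    then obtain y r where r: "strict_mono (r :: nat \<Rightarrow> nat)" "(b \<circ> r) \<longlonglongrightarrow> y"
      using bounded_imp_convergent_subsequence by blast
    hence "Cauchy (b \<circ> r)" using LIMSEQ_imp_Cauchy by blast
    then obtain N where N: "\<And>m n. m \<ge> N \<Longrightarrow> n \<ge> N \<Longrightarrow> dist ((b \<circ> r) m) ((b \<circ> r) n) < \<rho>"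
      using \<rho> unfolding Cauchy_def by blast
    \<comment> \<open>Two centres closer than \<rho> put one of them into the images of two
      different discs \<open>W n\<close>, whose points have different real parts; this contradicts
      the injectivity of g.\<close>
    have "dist (b (r N)) (b (r (Suc N))) < \<rho>" using N[of N "Suc N"] by simp
    hence "b (r (Suc N)) \<in> G ` W (r N)" using b[of "r N"] by auto
    then obtain z where z: "z \<in> W (r N)" "b (r (Suc N)) = G z" by blast
    obtain z' where z': "z' \<in> W (r (Suc N))" "b (r (Suc N)) = G z'" using bmem by blast
    have lt: "r N < r (Suc N)" using r(1) by (simp add: strict_mono_Suc_iff)
    have Re: "Re z' < Re z" using WRe[OF z(1)] WRe[OF z'(1)] dec[OF lt] pos(1)[of "r N"] by linarith
    have "exp z' = exp z"
    proof (rule inj_onD[OF g_inj])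
      show "g (exp z') = g (exp z)" using z z' by (simp add: G_def)
      have "Re z > 0" "Re z' > 0" using WRe[OF z(1)] WRe[OF z'(1)] pos(1)[of "r N"] pos(1)[of "r (Suc N)"] by linarith+
      thus "exp z' \<in> {z. 1 < cmod z}" "exp z \<in> {z. 1 < cmod z}" by auto
    qed
    hence "cmod (exp z') = cmod (exp z)" by simp
    thus False using Re by simp
  qed
  then obtain x0 where x0: "x0 > 0" "\<And>v. 0 < Re v \<Longrightarrow> Re v < x0 \<Longrightarrow> Re v * cmod (P v) < \<delta>" by blast
  show ?thesis by (rule that[of "min 1 (x0 / 2)"]) (use x0 in auto)
qed

section \<open>Power growth of the derivative near the circle\<close>

lemma Q_bound: "v \<in> H \<Longrightarrow> cmod (1 - Q v) \<le> k * cmod s / Re v"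
proof -
  assume v: "v \<in> H"
  hence x: "Re v > 0" by (simp add: H_def)
  \<comment> \<open>The smallest admissible c makes the coefficient of 1 - Q as large as possible,
    at least 2x in modulus; the right-hand side k|s| + |b| is at most 2k|s|, and the factors 2
    cancel.\<close>
  define c where "c = exp (- 2 * Re v / a)"
  have c1: "c \<le> 1" using x by (simp add: c_def divide_nonpos_pos)
  have E: "cmod (E c v) \<le> k * cmod s" by (rule E_le[OF v]) (use c1 in \<open>auto simp: c_def\<close>)
  have ic: "1 / c = exp (2 * Re v / a)" by (simp add: c_def exp_minus divide_inverse)
  have "1 + 2 * Re v / a \<le> 1 / c" unfolding ic by (rule exp_ge_add_one_self)
  hence "a * (2 * Re v / a) \<le> a * (1 / c - 1)" by (intro mult_left_mono) auto
  hence ge: "2 * Re v \<le> a * (1 / c - 1)" by simp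
  have "of_real (a * (1 - 1 / c)) * (1 - Q v) = E c v - \<i> * of_real b" by (simp add: E_def)
  hence "\<bar>a * (1 - 1 / c)\<bar> * cmod (1 - Q v) = cmod (E c v - \<i> * of_real b)" by (metis norm_mult norm_of_real)
  also have "\<dots> \<le> cmod (E c v) + \<bar>b\<bar>" using norm_triangle_ineq4[of "E c v" "\<i> * of_real b"] by (simp add: norm_mult)
  also have "\<dots> \<le> 2 * (k * cmod s)" using E b_le' by simp
  finally have "\<bar>a * (1 - 1 / c)\<bar> * cmod (1 - Q v) \<le> 2 * (k * cmod s)" .
  moreover have "2 * Re v \<le> \<bar>a * (1 - 1 / c)\<bar>" using ge by (simp add: algebra_simps)
  ultimately have "2 * Re v * cmod (1 - Q v) \<le> 2 * (k * cmod s)"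
    using mult_right_mono[of "2 * Re v" "\<bar>a * (1 - 1 / c)\<bar>" "cmod (1 - Q v)"] by simp
  thus ?thesis using x by (simp add: field_simps)
qed

text \<open>The logarithmic derivative of \<open>P\<close> is (Q - P)/s. \<open>Q_bound\<close>
  contributes k/x and \<open>P_small\<close> contributes an arbitrarily small multiple of 1/x, so
  integration from \<open>x0\<close> gives a power with exponent below 1.\<close>

lemma P_growth:
  obtains \<beta> x0 C where "0 \<le> \<beta>" "\<beta> < 1" "x0 > 0" "x0 \<le> 1" "C > 0"
    "\<And>v. 0 < Re v \<Longrightarrow> Re v \<le> x0 \<Longrightarrow> cmod (P v) \<le> C * Re v powr -\<beta>"
proof -
  \<comment> \<open>Half of the gap between k and 1, so that k + \<delta>/|s| becomes \<beta> = (1 +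
    k)/2 < 1.\<close>
  define \<delta> where "\<delta> = cmod s * (1 - k) / 2"
  have \<delta>: "\<delta> > 0" using k_lt by (simp add: \<delta>_def)
  obtain x0 where x0: "x0 > 0" "x0 \<le> 1" "\<And>v. 0 < Re v \<Longrightarrow> Re v \<le> x0 \<Longrightarrow> Re v * cmod (P v) < \<delta>"
    using P_small[OF \<delta>] by blast
  define \<beta> where "\<beta> = (1 + k) / 2"
  have \<beta>: "k + \<delta> / cmod s = \<beta>" by (simp add: \<beta>_def \<delta>_def field_simps)
  have "convex H" unfolding H_def by (rule convex_halfspace_Re_gt)
  hence "contractible H" by (rule convex_imp_contractible)
  then obtain L where L: "L holomorphic_on H" "\<And>v. v \<in> H \<Longrightarrow> P v = exp (L v)"
    using contractible_imp_holomorphic_log[OF P_hol _ P_nz] by blast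
  have dL: "deriv L v = (Q v - P v) / s" "(L has_field_derivative deriv L v) (at v)" if v: "v \<in> H" for v
  proof -
    show 1: "(L has_field_derivative deriv L v) (at v)"
      using L(1) v by (auto intro!: holomorphic_derivI[OF _ open_H])
    have "((\<lambda>v. exp (L v)) has_field_derivative exp (L v) * deriv L v) (at v)"
      by (rule DERIV_chain2[OF DERIV_exp 1])
    hence "(P has_field_derivative exp (L v) * deriv L v) (at v)"
      by (rule has_field_derivative_transform_within_open[OF _ open_H v]) (simp add: L(2))
    hence "exp (L v) * deriv L v = P v * (Q v - P v) / s"
      using P_deriv[OF v] DERIV_unique by blast
    hence "P v * deriv L v = P v * ((Q v - P v) / s)" using L(2)[OF v] by simp
    thus "deriv L v = (Q v - P v) / s" using P_nz[OF v] mult_left_cancel by blast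
  qed
  have dL_le: "cmod (deriv L v) \<le> 1 / cmod s + \<beta> / Re v" if v: "0 < Re v" "Re v \<le> x0" for v
  proof -
    have vH: "v \<in> H" using v by (simp add: H_def)
    have "cmod (P v) \<le> \<delta> / Re v" using x0(3)[OF v] v by (simp add: field_simps)
    have Qeq: "Q v - P v = 1 - (1 - Q v) - P v" by simp
    have "cmod (Q v - P v) \<le> cmod (1 - (1 - Q v)) + cmod (P v)" unfolding Qeq by (rule norm_triangle_ineq4)
    also have "cmod (1 - (1 - Q v)) \<le> 1 + cmod (1 - Q v)" using norm_triangle_ineq4[of 1 "1 - Q v"] by simp
    finally have "cmod (Q v - P v) \<le> 1 + k * cmod s / Re v + \<delta> / Re v"
      using Q_bound[OF vH] \<open>cmod (P v) \<le> \<delta> / Re v\<close> by linarith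
    hence "cmod (Q v - P v) / cmod s \<le> (1 + k * cmod s / Re v + \<delta> / Re v) / cmod s"
      by (intro divide_right_mono) auto
    also have "\<dots> = 1 / cmod s + (k + \<delta> / cmod s) / Re v" using v by (simp add: field_simps)
    finally show ?thesis unfolding dL(1)[OF vH] \<beta> by (simp add: norm_divide)
  qed
  define C where "C = \<delta> / x0 * (x0 powr \<beta> * exp (x0 / cmod s))"
  have "cmod (P v) \<le> C * Re v powr -\<beta>" if v: "0 < Re v" "Re v \<le> x0" for v
  proof -
    define y where "y = Im v"
    \<comment> \<open>The two added terms have derivative \<beta>/x + 1/|s|, which outweighs any
      decrease of Re L; monotonicity replaces an integration.\<close>
    define \<psi> where "\<psi> x = Re (L (Complex x y)) + \<beta> * ln x + x / cmod s" for x
    have "\<psi> (Re v) \<le> \<psi> x0"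
    proof (rule DERIV_nonneg_imp_nondecreasing[OF v(2)])
      fix x assume x: "Re v \<le> x" "x \<le> x0"
      hence x': "0 < x" using v by simp
      have H: "Complex x y \<in> H" using x' by (simp add: H_def)
      have "((\<lambda>x. L (Complex x y)) has_vector_derivative 1 * deriv L (Complex x y)) (at x)"
        using field_vector_diff_chain_at[OF has_vector_derivative_Complex_left dL(2)[OF H]] unfolding o_def .
      hence "((\<lambda>x. Re (L (Complex x y))) has_real_derivative Re (deriv L (Complex x y))) (at x)"
        by (simp add: has_vector_derivative_complex_iff)
      hence "(\<psi> has_real_derivative Re (deriv L (Complex x y)) + \<beta> * (1 / x) + 1 / cmod s) (at x)"
        unfolding \<psi>_def by (intro DERIV_add DERIV_cmult DERIV_ln_divide x' DERIV_cdivide DERIV_ident)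
      moreover have "Re (deriv L (Complex x y)) + \<beta> * (1 / x) + 1 / cmod s \<ge> 0"
        using dL_le[of "Complex x y"] x x' abs_Re_le_cmod[of "deriv L (Complex x y)"] by simp
      ultimately show "\<exists>y. (\<psi> has_real_derivative y) (at x) \<and> 0 \<le> y" by blast
    qed
    hence le: "Re (L v) \<le> Re (L (Complex x0 y)) + \<beta> * ln x0 + x0 / cmod s - \<beta> * ln (Re v)"
      using v by (simp add: \<psi>_def y_def) (smt (verit) divide_nonneg_nonneg norm_ge_zero)
    have "cmod (P v) = exp (Re (L v))" using v L(2)[of v] by (simp add: H_def)
    also have "\<dots> \<le> exp (Re (L (Complex x0 y)) + \<beta> * ln x0 + x0 / cmod s - \<beta> * ln (Re v))"
      using le by simp
    also have "\<dots> = exp (Re (L (Complex x0 y))) * (x0 powr \<beta> * exp (x0 / cmod s)) * Re v powr - \<beta>"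
    proof -
      have "x0 powr \<beta> = exp (\<beta> * ln x0)" "Re v powr - \<beta> = exp (- \<beta> * ln (Re v))"
        using v x0 by (simp_all add: powr_def)
      thus ?thesis by (simp only: mult_exp_exp) (simp add: algebra_simps)
    qed
    also have "exp (Re (L (Complex x0 y))) = cmod (P (Complex x0 y))" using x0 L(2)[of "Complex x0 y"] by (simp add: H_def)
    also have "\<dots> \<le> \<delta> / x0" using x0(3)[of "Complex x0 y"] x0 by (simp add: field_simps)
    finally show ?thesis by (simp add: C_def mult_right_mono)
  qed
  moreover have "0 \<le> \<beta>" "\<beta> < 1" using k_ge k_lt by (auto simp: \<beta>_def)
  moreover have "C > 0" using \<delta> x0 by (simp add: C_def)
  ultimately show ?thesis using that x0 by blast
qed

text \<open>The derivative PG is bounded by a multiple of x^(-\<beta>), which integrates to x^(1 -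
  \<beta>).\<close>

lemma G_horizontal_increment:
  obtains \<alpha> x0 K where "\<alpha> > 0" "x0 > 0" "x0 \<le> 1" "K > 0"
    "\<And>x1 x2 y. 0 < x1 \<Longrightarrow> x1 \<le> x2 \<Longrightarrow> x2 \<le> x0 \<Longrightarrow> cmod (G (Complex x2 y) - G (Complex x1 y)) \<le> K * x2 powr \<alpha>"
proof -
  obtain \<beta> x0 C where P: "0 \<le> \<beta>" "\<beta> < 1" "x0 > 0" "x0 \<le> 1" "C > 0"
    "\<And>v. 0 < Re v \<Longrightarrow> Re v \<le> x0 \<Longrightarrow> cmod (P v) \<le> C * Re v powr -\<beta>"
    using P_growth by blast
  obtain l U where lU: "l > 0" "\<And>v. 0 < Re v \<Longrightarrow> Re v \<le> 1 \<Longrightarrow> l \<le> cmod (G v) \<and> cmod (G v) \<le> U"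
    using G_bounds by blast
  have U: "U > 0" using lU(2)[of 1] lU(1) by simp
  define \<alpha> where "\<alpha> = 1 - \<beta>"
  have \<alpha>: "\<alpha> > 0" using P by (simp add: \<alpha>_def)
  define K where "K = C * U / \<alpha>"
  have K: "K > 0" using P U \<alpha> by (simp add: K_def)
  have "cmod (G (Complex x2 y) - G (Complex x1 y)) \<le> K * x2 powr \<alpha>" if x: "0 < x1" "x1 \<le> x2" "x2 \<le> x0" for x1 x2 y
  proof (cases "x1 = x2")
    case True thus ?thesis using K by simp
  next
    case False
    define \<phi> where "\<phi> x = K * x powr \<alpha>" for x
    have dG: "((\<lambda>x. G (Complex x y)) has_vector_derivative 1 * (P (Complex x y) * G (Complex x y))) (at x)" if "0 < x" for x
    proof -
      have "(G has_field_derivative P (Complex x y) * G (Complex x y)) (at (Complex x y))"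
        by (rule G_deriv) (use that in \<open>simp add: H_def\<close>)
      from field_vector_diff_chain_at[OF has_vector_derivative_Complex_left this] show ?thesis
        unfolding o_def .
    qed
    have "norm (G (Complex x2 y) - G (Complex x1 y)) \<le> \<phi> x2 - \<phi> x1"
    proof (rule differentiable_bound_general[where \<phi>' = "\<lambda>x. K * (\<alpha> * x powr (\<alpha> - 1))"])
      show "x1 < x2" using x False by simp
      show "continuous_on {x1..x2} (\<lambda>x. G (Complex x y))"
        by (intro continuous_at_imp_continuous_on ballI has_vector_derivative_continuous[OF dG]) (use x in auto)
      show "continuous_on {x1..x2} \<phi>" unfolding \<phi>_def by (intro continuous_intros) (use x in auto)
      fix x assume t: "x1 < x" "x < x2"
      hence x0: "0 < x" "x \<le> x0" "x \<le> 1" using x P(4) by auto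
      show "((\<lambda>x. G (Complex x y)) has_vector_derivative 1 * (P (Complex x y) * G (Complex x y))) (at x)" by (rule dG[OF x0(1)])
      have "((\<lambda>x. x powr \<alpha>) has_real_derivative \<alpha> * x powr (\<alpha> - 1)) (at x)"
        by (rule has_real_derivative_powr[OF x0(1)])
      hence "(\<phi> has_real_derivative K * (\<alpha> * x powr (\<alpha> - 1))) (at x)"
        unfolding \<phi>_def by (rule DERIV_cmult)
      thus "(\<phi> has_vector_derivative K * (\<alpha> * x powr (\<alpha> - 1))) (at x)"
        by (simp add: has_real_derivative_iff_has_vector_derivative)
      have "cmod (P (Complex x y)) * cmod (G (Complex x y)) \<le> (C * x powr -\<beta>) * U"
        using P(5) P(6)[of "Complex x y"] lU(2)[of "Complex x y"] x0 by (intro mult_mono) auto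
      also have "\<dots> = K * (\<alpha> * x powr (\<alpha> - 1))" using \<alpha> by (simp add: K_def \<alpha>_def)
      finally show "norm (1 * (P (Complex x y) * G (Complex x y))) \<le> K * (\<alpha> * x powr (\<alpha> - 1))" by (simp add: norm_mult)
    qed
    also have "\<dots> \<le> K * x2 powr \<alpha>" using K by (simp add: \<phi>_def)
    finally show ?thesis .
  qed
  thus ?thesis using that \<alpha> P(3,4) K by blast
qed

section \<open>Uniform convergence of the regularised maps\<close>

lemma one_minus_B_le:
  assumes T: "T > 0"
  shows "cmod (1 - B (cT T u) (vT T u)) \<le> 2 * (mu T (Re u) * cmod (P (vT T u)))"
proof -
  define m where "m = mu T (Re u)"
  have m: "\<bar>Re u\<bar> \<le> m" using mu_ge[OF T] by (simp add: m_def)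
  have "(m - Re u) / a = - ((Re u - m) / a)" by (simp add: minus_divide_left)
  hence "1 - cT T u \<le> (m - Re u) / a"
    using exp_ge_add_one_self[of "(Re u - m) / a"] unfolding cT_def m_def[symmetric] by linarith
  also have "\<dots> \<le> 2 * m / 1" using m a_ge by (intro frac_le) auto
  finally have "(1 - cT T u) * cmod (P (vT T u)) \<le> 2 * m * cmod (P (vT T u))"
    by (intro mult_right_mono) auto
  moreover have "cmod (1 - B (cT T u) (vT T u)) = (1 - cT T u) * cmod (P (vT T u))"
    using cT_admissible(2)[OF T, of u] by (simp add: B_def norm_mult del: of_real_diff)
  ultimately show ?thesis by (simp add: m_def)
qed

text \<open>\<open>P_small\<close> drives \<open>B\<close> to 1 while |G| stays bounded. The
  estimate sees T only through \<open>mu T\<close>, hence is uniform in T.\<close>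

lemma Phi_near_boundary:
  assumes e: "e > 0"
  obtains T0 where "T0 > 0" "T0 \<le> 1"
    "\<And>T u. 0 < T \<Longrightarrow> mu T (Re u) \<le> T0 \<Longrightarrow> cmod (Phi T u - G (vT T u)) < e"
proof -
  obtain l U where lU: "l > 0" "\<And>v. 0 < Re v \<Longrightarrow> Re v \<le> 1 \<Longrightarrow> l \<le> cmod (G v) \<and> cmod (G v) \<le> U"
    using G_bounds by blast
  have U: "U > 0" using lU(2)[of 1] lU(1) by simp
  have "isCont (\<lambda>z. exp (s * Ln (1 - z))) 0" by (intro continuous_intros) auto
  then obtain d where d: "d > 0" "\<And>z. cmod z < d \<Longrightarrow> cmod (exp (s * Ln (1 - z)) - 1) < e / U"
    using e U unfolding continuous_at_eps_delta
    by (metis (no_types, lifting) diff_zero dist_norm divide_pos_pos exp_zero Ln_1 mult_zero_right)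
  obtain T0 where T0: "T0 > 0" "T0 \<le> 1" "\<And>v. 0 < Re v \<Longrightarrow> Re v \<le> T0 \<Longrightarrow> Re v * cmod (P v) < d / 2"
    using P_small[of "d / 2"] d(1) by auto
  have "cmod (Phi T u - G (vT T u)) < e" if T: "0 < T" "mu T (Re u) \<le> T0" for T u
  proof -
    note adm = cT_admissible[OF T(1), of u]
    define m where "m = mu T (Re u)"
    have m: "m > 0" "\<bar>Re u\<bar> \<le> m" using mu_pos[OF T(1)] mu_ge[OF T(1)] by (auto simp: m_def)
    have Rv: "Re (vT T u) = m" by (simp add: vT_def m_def)
    have "2 * (m * cmod (P (vT T u))) < d" using T0(3)[of "vT T u"] T m Rv by (simp add: m_def)
    hence "cmod (1 - B (cT T u) (vT T u)) < d" using one_minus_B_le[OF T(1), of u] unfolding m_def by linarith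
    from d(2)[OF this] have 1: "cmod (exp (s * Ln (B (cT T u) (vT T u))) - 1) < e / U" by simp
    have "Phi T u - G (vT T u) = G (vT T u) * (exp (s * Ln (B (cT T u) (vT T u))) - 1)"
      by (simp add: Phi_def Psi_def algebra_simps)
    hence "cmod (Phi T u - G (vT T u)) = cmod (G (vT T u)) * cmod (exp (s * Ln (B (cT T u) (vT T u))) - 1)"
      by (simp only: norm_mult)
    also have "\<dots> \<le> U * cmod (exp (s * Ln (B (cT T u) (vT T u))) - 1)"
      using lU(2)[of "vT T u"] Rv m T T0(2) by (intro mult_right_mono) (auto simp: m_def)
    also have "\<dots> < U * (e / U)" using 1 U by (intro mult_strict_left_mono) auto
    finally show ?thesis using U by simp
  qed
  thus ?thesis using that T0 by blast
qed

text \<open>The two maps differ only where |ln |z|| < T0. There each is close to \<open>G\<close> at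
  a point with the same imaginary part, and \<open>G\<close> varies little along the horizontal
  segment joining these points.\<close>

lemma FT_uniformly_Cauchy:
  assumes e: "e > 0"
  shows "\<exists>T0>0. \<forall>T T' z. 0 < T \<longrightarrow> T \<le> T0 \<longrightarrow> 0 < T' \<longrightarrow> T' \<le> T0 \<longrightarrow> cmod (FT T z - FT T' z) < e"
proof -
  obtain \<alpha> x0 K where K: "\<alpha> > 0" "x0 > 0" "x0 \<le> 1" "K > 0"
    "\<And>x1 x2 y. 0 < x1 \<Longrightarrow> x1 \<le> x2 \<Longrightarrow> x2 \<le> x0 \<Longrightarrow> cmod (G (Complex x2 y) - G (Complex x1 y)) \<le> K * x2 powr \<alpha>"
    using G_horizontal_increment by blast
  obtain T1 where T1: "T1 > 0" "T1 \<le> 1" "\<And>T u. 0 < T \<Longrightarrow> mu T (Re u) \<le> T1 \<Longrightarrow> cmod (Phi T u - G (vT T u)) < e/3"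
    using Phi_near_boundary[of "e/3"] e by auto
  \<comment> \<open>The last entry makes the oscillation \<open>K * T0 powr \<alpha>\<close> at most
    e/4, strictly below the e/3 allotted to it.\<close>
  define T0 where "T0 = min (min T1 x0) ((e / (4 * K)) powr (1 / \<alpha>))"
  have T0: "T0 > 0" "T0 \<le> T1" "T0 \<le> x0" using T1 K e by (auto simp: T0_def)
  have "T0 powr \<alpha> \<le> ((e / (4 * K)) powr (1 / \<alpha>)) powr \<alpha>"
    using T0(1) K by (intro powr_mono2) (auto simp: T0_def)
  also have "\<dots> = e / (4 * K)" using K e by (simp add: powr_powr)
  finally have "K * T0 powr \<alpha> \<le> e / 4" using K by (simp add: field_simps)
  hence KT: "K * T0 powr \<alpha> < e / 3" using e by simp
  have "cmod (FT T z - FT T' z) < e" if T: "0 < T" "T \<le> T0" "0 < T'" "T' \<le> T0" for T T' z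
  proof (cases "z = 0 \<or> T0 \<le> \<bar>ln (cmod z)\<bar>")
    case True
    thus ?thesis using FT_eq[OF T(1,2), of z] FT_eq[OF T(3,4), of z] e by (cases "z = 0") auto
  next
    case False
    define u where "u = Ln z"
    define x where "x = Re u"
    have x: "\<bar>x\<bar> \<le> T0" using False by (simp add: x_def u_def)
    have muT: "mu t x \<le> T0" if "0 < t" "t \<le> T0" for t
    proof (cases "t \<le> \<bar>x\<bar>")
      case True thus ?thesis using mu_outside[OF that(1) True] x by simp
    next
      case False thus ?thesis using mu_le[OF that(1), of x] that by simp
    qed
    have 1: "cmod (Phi T u - G (vT T u)) < e/3" using T1(3)[OF T(1), of u] muT[OF T(1,2)] T0 by (simp add: x_def)
    have 2: "cmod (Phi T' u - G (vT T' u)) < e/3" using T1(3)[OF T(3), of u] muT[OF T(3,4)] T0 by (simp add: x_def)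
    have inc: "cmod (G (Complex x2 y) - G (Complex x1 y)) < e/3" if "0 < x1" "x1 \<le> x2" "x2 \<le> T0" for x1 x2 y
    proof -
      have "cmod (G (Complex x2 y) - G (Complex x1 y)) \<le> K * x2 powr \<alpha>" using K(5) that T0 by simp
      also have "\<dots> \<le> K * T0 powr \<alpha>" using K that by (intro mult_left_mono powr_mono2) auto
      finally show ?thesis using KT by simp
    qed
    have 3: "cmod (G (vT T u) - G (vT T' u)) < e/3"
    proof (cases "mu T x \<le> mu T' x")
      case True
      show ?thesis using inc[OF mu_pos[OF T(1), of x] True muT[OF T(3,4)], of "Im u"]
        by (simp add: vT_def x_def norm_minus_commute)
    next
      case False
      thus ?thesis using inc[OF mu_pos[OF T(3), of x] _ muT[OF T(1,2)], of "Im u"] by (simp add: vT_def x_def)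
    qed
    have "FT T z - FT T' z = (Phi T u - G (vT T u)) + (G (vT T u) - G (vT T' u)) - (Phi T' u - G (vT T' u))"
      using False by (simp add: FT_def u_def)
    also have "cmod \<dots> \<le> cmod (Phi T u - G (vT T u)) + cmod (G (vT T u) - G (vT T' u)) + cmod (Phi T' u - G (vT T' u))"
      using norm_triangle_ineq4 norm_triangle_ineq by (smt (verit))
    finally show ?thesis using 1 2 3 by simp
  qed
  thus ?thesis using T0(1) by blast
qed

text \<open>Taken as a limit because on the unit circle no formula is available; off the circle the
  sequence is eventually constant at each point.\<close>

definition F :: "complex \<Rightarrow> complex" where "F z = lim (\<lambda>n. FT (1 / real (Suc n)) z)"

lemma F_limit: "uniform_limit UNIV (\<lambda>n. FT (1 / real (Suc n))) F sequentially"
proof -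
  have "uniformly_Cauchy_on UNIV (\<lambda>n. FT (1 / real (Suc n)))"
    unfolding uniformly_Cauchy_on_def
  proof (intro allI impI)
    fix e :: real assume "e > 0"
    then obtain T0 where T0: "T0 > 0" "\<And>T T' z. 0 < T \<Longrightarrow> T \<le> T0 \<Longrightarrow> 0 < T' \<Longrightarrow> T' \<le> T0 \<Longrightarrow> cmod (FT T z - FT T' z) < e"
      using FT_uniformly_Cauchy by metis
    obtain N where N: "1 / real (Suc N) < T0" using nat_approx_posE[OF T0(1)] by blast
    have *: "1 / real (Suc n) \<le> T0" if "n \<ge> N" for n
    proof -
      have "1 / real (Suc n) \<le> 1 / real (Suc N)" using that by (intro divide_left_mono) auto
      thus ?thesis using N by simp
    qed
    show "\<exists>M. \<forall>x\<in>UNIV. \<forall>m\<ge>M. \<forall>n\<ge>M. dist (FT (1 / real (Suc m)) x) (FT (1 / real (Suc n)) x) < e"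
      unfolding dist_norm by (intro exI[of _ N] ballI allI impI T0(2) *) auto
  qed
  hence "uniformly_convergent_on UNIV (\<lambda>n. FT (1 / real (Suc n)))"
    by (rule Cauchy_uniformly_convergent)
  thus ?thesis unfolding uniformly_convergent_uniform_limit_iff F_def[abs_def] .
qed

lemma F_cont: "continuous_on UNIV F"
  by (rule uniform_limit_theorem[OF _ F_limit]) (auto intro!: always_eventually FT_cont)

lemma F_eq_FT:
  assumes T: "0 < T" and z: "z = 0 \<or> T \<le> \<bar>ln (cmod z)\<bar>"
  shows "F z = FT T z"
proof -
  obtain N where N: "1 / real (Suc N) < T" using nat_approx_posE[OF T] by blast
  have "\<forall>\<^sub>F n in sequentially. FT (1 / real (Suc n)) z = FT T z"
    unfolding eventually_sequentially
  proof (intro exI[of _ N] allI impI)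
    fix n assume "N \<le> n"
    hence "1 / real (Suc n) \<le> 1 / real (Suc N)" by (intro divide_left_mono) auto
    hence "1 / real (Suc n) \<le> T" using N by simp
    thus "FT (1 / real (Suc n)) z = FT T z" using z FT_eq[of "1 / real (Suc n)" T z] by (cases "z = 0") auto
  qed
  hence "(\<lambda>n. FT (1 / real (Suc n)) z) \<longlonglongrightarrow> FT T z" by (rule tendsto_eventually)
  thus ?thesis unfolding F_def by (rule limI)
qed

lemma F_outside: "1 < cmod z \<Longrightarrow> F z = g z"
proof -
  assume z: "1 < cmod z"
  hence T: "0 < ln (cmod z)" by (rule ln_gt_zero)
  have "F z = FT (ln (cmod z)) z" by (rule F_eq_FT[OF T]) (rule disjI2, rule abs_ge_self)
  also have "\<dots> = g z" by (rule FT_outside_ln[OF T order.refl])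
  finally show ?thesis .
qed

lemma F_0 [simp]: "F 0 = 0" using F_eq_FT[of 1 0] by simp

lemma F_at_infinity: "filterlim F at_infinity at_infinity"
proof -
  have "\<forall>\<^sub>F z in at_infinity. g z = F z"
    unfolding eventually_at_infinity by (intro exI[of _ 2]) (simp add: F_outside)
  thus ?thesis by (rule filterlim_mono_eventually[OF g_at_infinity order_refl order_refl])
qed

section \<open>Fibres of the limit map\<close>

lemma off_circle_scale:
  assumes "cmod z \<noteq> 1"
  obtains T where "T > 0" "\<And>T'. 0 < T' \<Longrightarrow> T' \<le> T \<Longrightarrow> F z = FT T' z"
proof (cases "z = 0")
  case True thus ?thesis using that[of 1] by simp
next
  case False
  hence "ln (cmod z) \<noteq> 0" using assms by simp
  thus ?thesis using that[of "\<bar>ln (cmod z)\<bar>"] F_eq_FT by simp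
qed

lemma F_inj_off_circle:
  assumes "cmod x \<noteq> 1" "cmod y \<noteq> 1" "F x = F y"
  shows "x = y"
proof -
  obtain T1 where T1: "T1 > 0" "\<And>T'. 0 < T' \<Longrightarrow> T' \<le> T1 \<Longrightarrow> F x = FT T' x" using off_circle_scale[OF assms(1)] by blast
  obtain T2 where T2: "T2 > 0" "\<And>T'. 0 < T' \<Longrightarrow> T' \<le> T2 \<Longrightarrow> F y = FT T' y" using off_circle_scale[OF assms(2)] by blast
  have T: "min T1 T2 > 0" using T1 T2 by simp
  have "FT (min T1 T2) x = FT (min T1 T2) y" using T1(2)[of "min T1 T2"] T2(2)[of "min T1 T2"] T assms(3) by simp
  moreover obtain h where "homeomorphism UNIV UNIV (FT (min T1 T2)) h" using FT_homeomorphism[OF T] by blast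
  ultimately show ?thesis by (metis UNIV_I homeomorphism_apply1)
qed

lemma F_fibre_connected: "connected (F -` {p})"
  by (rule connected_fibre_of_homeomorphism_limit[OF FT_homeomorphism F_limit F_cont F_at_infinity]) simp

text \<open>Otherwise the connected fibre would contain further points off the circle.\<close>
lemma F_fibre_circle:
  assumes z1: "cmod z1 = 1" and z2: "cmod z2 \<noteq> 1"
  shows "F z1 \<noteq> F z2"
proof
  assume eq: "F z1 = F z2"
  define r where "r = (1 + cmod z2) / 2"
  have "connected (cmod ` (F -` {F z2}))"
    by (intro connected_continuous_image continuous_intros F_fibre_connected)
  note conn = connectedD_interval[OF this]
  have "1 \<in> cmod ` (F -` {F z2})" "cmod z2 \<in> cmod ` (F -` {F z2})"
    using imageI[of z1 "F -` {F z2}" cmod] z1 eq by auto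
  hence "r \<in> cmod ` (F -` {F z2})"
    using conn[of 1 "cmod z2" r] conn[of "cmod z2" 1 r] by (cases "cmod z2 \<le> 1") (auto simp: r_def)
  then obtain z3 where z3: "F z3 = F z2" "cmod z3 = r" by auto
  moreover have "r \<noteq> 1" "r \<noteq> cmod z2" using z2 by (auto simp: r_def)
  ultimately show False using F_inj_off_circle[of z3 z2] z2 by auto
qed

section \<open>Injectivity of the limit\<close>

text \<open>In logarithmic coordinates the constant p on Re v <= 0 glues continuously to F on Re v >
  0, so the glued function is holomorphic across the line. The identity theorem makes it constant,
  against the injectivity of F outside the circle.\<close>

lemma F_not_constant_on_arc:
  assumes \<omega>: "cmod \<omega> = 1" and ab: "\<alpha> < \<beta>"
    and const: "\<And>\<theta>. \<alpha> < \<theta> \<Longrightarrow> \<theta> < \<beta> \<Longrightarrow> F (\<omega> * cis \<theta>) = p"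
  shows False
proof -
  define S where "S = {v. \<alpha> < Im v \<and> Im v < \<beta>}"
  have S_eq: "S = {v. \<alpha> < Im v} \<inter> {v. Im v < \<beta>}" by (auto simp: S_def)
  have opS: "open S" unfolding S_eq by (intro open_Int open_halfspace_Im_gt open_halfspace_Im_lt)
  have "convex S" unfolding S_eq by (intro convex_Int convex_halfspace_Im_gt convex_halfspace_Im_lt)
  hence cS: "connected S" by (rule convex_connected)
  define f where "f v = (if Re v \<le> 0 then p else F (\<omega> * exp v))" for v
  have "continuous_on S f" unfolding f_def
  proof (rule continuous_on_cases_le)
    show "continuous_on {t \<in> S. 0 \<le> Re t} (\<lambda>v. F (\<omega> * exp v))"
      by (intro continuous_on_compose2[OF F_cont] continuous_intros) auto
    fix v assume v: "v \<in> S" "Re v = 0"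
    have "exp v = cis (Im v)" using v(2) by (simp add: exp_eq_polar)
    thus "p = F (\<omega> * exp v)" using const[of "Im v"] v(1) by (simp add: S_def)
  qed (intro continuous_intros)+
  moreover have "f holomorphic_on (S \<inter> {z. 1 \<bullet> z < 0})"
    by (rule holomorphic_transform[of "\<lambda>_. p"]) (auto simp: f_def inner_complex_def)
  moreover have "f holomorphic_on (S \<inter> {z. 0 < 1 \<bullet> z})"
  proof (rule holomorphic_transform)
    have "(g \<circ> (\<lambda>v. \<omega> * exp v)) holomorphic_on (S \<inter> {z. 0 < 1 \<bullet> z})"
      by (intro holomorphic_on_compose_gen[OF _ g_hol] holomorphic_intros)
         (use \<omega> in \<open>auto simp: inner_complex_def norm_mult\<close>)
    thus "(\<lambda>v. g (\<omega> * exp v)) holomorphic_on (S \<inter> {z. 0 < 1 \<bullet> z})" by (simp add: o_def)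
    fix v assume v: "v \<in> S \<inter> {z. 0 < 1 \<bullet> z}"
    hence "1 < cmod (\<omega> * exp v)" using \<omega> by (simp add: inner_complex_def norm_mult)
    thus "g (\<omega> * exp v) = f v" using v F_outside by (simp add: f_def inner_complex_def)
  qed
  ultimately have holo: "f holomorphic_on S"
    using holomorphic_on_paste_across_line[OF opS, of 1 f 0] by simp
  define \<theta> where "\<theta> = (\<alpha> + \<beta>) / 2"
  have \<theta>: "\<alpha> < \<theta>" "\<theta> < \<beta>" using ab by (auto simp: \<theta>_def)
  have fp: "f v = p" if "v \<in> S" for v
  proof (rule analytic_continuation_open[of "S \<inter> {v. Re v < 0}" S f "\<lambda>_. p"])
    show "open (S \<inter> {v. Re v < 0})" by (intro open_Int opS open_halfspace_Re_lt)
    have "Complex (-1) \<theta> \<in> S \<inter> {v. Re v < 0}" using \<theta> by (simp add: S_def)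
    thus "S \<inter> {v. Re v < 0} \<noteq> {}" by blast
  qed (use opS cS holo that in \<open>auto simp: f_def\<close>)
  \<comment> \<open>Any two points with distinct positive real parts would serve.\<close>
  have "f (Complex 1 \<theta>) = f (Complex 2 \<theta>)" using fp \<theta> by (simp add: S_def)
  hence "F (\<omega> * exp (Complex 1 \<theta>)) = F (\<omega> * exp (Complex 2 \<theta>))" by (simp add: f_def)
  moreover have "cmod (\<omega> * exp (Complex 1 \<theta>)) = exp 1" "cmod (\<omega> * exp (Complex 2 \<theta>)) = exp 2"
    using \<omega> by (simp_all add: norm_mult)
  moreover have "exp 1 \<noteq> (1::real)" "exp 2 \<noteq> (1::real)" "exp 1 \<noteq> exp (2::real)" by simp_all
  ultimately show False using F_inj_off_circle by metis
qed

text \<open>A fibre \<open>K\<close> with two points is a connected subset of the unit circle. After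
  a rotation its projection to the imaginary axis contains an interval, and at each height sin
  \<theta> in it \<open>K\<close> contains the right point cis \<theta> or the left point
  -cis(-\<theta>). This alternative yields an arc inside \<open>K\<close>.\<close>

lemma F_inj: "inj F"
proof (rule injI, rule ccontr)
  fix z1 z2 assume eq: "F z1 = F z2" and ne: "z1 \<noteq> z2"
  have c1: "cmod z1 = 1"
  proof (rule ccontr)
    assume n: "cmod z1 \<noteq> 1"
    show False
      using F_inj_off_circle[OF n _ eq] F_fibre_circle[OF _ n, of z2] eq ne by metis
  qed
  define p where "p = F z1"
  define K where "K = F -` {p}"
  have z12: "z1 \<in> K" "z2 \<in> K" by (auto simp: K_def p_def eq)
  have Kc: "cmod z = 1" if "z \<in> K" for z
    using F_fibre_circle[OF c1, of z] that by (auto simp: K_def p_def)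
  have "connected K" unfolding K_def by (rule F_fibre_connected)
  \<comment> \<open>A rotation after which the two points lie at different heights.\<close>
  obtain \<eta> where \<eta>: "cmod \<eta> = 1" "Im (z1 * \<eta>) \<noteq> Im (z2 * \<eta>)"
  proof (cases "Im z1 = Im z2")
    case True
    hence "Re z1 \<noteq> Re z2" using ne by (simp add: complex_eq_iff)
    thus ?thesis using that[of \<i>] by simp
  next
    case False thus ?thesis using that[of 1] by simp
  qed
  hence \<eta>0: "\<eta> \<noteq> 0" by auto
  have "connected ((\<lambda>z. Im (z * \<eta>)) ` K)"
    by (intro connected_continuous_image continuous_intros \<open>connected K\<close>)
  note conn = connectedD_interval[OF this]
  define y1 where "y1 = min (Im (z1 * \<eta>)) (Im (z2 * \<eta>))"
  define y2 where "y2 = max (Im (z1 * \<eta>)) (Im (z2 * \<eta>))"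
  have y12: "y1 < y2" using \<eta>(2) by (auto simp: y1_def y2_def)
  have ymem: "y1 \<in> (\<lambda>z. Im (z * \<eta>)) ` K" "y2 \<in> (\<lambda>z. Im (z * \<eta>)) ` K"
    using z12 by (auto simp: y1_def y2_def min_def max_def)
  have ybnd: "-1 \<le> Im (z * \<eta>)" "Im (z * \<eta>) \<le> 1" if "z \<in> K" for z
    using abs_Im_le_cmod[of "z * \<eta>"] Kc[OF that] \<eta>(1) unfolding norm_mult by auto
  have yb: "-1 \<le> y1" "y2 \<le> 1" using ymem ybnd by force+
  define \<alpha> where "\<alpha> = arcsin y1"
  define \<beta> where "\<beta> = arcsin y2"
  have ab: "\<alpha> < \<beta>" unfolding \<alpha>_def \<beta>_def using y12 yb by (intro arcsin_less_arcsin) auto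
  have abpi: "-pi/2 \<le> \<alpha>" "\<beta> \<le> pi/2" unfolding \<alpha>_def \<beta>_def using y12 yb arcsin_bounded[of y1] arcsin_bounded[of y2] by auto
  have alt: "F (inverse \<eta> * cis \<theta>) = p \<or> F (- inverse \<eta> * cis (- \<theta>)) = p" if \<theta>: "\<alpha> < \<theta>" "\<theta> < \<beta>" for \<theta>
  proof -
    have "sin \<alpha> < sin \<theta>" "sin \<theta> < sin \<beta>" using \<theta> abpi by (auto intro!: sin_monotone_2pi)
    hence "y1 < sin \<theta>" "sin \<theta> < y2" unfolding \<alpha>_def \<beta>_def using y12 yb by simp_all
    then obtain z where z: "z \<in> K" "Im (z * \<eta>) = sin \<theta>" using conn[OF ymem, of "sin \<theta>"] by auto
    define w where "w = z * \<eta>"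
    have "(cmod w)^2 = 1" using Kc[OF z(1)] \<eta>(1) by (simp add: w_def norm_mult)
    hence "(Re w)^2 + (sin \<theta>)^2 = 1" using z(2) by (simp add: cmod_power2 w_def)
    hence "(Re w)^2 = (cos \<theta>)^2" by (simp add: cos_squared_eq)
    hence "Re w = cos \<theta> \<or> Re w = - cos \<theta>" by (simp add: power2_eq_iff)
    hence "w = cis \<theta> \<or> w = - cis (- \<theta>)" using z(2) by (auto simp: complex_eq_iff w_def)
    moreover have "z = inverse \<eta> * w" using \<eta>0 by (simp add: w_def)
    ultimately have "z = inverse \<eta> * cis \<theta> \<or> z = - inverse \<eta> * cis (- \<theta>)" by auto
    thus ?thesis using z(1) by (auto simp: K_def)
  qed
  have n\<eta>: "cmod (inverse \<eta>) = 1" "cmod (- inverse \<eta>) = 1" using \<eta>(1) by (simp_all add: norm_inverse)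
  show False
  proof (cases "\<forall>\<theta>. \<alpha> < \<theta> \<longrightarrow> \<theta> < \<beta> \<longrightarrow> F (inverse \<eta> * cis \<theta>) = p")
    case True
    thus False using F_not_constant_on_arc[OF n\<eta>(1) ab] by blast
  next
    \<comment> \<open>If one right point is missing from the fibre, continuity removes its
      neighbours as well, so the opposite left points fill an arc.\<close>
    case False
    then obtain \<theta>0 where \<theta>0: "\<alpha> < \<theta>0" "\<theta>0 < \<beta>" "F (inverse \<eta> * cis \<theta>0) \<noteq> p" by blast
    have "isCont (\<lambda>\<theta>. F (inverse \<eta> * cis \<theta>)) \<theta>0"
    proof (rule isCont_o2[where g = F])
      show "isCont (\<lambda>\<theta>. inverse \<eta> * cis \<theta>) \<theta>0" unfolding cis_conv_exp by (intro continuous_intros)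
      show "isCont F (inverse \<eta> * cis \<theta>0)" using F_cont by (simp add: continuous_on_eq_continuous_at)
    qed
    then obtain e where e: "e > 0" "\<And>\<theta>. dist \<theta> \<theta>0 < e \<Longrightarrow> dist (F (inverse \<eta> * cis \<theta>)) (F (inverse \<eta> * cis \<theta>0)) < dist (F (inverse \<eta> * cis \<theta>0)) p"
      using \<theta>0(3) unfolding continuous_at_eps_delta by (metis zero_less_dist_iff)
    define e' where "e' = min e (min (\<theta>0 - \<alpha>) (\<beta> - \<theta>0))"
    have e': "e' > 0" using e \<theta>0 by (simp add: e'_def)
    have arc: "F (- inverse \<eta> * cis \<theta>) = p" if "- \<theta>0 - e' < \<theta>" "\<theta> < - \<theta>0 + e'" for \<theta>
    proof -
      have "dist (- \<theta>) \<theta>0 < e" "\<alpha> < - \<theta>" "- \<theta> < \<beta>" using that by (auto simp: e'_def dist_real_def)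
      moreover from this have "F (inverse \<eta> * cis (- \<theta>)) \<noteq> p" using e(2)[of "- \<theta>"] by (auto simp: dist_commute)
      ultimately show ?thesis using alt[of "- \<theta>"] by simp
    qed
    show False
    proof (rule F_not_constant_on_arc[OF n\<eta>(2)])
      show "- \<theta>0 - e' < - \<theta>0 + e'" using e' by simp
    qed (rule arc)
  qed
qed

lemma F_homeomorphism: "\<exists>h. homeomorphism UNIV UNIV F h"
  using inj_proper_imp_homeomorphism[OF F_cont F_inj F_at_infinity] by blast

section \<open>Regularity and dilatation\<close>

lemma F_deriv_FT:
  assumes T: "0 < T" "T < \<bar>ln (cmod z)\<bar>" and u: "exp u = z"
  shows "(F has_derivative (\<lambda>h. dPhi T u (h / z))) (at z)"
proof (rule has_derivative_transform_within_open[OF FT_deriv[OF T(1) u]])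
  have "continuous_on (- {0::complex}) (\<lambda>z. \<bar>ln (cmod z)\<bar>)" by (intro continuous_intros) auto
  hence "open (- {0::complex} \<inter> (\<lambda>z. \<bar>ln (cmod z)\<bar>) -` {T<..})"
    by (intro continuous_open_preimage) auto
  moreover have "- {0::complex} \<inter> (\<lambda>z. \<bar>ln (cmod z)\<bar>) -` {T<..} = {z \<in> - {0}. T < \<bar>ln (cmod z)\<bar>}"
    by auto
  ultimately show "open {z \<in> - {0::complex}. T < \<bar>ln (cmod z)\<bar>}" by simp
  have "z \<noteq> 0" using u by auto
  thus "z \<in> {z \<in> - {0}. T < \<bar>ln (cmod z)\<bar>}" using T by simp
  show "FT T w = F w" if "w \<in> {z \<in> - {0}. T < \<bar>ln (cmod z)\<bar>}" for w
    using F_eq_FT[OF T(1), of w] that by simp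
qed

lemma dPhi_bound: "cmod (dPhi T u (h / z)) \<le> (cmod (pdx T u) + cmod (pdy T u)) / cmod z * cmod h"
proof -
  have "cmod (dPhi T u (h / z)) \<le> cmod (pdx T u) * \<bar>Re (h / z)\<bar> + cmod (pdy T u) * \<bar>Im (h / z)\<bar>"
    unfolding dPhi_def by (rule order.trans[OF norm_triangle_ineq]) (simp only: norm_mult norm_of_real order.refl)
  also have "\<dots> \<le> cmod (pdx T u) * cmod (h / z) + cmod (pdy T u) * cmod (h / z)"
    by (intro add_mono mult_left_mono abs_Re_le_cmod abs_Im_le_cmod) auto
  finally show ?thesis by (simp add: norm_divide algebra_simps add_divide_distrib)
qed

lemma F_deriv_locally_bounded:
  assumes z0: "z0 \<noteq> 0" "cmod z0 \<noteq> 1"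
  obtains r M where "r > 0"
    "\<And>z. z \<in> ball z0 r \<Longrightarrow> \<exists>D. (F has_derivative D) (at z) \<and> (\<forall>h. cmod (D h) \<le> M * cmod h)"
proof -
  define T where "T = \<bar>ln (cmod z0)\<bar> / 2"
  have T: "T > 0" "T < \<bar>ln (cmod z0)\<bar>" using z0 by (auto simp: T_def)
  define u0 where "u0 = Ln z0"
  have u0: "exp u0 = z0" "Re u0 = ln (cmod z0)" using z0 by (simp_all add: u0_def)
  define N where "N u = (cmod (pdx T u) + cmod (pdy T u)) / cmod (exp u)" for u
  have "isCont N u0" unfolding N_def by (intro continuous_intros pd_cont T) auto
  then obtain d where d: "d > 0" "\<And>u. dist u u0 < d \<Longrightarrow> dist (N u) (N u0) < 1"
    unfolding continuous_at_eps_delta using zero_less_one by blast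
  define r where "r = min d (\<bar>Re u0\<bar> - T)"
  have r: "r > 0" using d T u0 by (simp add: r_def)
  obtain e where e: "e > 0" "ball z0 e \<subseteq> exp ` ball u0 r" using exp_nbhd[OF u0(1) r] by blast
  show ?thesis
  proof (rule that[OF e(1), of "N u0 + 1"])
    fix z assume "z \<in> ball z0 e"
    then obtain u where u: "z = exp u" "dist u u0 < r" using e(2) by (auto simp: dist_commute)
    have Nu: "N u < N u0 + 1" using d(2)[of u] u(2) by (simp add: r_def dist_real_def)
    have "\<bar>Re u - Re u0\<bar> < r" using u(2) abs_Re_le_cmod[of "u - u0"] by (simp add: dist_norm)
    moreover have "r \<le> \<bar>Re u0\<bar> - T" by (simp add: r_def)
    ultimately have "T < \<bar>Re u\<bar>" by linarith
    hence "T < \<bar>ln (cmod z)\<bar>" using u(1) by simp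
    moreover have "cmod (dPhi T u (h / z)) \<le> (N u0 + 1) * cmod h" for h
    proof -
      have "cmod (dPhi T u (h / z)) \<le> N u * cmod h" unfolding N_def u(1) by (rule dPhi_bound)
      also have "\<dots> \<le> (N u0 + 1) * cmod h" using Nu by (intro mult_right_mono) auto
      finally show ?thesis .
    qed
    ultimately show "\<exists>D. (F has_derivative D) (at z) \<and> (\<forall>h. cmod (D h) \<le> (N u0 + 1) * cmod h)"
      using F_deriv_FT[OF T(1) _ u(1)[symmetric]] by blast
  qed
qed

text \<open>In \<open>Lam\<close> only the factor \<open>P\<close> can be large: near the circle
  |Phi| <= U + 1, |B| >= 1/2 and |E| < |s|. The derivative therefore inherits the power growth of
  \<open>P\<close>.\<close>

lemma F_deriv_near_circle:
  obtains \<beta> C x0 where "0 \<le> \<beta>" "\<beta> < 1" "C > 0" "x0 > 0" "x0 \<le> 1"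
    "\<And>z. 0 < \<bar>ln (cmod z)\<bar> \<Longrightarrow> \<bar>ln (cmod z)\<bar> \<le> x0 \<Longrightarrow> z \<noteq> 0 \<Longrightarrow>
      \<exists>D. (F has_derivative D) (at z) \<and> (\<forall>h. cmod (D h) \<le> C * \<bar>ln (cmod z)\<bar> powr -\<beta> * cmod h)"
proof -
  obtain \<beta> x1 C where P: "0 \<le> \<beta>" "\<beta> < 1" "x1 > 0" "x1 \<le> 1" "C > 0"
    "\<And>v. 0 < Re v \<Longrightarrow> Re v \<le> x1 \<Longrightarrow> cmod (P v) \<le> C * Re v powr -\<beta>"
    using P_growth by blast
  obtain l U where lU: "l > 0" "\<And>v. 0 < Re v \<Longrightarrow> Re v \<le> 1 \<Longrightarrow> l \<le> cmod (G v) \<and> cmod (G v) \<le> U"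
    using G_bounds by blast
  have U: "U > 0" using lU(2)[of 1] lU(1) by simp
  obtain x2 where x2: "x2 > 0" "x2 \<le> 1" "\<And>v. 0 < Re v \<Longrightarrow> Re v \<le> x2 \<Longrightarrow> Re v * cmod (P v) < 1/4"
    using P_small[of "1/4"] by auto
  obtain x3 where x3: "x3 > 0" "x3 \<le> 1" "\<And>T u. 0 < T \<Longrightarrow> mu T (Re u) \<le> x3 \<Longrightarrow> cmod (Phi T u - G (vT T u)) < 1"
    using Phi_near_boundary[of 1] by auto
  define x0 where "x0 = min x1 (min x2 x3)"
  \<comment> \<open>The factors bound Phi, P, 1/B, the brackets in \<open>pdx\<close> and
    \<open>pdy\<close> (4|s| + 2|s|), and 1/|z|, in this order.\<close>
  define C' where "C' = (U + 1) * C * 2 * (6 * cmod s) * exp 1"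
  show ?thesis
  proof (rule that[of \<beta> C' x0])
    show "C' > 0" using U P by (simp add: C'_def)
    show "x0 > 0" "x0 \<le> 1" using P x2 x3 by (auto simp: x0_def)
    fix z :: complex assume z: "0 < \<bar>ln (cmod z)\<bar>" "\<bar>ln (cmod z)\<bar> \<le> x0" "z \<noteq> 0"
    define x where "x = \<bar>ln (cmod z)\<bar>"
    define T where "T = x / 2"
    define u where "u = Ln z"
    have x: "0 < x" "x \<le> x1" "x \<le> x2" "x \<le> x3" "x \<le> 1" using z P by (auto simp: x_def x0_def)
    have T: "0 < T" "T < \<bar>ln (cmod z)\<bar>" using z by (auto simp: T_def x_def)
    have Reu: "Re u = ln (cmod z)" using z by (simp add: u_def)
    have mu: "mu T (Re u) = x" using mu_outside[OF T(1), of "Re u"] T Reu by (simp add: x_def)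
    note adm = cT_admissible[OF T(1), of u]
    have Rv: "Re (vT T u) = x" by (simp add: vT_def mu)
    have P1: "cmod (P (vT T u)) \<le> C * x powr -\<beta>" using P(6)[of "vT T u"] Rv x by simp
    have P2: "x * cmod (P (vT T u)) < 1/4" using x2(3)[of "vT T u"] Rv x by simp
    have "cmod (Phi T u - G (vT T u)) < 1" using x3(3)[OF T(1), of u] mu x by simp
    moreover have "cmod (G (vT T u)) \<le> U" using lU(2)[of "vT T u"] Rv x by simp
    ultimately have Phi: "cmod (Phi T u) \<le> U + 1" using norm_triangle_ineq2[of "Phi T u" "G (vT T u)"] by simp
    have B: "1/2 \<le> cmod (B (cT T u) (vT T u))"
      using norm_triangle_ineq2[of 1 "1 - B (cT T u) (vT T u)"] one_minus_B_le[OF T(1), of u] P2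
      unfolding mu by simp
    have "cmod (Lam T u) = cmod (Phi T u) * cmod (P (vT T u)) * (cT T u / a) / cmod (B (cT T u) (vT T u))"
      using adm(1) by (simp add: Lam_def norm_mult norm_divide)
    also have "\<dots> \<le> ((U + 1) * (C * x powr -\<beta>) * 1) / (1/2)"
    proof (intro frac_le mult_mono Phi P1 B)
      show "cT T u / a \<le> 1" using adm a_ge by (simp add: divide_le_eq)
    qed (use U P adm in auto)
    also have "\<dots> = (U + 1) * C * 2 * x powr -\<beta>" by simp
    finally have L: "cmod (Lam T u) \<le> (U + 1) * C * 2 * x powr -\<beta>" .
    have E: "cmod (s - E (cT T u) (vT T u)) \<le> 2 * cmod s"
      using E_lt[OF adm(3,1,2,4)] norm_triangle_ineq4[of s "E (cT T u) (vT T u)"] by simp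
    have d: "\<bar>dmu T (Re u)\<bar> \<le> 1" by (rule dmu_le[OF T(1)])
    have "cmod ((s - E (cT T u) (vT T u)) * of_real (dmu T (Re u)) + s * of_real (1 - dmu T (Re u)))
       \<le> cmod (s - E (cT T u) (vT T u)) * \<bar>dmu T (Re u)\<bar> + cmod s * \<bar>1 - dmu T (Re u)\<bar>"
      by (rule order.trans[OF norm_triangle_ineq]) (simp only: norm_mult norm_of_real order.refl)
    also have "\<dots> \<le> (2 * cmod s) * 1 + cmod s * 2"
      using E d by (intro add_mono mult_mono) auto
    finally have "cmod (pdx T u) \<le> cmod (Lam T u) * (4 * cmod s)"
      unfolding pdx_def norm_mult by (intro mult_left_mono) auto
    moreover have "cmod (pdy T u) \<le> cmod (Lam T u) * (2 * cmod s)"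
      unfolding pdy_def norm_mult using E by (simp add: mult_left_mono)
    ultimately have "cmod (pdx T u) + cmod (pdy T u) \<le> cmod (Lam T u) * (6 * cmod s)" by simp
    also have "\<dots> \<le> ((U + 1) * C * 2 * x powr -\<beta>) * (6 * cmod s)" using L by (intro mult_right_mono) auto
    finally have pd: "cmod (pdx T u) + cmod (pdy T u) \<le> ((U + 1) * C * 2 * (6 * cmod s)) * x powr -\<beta>"
      by (simp add: mult_ac)
    have "exp (-1) \<le> exp (ln (cmod z))" using x unfolding exp_le_cancel_iff by (simp add: x_def)
    hence zge: "exp (-1) \<le> cmod z" using z by simp
    have "cmod (dPhi T u (h / z)) \<le> C' * x powr -\<beta> * cmod h" for h
    proof -
      have "(cmod (pdx T u) + cmod (pdy T u)) / cmod z \<le> ((U + 1) * C * 2 * (6 * cmod s)) * x powr -\<beta> / exp (-1)"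
        by (intro frac_le pd zge) (use U P in auto)
      also have "\<dots> = C' * x powr -\<beta>" by (simp add: C'_def exp_minus divide_inverse)
      finally have "(cmod (pdx T u) + cmod (pdy T u)) / cmod z * cmod h \<le> C' * x powr -\<beta> * cmod h"
        by (intro mult_right_mono) auto
      thus ?thesis using dPhi_bound[of T u h z] by linarith
    qed
    moreover have "exp u = z" using z by (simp add: u_def)
    ultimately show "\<exists>D. (F has_derivative D) (at z) \<and> (\<forall>h. cmod (D h) \<le> C' * \<bar>ln (cmod z)\<bar> powr -\<beta> * cmod h)"
      using F_deriv_FT[OF T] unfolding x_def by blast
  qed (use P in auto)
qed

lemma F_beltrami:
  assumes l: "k \<le> l" and z: "z \<noteq> 0" "cmod z \<noteq> 1"
  shows "\<exists>px py. ((\<lambda>t. F (z + of_real t)) has_vector_derivative px) (at 0) \<and>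
     ((\<lambda>t. F (z + \<i> * of_real t)) has_vector_derivative py) (at 0) \<and>
     cmod ((px + \<i> * py) / 2) \<le> l * cmod ((px - \<i> * py) / 2)"
proof -
  define T where "T = \<bar>ln (cmod z)\<bar> / 2"
  have T: "T > 0" "T < \<bar>ln (cmod z)\<bar>" using z by (auto simp: T_def)
  define u where "u = Ln z"
  have u: "exp u = z" "Re u = ln (cmod z)" using z by (auto simp: u_def)
  note adm = cT_admissible[OF T(1), of u]
  define D where "D h = dPhi T u (h / z)" for h
  have D: "(F has_derivative D) (at z)" unfolding D_def by (rule F_deriv_FT[OF T u(1)])
  have dir: "((\<lambda>t. F (z + e * of_real t)) has_vector_derivative D e) (at 0)" for e
  proof -
    have "((\<lambda>t. z + e * complex_of_real t) has_derivative (\<lambda>t. t *\<^sub>R e)) (at 0)"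
      by (auto intro!: derivative_eq_intros simp: scaleR_conv_of_real)
    moreover have "(F has_derivative D) (at (z + e * complex_of_real 0))" using D by simp
    ultimately have "((\<lambda>t. F (z + e * complex_of_real t)) has_derivative (\<lambda>t. D (t *\<^sub>R e))) (at 0)"
      by (rule has_derivative_compose)
    moreover have "D (t *\<^sub>R e) = t *\<^sub>R D e" for t
      by (rule linear_scale[OF has_derivative_linear[OF D]])
    ultimately show ?thesis by (simp add: has_vector_derivative_def)
  qed
  \<comment> \<open>Outside the circle mu has slope 1 and the antilinear coefficient vanishes;
    inside, the slope is -1 and the coefficients have ratio E/s. Returning from h/z to h multiplies
    them by 1/z and 1/cnj z, which have equal modulus.\<close>
  obtain A C where AC: "\<And>h. D h = A * (h / z) + C * cnj (h / z)" "cmod C \<le> k * cmod A"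
  proof (cases "ln (cmod z) > 0")
    case True
    hence "dmu T (Re u) = 1" using dmu_right[OF T(1), of "Re u"] T u by simp
    hence "D h = (Lam T u * (s - E (cT T u) (vT T u))) * (h / z) + 0 * cnj (h / z)" for h
      unfolding D_def dPhi_def pdx_def pdy_def
      by (subst (3) complex_eq[of "h / z"]) (simp add: algebra_simps)
    thus ?thesis using that[of "Lam T u * (s - E (cT T u) (vT T u))" 0] k_ge by simp
  next
    case False
    hence "dmu T (Re u) = -1" using dmu_left[OF T(1), of "Re u"] T u by simp
    hence pd: "pdx T u = Lam T u * (s + E (cT T u) (vT T u))" by (simp add: pdx_def algebra_simps)
    have "D h = (Lam T u * s) * (h / z) + (Lam T u * E (cT T u) (vT T u)) * cnj (h / z)" for h
    proof -
      define w where "w = h / z"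
      have w: "w = of_real (Re w) + \<i> * of_real (Im w)" "cnj w = of_real (Re w) - \<i> * of_real (Im w)"
        by (simp_all add: complex_eq_iff)
      show ?thesis unfolding D_def dPhi_def pd pdy_def w_def[symmetric] w(2)
        by (subst (3) w(1)) (simp add: algebra_simps)
    qed
    moreover have "cmod (Lam T u * E (cT T u) (vT T u)) \<le> k * cmod (Lam T u * s)"
      using mult_left_mono[OF E_le[OF adm(3,1,2,4)], of "cmod (Lam T u)"] by (simp add: norm_mult mult_ac)
    ultimately show ?thesis using that by blast
  qed
  have px: "D 1 = A / z + C / cnj z" and py: "D \<i> = \<i> * A / z - \<i> * C / cnj z"
    by (simp_all add: AC(1) mult.commute)
  have "(D 1 + \<i> * D \<i>) / 2 = C / cnj z" "(D 1 - \<i> * D \<i>) / 2 = A / z"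
    unfolding px py by (simp_all add: algebra_simps add_divide_distrib[symmetric])
  moreover have "cmod C \<le> l * cmod A" using AC(2) mult_right_mono[OF l, of "cmod A"] by simp
  ultimately have "cmod ((D 1 + \<i> * D \<i>) / 2) \<le> l * cmod ((D 1 - \<i> * D \<i>) / 2)"
    by (simp add: norm_divide divide_right_mono)
  thus ?thesis using dir[of 1] dir[of \<i>] by auto
qed

text \<open>The rotation \<eta> lets one argument serve both families of lines: it is 1 for
  horizontal lines and \<i> for vertical ones.\<close>

lemma F_along_line:
  assumes D: "(F has_derivative D) (at (\<eta> * Complex t y))" and \<eta>: "cmod \<eta> = 1"
    and le: "\<And>h. cmod (D h) \<le> N * cmod h"
  shows "\<exists>D'. ((\<lambda>t. F (\<eta> * Complex t y)) has_vector_derivative D') (at t) \<and> norm D' \<le> N"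
proof -
  have "((\<lambda>t. \<eta> * (complex_of_real t + \<i> * of_real y)) has_derivative (\<lambda>h. h *\<^sub>R \<eta>)) (at t)"
    by (auto intro!: derivative_eq_intros simp: scaleR_conv_of_real)
  hence "((\<lambda>t. \<eta> * Complex t y) has_derivative (\<lambda>h. h *\<^sub>R \<eta>)) (at t)" by (simp add: Complex_eq)
  hence "((\<lambda>t. F (\<eta> * Complex t y)) has_derivative (\<lambda>h. D (h *\<^sub>R \<eta>))) (at t)"
    using D by (rule has_derivative_compose)
  moreover have "D (h *\<^sub>R \<eta>) = h *\<^sub>R D \<eta>" for h by (rule linear_scale[OF has_derivative_linear[OF D]])
  ultimately show ?thesis using le[of \<eta>] \<eta> by (intro exI[of _ "D \<eta>"]) (simp add: has_vector_derivative_def)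
qed

text \<open>Away from the unit circle \<open>F\<close> is \<open>C\<^sup>1\<close>; a line crossing the circle transversally sees an
  integrable singularity of the derivative.\<close>
lemma F_abs_cont_on_line:
  assumes \<eta>: "cmod \<eta> = 1" and y: "y \<noteq> 0" "\<bar>y\<bar> \<noteq> 1" and cd: "c \<le> d"
  shows "abs_cont_on_interval (\<lambda>t. F (\<eta> * Complex t y)) c d"
proof (rule abs_cont_on_interval_local[OF cd])
  fix t0 :: real
  let ?f = "\<lambda>t. F (\<eta> * Complex t y)"
  have cf: "continuous_on A ?f" for A
    unfolding Complex_eq by (intro continuous_on_compose2[OF F_cont] continuous_intros) auto
  define z0 where "z0 = \<eta> * Complex t0 y"
  have n: "cmod (\<eta> * Complex t y) = sqrt (t^2 + y^2)" for t
    by (simp only: norm_mult \<eta> mult_1 complex_norm)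
  have nz: "\<eta> * Complex t y \<noteq> 0" for t
  proof -
    have "\<eta> \<noteq> 0" using \<eta> by auto
    thus ?thesis using y(1) by (simp add: complex_eq_iff[of "Complex t y"])
  qed
  have dst: "dist (\<eta> * Complex t y) z0 = \<bar>t - t0\<bar>" for t
  proof -
    have "\<eta> * Complex t y - z0 = \<eta> * of_real (t - t0)" by (simp add: z0_def Complex_eq algebra_simps)
    thus ?thesis using \<eta> by (simp only: dist_norm norm_mult norm_of_real mult_1)
  qed
  show "\<exists>\<delta>>0. \<forall>a b. a \<le> t0 \<and> t0 \<le> b \<and> b - a < \<delta> \<longrightarrow> abs_cont_on_interval ?f a b"
  proof (cases "cmod z0 = 1")
    case False
    obtain r M where r: "r > 0"
      "\<And>z. z \<in> ball z0 r \<Longrightarrow> \<exists>D. (F has_derivative D) (at z) \<and> (\<forall>h. cmod (D h) \<le> M * cmod h)"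
      using F_deriv_locally_bounded[OF nz[of t0, folded z0_def] False] by blast
    show ?thesis
    proof (intro exI[of _ r] conjI allI impI r(1))
      fix a b assume ab: "a \<le> t0 \<and> t0 \<le> b \<and> b - a < r"
      show "abs_cont_on_interval ?f a b"
      proof (rule abs_cont_on_interval_bounded_derivative[OF _ cf])
        show "a \<le> b" using ab by simp
        fix t assume t: "a < t" "t < b"
        have "\<bar>t - t0\<bar> < r" using t ab by linarith
        hence "\<eta> * Complex t y \<in> ball z0 r" using dst[of t] by (simp add: dist_commute)
        from r(2)[OF this] obtain D where "(F has_derivative D) (at (\<eta> * Complex t y))" "\<And>h. cmod (D h) \<le> M * cmod h" by blast
        thus "\<exists>D. (?f has_vector_derivative D) (at t) \<and> norm D \<le> M" using F_along_line \<eta> by blast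
      qed
    qed
  next
    case True
    hence t0y: "t0^2 + y^2 = 1" using n[of t0] by (simp add: z0_def)
    \<comment> \<open>|y| = 1 is tangency to the circle; otherwise t0 is nonzero and ln |z| vanishes
      only to first order at t0.\<close>
    have t00: "t0 \<noteq> 0"
    proof
      assume "t0 = 0"
      hence "y^2 = 1" using t0y by simp
      thus False using y(2) by (simp add: abs_square_eq_1)
    qed
    obtain \<beta> C x0 where B: "0 \<le> \<beta>" "\<beta> < 1" "C > 0" "x0 > 0" "x0 \<le> 1"
      "\<And>z. 0 < \<bar>ln (cmod z)\<bar> \<Longrightarrow> \<bar>ln (cmod z)\<bar> \<le> x0 \<Longrightarrow> z \<noteq> 0 \<Longrightarrow>
        \<exists>D. (F has_derivative D) (at z) \<and> (\<forall>h. cmod (D h) \<le> C * \<bar>ln (cmod z)\<bar> powr -\<beta> * cmod h)"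
      using F_deriv_near_circle by blast
    have "isCont (\<lambda>z. \<bar>ln (cmod z)\<bar>) z0"
      by (intro continuous_intros) (use nz[of t0] in \<open>auto simp: z0_def\<close>)
    hence "\<exists>d>0. \<forall>z. dist z z0 < d \<longrightarrow> dist \<bar>ln (cmod z)\<bar> \<bar>ln (cmod z0)\<bar> < x0"
      using B(4) unfolding continuous_at_eps_delta by blast
    then obtain d where d: "d > 0" "\<And>z. dist z z0 < d \<Longrightarrow> \<bar>ln (cmod z)\<bar> < x0"
      using True by auto
    define \<delta> where "\<delta> = min d \<bar>t0\<bar>"
    have \<delta>: "\<delta> > 0" "\<delta> \<le> d" "\<delta> \<le> \<bar>t0\<bar>" using d t00 by (auto simp: \<delta>_def)
    \<comment> \<open>Comes from the transversality estimate |ln |z|| >= |t0||t - t0|/(4e), which is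
      raised to the power -\<beta> below.\<close>
    define C' where "C' = C * (\<bar>t0\<bar> / (4 * exp 1)) powr -\<beta>"
    have C': "C' \<ge> 0" using B by (simp add: C'_def)
    have der: "\<exists>D. (?f has_vector_derivative D) (at t) \<and> norm D \<le> C' * \<bar>t - t0\<bar> powr -\<beta>"
      if t: "\<bar>t - t0\<bar> < \<delta>" "t \<noteq> t0" for t
    proof -
      define z where "z = \<eta> * Complex t y"
      have z0: "z \<noteq> 0" using nz by (simp add: z_def)
      have lnx: "\<bar>ln (cmod z)\<bar> < x0" using d(2)[of z] dst[of t] t \<delta> by (simp add: z_def)
      have "ln (cmod z) \<le> 1" using lnx B(5) by linarith
      hence "exp (ln (cmod z)) \<le> exp 1" by simp
      hence ze: "cmod z \<le> exp 1" using z0 by simp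
      have "\<bar>t0\<bar> \<le> \<bar>t + t0\<bar>" using t(1) \<delta>(3) by linarith
      hence "\<bar>t - t0\<bar> * \<bar>t0\<bar> \<le> \<bar>t - t0\<bar> * \<bar>t + t0\<bar>" by (intro mult_left_mono) auto
      also have "\<dots> = \<bar>t^2 - t0^2\<bar>" by (simp add: abs_mult[symmetric] power2_eq_square algebra_simps)
      also have "t^2 - t0^2 = (cmod z)^2 - 1"
      proof -
        have "(cmod z)^2 = t^2 + y^2" unfolding z_def n by simp
        thus ?thesis using t0y by simp
      qed
      also have "\<bar>(cmod z)^2 - 1\<bar> = (cmod z + 1) * \<bar>cmod z - 1\<bar>"
      proof -
        have "(cmod z)^2 - 1 = (cmod z + 1) * (cmod z - 1)" by (simp add: power2_eq_square algebra_simps)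
        thus ?thesis by (simp add: abs_mult)
      qed
      also have "\<dots> \<le> 4 * (exp 1 * \<bar>ln (cmod z)\<bar>)"
      proof (intro mult_mono)
        have "exp 1 \<le> (3::real)" by (rule exp_le)
        thus "cmod z + 1 \<le> 4" using ze by simp
        show "\<bar>cmod z - 1\<bar> \<le> exp 1 * \<bar>ln (cmod z)\<bar>" by (rule ln_ge_dist_one) (use z0 ze in auto)
      qed auto
      finally have low: "\<bar>t0\<bar> / (4 * exp 1) * \<bar>t - t0\<bar> \<le> \<bar>ln (cmod z)\<bar>" by (simp add: field_simps)
      have pos: "0 < \<bar>t0\<bar> / (4 * exp 1) * \<bar>t - t0\<bar>" using t00 t by simp
      hence "0 < \<bar>ln (cmod z)\<bar>" using low by linarith
      then obtain D where D: "(F has_derivative D) (at z)" "\<And>h. cmod (D h) \<le> C * \<bar>ln (cmod z)\<bar> powr -\<beta> * cmod h"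
        using B(6)[of z] lnx z0 by auto
      have "\<bar>ln (cmod z)\<bar> powr -\<beta> \<le> (\<bar>t0\<bar> / (4 * exp 1) * \<bar>t - t0\<bar>) powr -\<beta>"
        by (rule powr_mono2') (use B pos low in auto)
      also have "\<dots> = (\<bar>t0\<bar> / (4 * exp 1)) powr -\<beta> * \<bar>t - t0\<bar> powr -\<beta>"
        by (rule powr_mult)
      finally have "C * \<bar>ln (cmod z)\<bar> powr -\<beta> \<le> C' * \<bar>t - t0\<bar> powr -\<beta>"
        using B(3) by (simp add: C'_def mult.assoc)
      moreover obtain D' where "(?f has_vector_derivative D') (at t)" "norm D' \<le> C * \<bar>ln (cmod z)\<bar> powr -\<beta>"
        using F_along_line[OF D(1)[unfolded z_def] \<eta> D(2)[unfolded z_def]] unfolding z_def by blast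
      ultimately show ?thesis by (intro exI[of _ D']) auto
    qed
    show ?thesis
    proof (intro exI[of _ \<delta>] conjI allI impI \<delta>(1))
      fix a b assume ab: "a \<le> t0 \<and> t0 \<le> b \<and> b - a < \<delta>"
      have left: "abs_cont_on_interval ?f a t0"
        by (rule abs_cont_on_interval_endpoint_singularity[OF _ _ cf der C' B(1,2)]) (use ab in auto)
      have right: "abs_cont_on_interval ?f t0 b"
        by (rule abs_cont_on_interval_endpoint_singularity[OF _ _ cf der C' B(1,2)]) (use ab in auto)
      show "abs_cont_on_interval ?f a b" using abs_cont_on_interval_concat[OF left right] ab by blast
    qed
  qed
qed

lemma F_ACL: "ACL_on F UNIV"
proof -
  have fin: "finite A \<Longrightarrow> AE y in lborel. y \<notin> A" for A :: "real set"
    by (intro AE_not_in finite_imp_null_set_lborel)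
  have "AE y in lborel. y \<notin> {0, 1, -1 :: real}" by (rule fin) simp
  hence 1: "AE y in lborel. \<forall>c d. c \<le> d \<and> (\<forall>t\<in>{c..d}. Complex t y \<in> UNIV) \<longrightarrow> abs_cont_on_interval (\<lambda>t. F (Complex t y)) c d"
  proof (rule AE_mp, intro AE_I2 impI allI)
    fix y c d :: real assume "y \<notin> {0, 1, -1}" "c \<le> d \<and> (\<forall>t\<in>{c..d}. Complex t y \<in> UNIV)"
    thus "abs_cont_on_interval (\<lambda>t. F (Complex t y)) c d"
      using F_abs_cont_on_line[of 1 y c d] by auto
  qed
  have "AE x in lborel. x \<notin> {0, 1, -1 :: real}" by (rule fin) simp
  hence 2: "AE x in lborel. \<forall>c d. c \<le> d \<and> (\<forall>t\<in>{c..d}. Complex x t \<in> UNIV) \<longrightarrow> abs_cont_on_interval (\<lambda>t. F (Complex x t)) c d"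
  proof (rule AE_mp, intro AE_I2 impI allI)
    fix x c d :: real assume x: "x \<notin> {0, 1, -1}" "c \<le> d \<and> (\<forall>t\<in>{c..d}. Complex x t \<in> UNIV)"
    have "\<i> * Complex t (- x) = Complex x t" for t by (simp add: complex_eq_iff)
    thus "abs_cont_on_interval (\<lambda>t. F (Complex x t)) c d"
      using F_abs_cont_on_line[of \<i> "- x" c d] x by auto
  qed
  show ?thesis using 1 2 by (simp add: ACL_on_def)
qed

lemma F_qc:
  assumes l: "k \<le> l"
  shows "qc_on l F UNIV"
proof -
  have "closed (insert 0 (sphere (0::complex) 1))" by (intro closed_insert closed_sphere)
  moreover have "negligible (insert 0 (sphere (0::complex) 1))"
    using negligible_sphere[of "0::complex" 1] by (simp add: negligible_insert)
  ultimately have "insert 0 (sphere (0::complex) 1) \<in> null_sets lborel"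
    by (metis negligible_iff_null_sets null_sets_completion_iff borel_closed sets_lborel)
  hence "AE z in lborel. z \<notin> insert 0 (sphere (0::complex) 1)" by (rule AE_not_in)
  hence "beltrami_bound_on l F UNIV" unfolding beltrami_bound_on_def
    by (rule AE_mp) (intro AE_I2 impI F_beltrami l, auto)
  moreover have "range F = UNIV" using F_homeomorphism by (metis homeomorphism_image1)
  ultimately show ?thesis using F_ACL F_homeomorphism by (simp add: qc_on_def)
qed

text \<open>For |w| < 1 the point 1/w lies where F = g, so the chart map is the holomorphic function
  \<open>J\<close>.\<close>

lemma F_qc_infinity:
  assumes l: "0 \<le> l"
  shows "qc_on l (\<lambda>w. if w = 0 then 0 else inverse (F (inverse w))) (ball 0 1)"
proof (rule holomorphic_imp_qc_on[OF _ open_ball _ l])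
  show "(\<lambda>w. if w = 0 then 0 else inverse (F (inverse w))) holomorphic_on ball 0 1"
  proof (rule holomorphic_transform[OF J_hol])
    fix w :: complex assume w: "w \<in> ball 0 1"
    show "J w = (if w = 0 then 0 else inverse (F (inverse w)))"
    proof (cases "w = 0")
      case False
      hence "1 < cmod (inverse w)" using w by (simp add: norm_inverse one_less_inverse)
      thus ?thesis using J_eq[OF w False] F_outside False by simp
    qed (simp add: J_def)
  qed
  have nz: "F z \<noteq> 0" if "z \<noteq> 0" for z using F_inj that F_0 by (metis injD)
  show "inj_on (\<lambda>w. if w = 0 then 0 else inverse (F (inverse w))) (ball 0 1)"
  proof (rule inj_onI)
    fix x y assume "(if x = 0 then 0 else inverse (F (inverse x))) = (if y = 0 then 0 else inverse (F (inverse y)))"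
    thus "x = y" using nz[of "inverse x"] nz[of "inverse y"] injD[OF F_inj, of "inverse x" "inverse y"]
      by (auto split: if_splits)
  qed
qed

text \<open>After clearing the denominator and cancelling 1 - k^2 the claim becomes k|s| <= ka +
  |b|, which follows from |s| <= a + |b|.\<close>

lemma k_le_dilatation:
  "k \<le> (2 * k * a + (1 - k\<^sup>2) * \<bar>b\<bar>) / ((1 + k\<^sup>2) * a + (1 - k\<^sup>2) * cmod s)"
proof -
  have k2: "k\<^sup>2 < 1" using power_strict_mono[OF k_lt k_ge, of 2] by simp
  have pos: "(1 + k\<^sup>2) * a + (1 - k\<^sup>2) * cmod s > 0"
  proof (rule add_pos_pos)
    show "(1 + k\<^sup>2) * a > 0" using add_pos_nonneg[of 1 "k\<^sup>2"] by (intro mult_pos_pos) simp_all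
    show "(1 - k\<^sup>2) * cmod s > 0" using k2 by simp
  qed
  have "cmod s \<le> a + \<bar>b\<bar>" using cmod_le[of s] by simp
  hence "k * cmod s \<le> k * (a + \<bar>b\<bar>)" using k_ge by (rule mult_left_mono)
  also have "\<dots> \<le> k * a + 1 * \<bar>b\<bar>"
    unfolding distrib_left using k_lt by (intro add_left_mono mult_right_mono) auto
  finally have "(1 - k\<^sup>2) * (k * cmod s) \<le> (1 - k\<^sup>2) * (k * a + \<bar>b\<bar>)" using k2 by (intro mult_left_mono) auto
  hence "k * ((1 + k\<^sup>2) * a + (1 - k\<^sup>2) * cmod s) \<le> 2 * k * a + (1 - k\<^sup>2) * \<bar>b\<bar>"
    by (simp add: algebra_simps)
  thus ?thesis using pos by (simp add: pos_le_divide_eq)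
qed

end

theorem theorem3:
  fixes a b k :: real and s :: complex and g :: "complex \<Rightarrow> complex"
  assumes s_def: "s = Complex a b"
    and a_ge: "a \<ge> 1"
    and k_ge: "0 \<le> k" and k_lt: "k < 1"
    and bs: "cmod (of_real b / s) \<le> k"
    and g_hol: "g holomorphic_on {z. 1 < cmod z}"
    and g_exp: "\<exists>\<phi>. \<phi> holomorphic_on ball 0 1 \<and> \<phi> 0 = 0 \<and>
                 (\<forall>w. 0 < cmod w \<and> cmod w < 1 \<longrightarrow> g (inverse w) = inverse w + \<phi> w)"
    and g_defined: "\<forall>z. 1 < cmod z \<longrightarrow> g z \<noteq> 0 \<and> deriv g z \<noteq> 0"
    and ineq: "\<forall>z. 1 < cmod z \<longrightarrow>
       cmod (\<i> * of_real b + of_real ((1 - (cmod z)\<^sup>2) * a) *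
               ((1 - s) * (1 - z * deriv g z / g z) - s * (z * deriv (deriv g) z / deriv g z)))
         \<le> a * k * cmod s - \<bar>b\<bar> * (a - 1)"
  shows "\<exists>F. qc_automorphism_extending
              ((2 * k * a + (1 - k\<^sup>2) * \<bar>b\<bar>) / ((1 + k\<^sup>2) * a + (1 - k\<^sup>2) * cmod s)) g F"
proof -
  obtain \<phi> where \<phi>: "\<phi> holomorphic_on ball 0 1" "\<phi> 0 = 0"
     "\<And>w. 0 < cmod w \<Longrightarrow> cmod w < 1 \<Longrightarrow> g (inverse w) = inverse w + \<phi> w"
    using g_exp by blast
  have "cmod s > 0" using a_ge by (auto simp: s_def complex_eq_iff)
  hence b_le: "\<bar>b\<bar> \<le> k * cmod (Complex a b)"
    using bs by (simp add: norm_divide s_def[symmetric] pos_divide_le_eq)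
  interpret criterion a b k g \<phi>
  proof
    show "cmod (\<i> * of_real b + of_real ((1 - (cmod z)\<^sup>2) * a) *
         ((1 - Complex a b) * (1 - z * deriv g z / g z) - Complex a b * (z * deriv (deriv g) z / deriv g z)))
         \<le> a * k * cmod (Complex a b) - \<bar>b\<bar> * (a - 1)" if "1 < cmod z" for z
      using ineq[rule_format, OF that] unfolding s_def .
  qed (use a_ge k_ge k_lt b_le g_hol \<phi> g_defined in auto)
  let ?l = "(2 * k * a + (1 - k\<^sup>2) * \<bar>b\<bar>) / ((1 + k\<^sup>2) * a + (1 - k\<^sup>2) * cmod s)"
  have l: "k \<le> ?l" using k_le_dilatation unfolding \<open>s = Complex a b\<close> criterion.s_def[OF criterion_axioms] .
  hence "0 \<le> ?l" using k_ge by linarith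
  hence "qc_automorphism_extending ?l g F"
    unfolding qc_automorphism_extending_def
    using F_homeomorphism F_qc[OF l] F_qc_infinity F_outside by blast
  thus ?thesis by blast
qed

end
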